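(* Let $\mathbb{K}$ be a field of characteristic $0$. For a based digraph $G^*=(G_0,G_1,x)$ let $\mathcal{P}_x(G)$ be the $\mathbb{K}$-algebra generated by the iterated path integrals $\int_x\omega_1\cdots\omega_r$, let $\mathcal{Q}_x(G)$ be the $\mathbb{K}$-algebra generated by the iterated loop integrals $\oint_x\omega_1\cdots\omega_r$ (where $\omega_1,\ldots,\omega_r$ are $1$-forms on $G$), and let $\pi^1_x(G)$ be the sub-$\mathbb{K}$-algebra of $\mathcal{Q}_x(G)$ consisting of all iterated loop integrals that are independent of $C_\partial$-homotopy of loops. Then there exist contravariant functors, acting on morphisms by pullback $f\mapsto f^*$ (on the homotopy category, $[f]\mapsto f^*$), $$\mathcal{P}\colon \underline{\mathrm{Dig}^*}\to\underline{\mathcal{A}},\quad (G_0,G_1,x)\mapsto\mathcal{P}_x(G),$$ $$\mathcal{Q}\colon \underline{\mathrm{Dig}^*}\to\underline{\mathcal{H}},\quad (G_0,G_1,x)\mapsto\mathcal{Q}_x(G),$$ $$\pi^1\colon \underline{\mathrm{hDig}^*}\to\underline{\mathcal{H}},\quad (G_0,G_1,x)\mapsto\pi^1_x(G),$$ where $\underline{\mathrm{Dig}^*}$ is the category of based digraphs, $\underline{\mathrm{hDig}^*}$ is its homotopy category, and $\underline{\mathcal{A}}$ and $\underline{\mathcal{H}}$ are the categories of $\mathbb{K}$-algebras and of Hopf $\mathbb{K}$-algebras, respectively.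
   Context: A digraph $G=(G_0,G_1)$ has a finite vertex set $G_0$ and arrow set $G_1\subset (G_0\times G_0)\setminus\{(v,v)\}$ (no self-loops; both $u\to v$ and $v\to u$ may be arrows). A digraph map $f\colon G\to H$ is a map $G_0\to H_0$ such that for each arrow $u\to v$ of $G$ either $f(u)=f(v)$ or $f(u)\to f(v)$ is an arrow of $H$. A based digraph is a digraph with a chosen vertex; based digraph maps preserve base vertices. A line digraph $I_n$ ($n\ge 0$) has vertices $0,\ldots,n$ and, for each $0\le i<n$, exactly one of the arrows $i\to i+1$, $i+1\to i$, and no other arrows. A path map on $G$ is a digraph map $\alpha\colon I_n\to G$; it goes from $\alpha(0)$ to $\alpha(n)$; it is a loop at $x$ if $\alpha(0)=\alpha(n)=x$. Integrals. A $1$-form on $G$ is a function $\omega\colon G_1\to\mathbb{K}$. For a path map $\alpha\colon I_n\to G$ and $1\le t\le n$, set $\langle\omega,\alpha_t\rangle=0$ if $\alpha(t-1)=\alpha(t)$; otherwise $\langle\omega,\alpha_t\rangle=\omega(\alpha(t-1)\to\alpha(t))$ if $(t-1)\to t$ is in $I_n$, and $\langle\omega,\alpha_t\rangle=-\omega(\alpha(t)\to\alpha(t-1))$ if $t\to (t-1)$ is in $I_n$. With $\tau(t_1,\ldots,t_r)=\prod_{k\ge1}\varphi_k!$, $\varphi_k$ the multiplicity of $k$ in $(t_1,\ldots,t_r)$, define $$\int_\alpha\omega_1\cdots\omega_r=\sum_{1\le t_1\le\cdots\le t_r\le n}\frac{\prod_{i=1}^r\langle\omega_i,\alpha_{t_i}\rangle}{\tau(t_1,\ldots,t_r)},$$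 and the empty integral ($r=0$) is $1$; for loops it is written $\oint_\alpha$. Algebras. $\int_x\omega_1\cdots\omega_r$ denotes the function $\alpha\mapsto\int_\alpha\omega_1\cdots\omega_r$ on path maps starting at $x$, and $\oint_x\omega_1\cdots\omega_r$ the function $\alpha\mapsto\oint_\alpha\omega_1\cdots\omega_r$ on loops at $x$. $\mathcal{P}_x(G)$ (resp. $\mathcal{Q}_x(G)$) is the algebra of functions generated by these for $r\ge1$, with unit the constant function $1$; the multiplication is the shuffle product $\int_x\omega_1\cdots\omega_r\int_x\omega_{r+1}\cdots\omega_{r+s}=\sum_\sigma\int_x\omega_{\sigma(1)}\cdots\omega_{\sigma(r+s)}$ over permutations $\sigma$ with $\sigma^{-1}(1)<\cdots<\sigma^{-1}(r)$ and $\sigma^{-1}(r+1)<\cdots<\sigma^{-1}(r+s)$ (this is the pointwise product of functions), and similarly for $\oint_x$. The Hopf structure on $\mathcal{Q}_x(G)$ is: counit $u\mapsto u(r_x)$ with $r_x$ the trivial (constant) loop at $x$; comultiplication $\oint_x\omega_1\cdots\omega_r\mapsto\sum_{i=0}^r\oint_x\omega_1\cdots\omega_i\otimes\oint_x\omega_{i+1}\cdots\omega_r$; antipode $\oint_x\omega_1\cdots\omega_r\mapsto(-1)^r\oint_x\omega_r\cdots\omega_1$. The Hopf structure on $\pi^1_x(G)$ is obtained by restriction. Pullback. For a based digraph map $f\colon(G,x)\to(H,y)$ and a $1$-form $\omega$ on $H$, $(f^*\omega)(u\to v)=\omega(f(u)\to f(v))$ if $f(u)\ne f(v)$ and $0$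 otherwise; $f^*\int_y\omega_1\cdots\omega_r=\int_x f^*\omega_1\cdots f^*\omega_r$, and similarly for $\oint$. $C_\partial$-homotopy. A shrinking map $h\colon I_n\to I_m$ ($m\le n$) is a digraph map with $h(0)=0$, $h(n)=m$ and $h(i)\le h(j)$ for $i\le j$. The cylinder $C_h$ has vertex set $(I_n)_0\sqcup(I_m)_0$ and arrows those of $I_n$ and $I_m$ together with $i\to h(i)$ for all $i\in I_n$; $C_h^-$ is the same with $h(i)\to i$ instead. Path maps $\alpha\colon I_n\to G$, $\beta\colon I_m\to G$ with the same initial vertex and the same final vertex are one-step $C_\partial$-homotopic if for some shrinking map $h$ there is a digraph map from $C_h$ or $C_h^-$ to $G$ restricting to $\alpha$ on $I_n$ and $\beta$ on $I_m$. $C_\partial$-homotopy $\simeq_C$ is the equivalence relation generated by this (all intermediate path maps having the same endpoints). An element $u\in\mathcal{Q}_x(G)$ is independent of $C_\partial$-homotopy if $u(\alpha)=u(\alpha')$ for all loops $\alpha\simeq_C\alpha'$ at $x$; $\pi^1_x(G)$ is the set of all such elements. Homotopy category. The box product $G\Box H$ has vertices $G_0\times H_0$ and arrows $(u,u')\to(v,v')$ when either $u=v$ and $u'\to v'\in H_1$, or $u\to v\in G_1$ and $u'=v'$. Based digraph maps $f,g\colon(G,x)\to(H,y)$ are homotopic if there are a line digraph $I_n$ and a digraph map $F\colon G\Box I_n\to H$ with $F|_{G\Box\{0\}}=f$, $F|_{G\Box\{n\}}=g$ and $F(x,t)=y$ for all $t$. $\underline{\mathrm{hDig}^*}$ has based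 digraphs as objects and homotopy classes of based digraph maps as morphisms. *)

theory Defs
  imports
    "Graph_Theory.Pair_Digraph"
    "HOL-Algebra.Module"
    "HOL-Library.FuncSet"
    "HOL-Library.Poly_Mapping"
begin

section \<open>Based digraphs\<close>

text \<open>
  The locale \<open>pair_digraph\<close> describes exactly the digraphs considered here: finite, with arrows
  given by ordered pairs of vertices, and without loops. Maps out of a digraph are extensional
  functions on its vertex set, so that equality of digraph maps is equality in HOL.
\<close>

type_synonym 'v based_digraph = "'v pair_pre_digraph \<times> 'v"

definition based_digraph :: "'v based_digraph \<Rightarrow> bool" where
  "based_digraph A \<longleftrightarrow> pair_digraph (fst A) \<and> snd A \<in> pverts (fst A)"

definition digraph_maps :: "'v pair_pre_digraph \<Rightarrow> 'w pair_pre_digraph \<Rightarrow> ('v \<Rightarrow> 'w) set" where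
  "digraph_maps G H =
     {f \<in> pverts G \<rightarrow>\<^sub>E pverts H. \<forall>(u, v) \<in> parcs G. f u = f v \<or> (f u, f v) \<in> parcs H}"

definition based_maps :: "'v based_digraph \<Rightarrow> 'w based_digraph \<Rightarrow> ('v \<Rightarrow> 'w) set" where
  "based_maps A B = {f \<in> digraph_maps (fst A) (fst B). f (snd A) = snd B}"

definition line_digraph :: "nat \<Rightarrow> nat pair_pre_digraph \<Rightarrow> bool" where
  "line_digraph n I \<longleftrightarrow>
     pverts I = {0..n} \<and>
     parcs I \<subseteq> (\<Union>i<n. {(i, Suc i), (Suc i, i)}) \<and>
     (\<forall>i<n. (i, Suc i) \<in> parcs I \<longleftrightarrow> (Suc i, i) \<notin> parcs I)"

text \<open>A path map carries its line digraph, since integrals depend on the directions of its arrows.\<close>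

record 'v path_map =
  path_len :: nat
  path_line :: "nat pair_pre_digraph"
  path_fun :: "nat \<Rightarrow> 'v"

definition path_maps :: "'v pair_pre_digraph \<Rightarrow> 'v path_map set" where
  "path_maps G =
     {\<alpha>. line_digraph (path_len \<alpha>) (path_line \<alpha>) \<and> path_fun \<alpha> \<in> digraph_maps (path_line \<alpha>) G}"

definition paths_from :: "'v based_digraph \<Rightarrow> 'v path_map set" where
  "paths_from A = {\<alpha> \<in> path_maps (fst A). path_fun \<alpha> 0 = snd A}"

definition loops_at :: "'v based_digraph \<Rightarrow> 'v path_map set" where
  "loops_at A =
     {\<alpha> \<in> path_maps (fst A). path_fun \<alpha> 0 = snd A \<and> path_fun \<alpha> (path_len \<alpha>) = snd A}"

definition trivial_loop :: "'v \<Rightarrow> 'v path_map" where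
  "trivial_loop x =
     \<lparr>path_len = 0, path_line = \<lparr>pverts = {0}, parcs = {}\<rparr>, path_fun = (\<lambda>i\<in>{0}. x)\<rparr>"


section \<open>Iterated integrals\<close>

definition one_forms :: "'v pair_pre_digraph \<Rightarrow> ('v \<times> 'v \<Rightarrow> 'k) set" where
  "one_forms G = parcs G \<rightarrow>\<^sub>E UNIV"

definition step_value :: "('v \<times> 'v \<Rightarrow> 'k::field_char_0) \<Rightarrow> 'v path_map \<Rightarrow> nat \<Rightarrow> 'k" where
  "step_value \<omega> \<alpha> t =
     (if path_fun \<alpha> (t - 1) = path_fun \<alpha> t then 0
      else if (t - 1, t) \<in> parcs (path_line \<alpha>) then \<omega> (path_fun \<alpha> (t - 1), path_fun \<alpha> t)
      else - \<omega> (path_fun \<alpha> t, path_fun \<alpha> (t - 1)))"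

definition path_integral :: "('v \<times> 'v \<Rightarrow> 'k::field_char_0) list \<Rightarrow> 'v path_map \<Rightarrow> 'k" where
  "path_integral \<omega>s \<alpha> =
     (\<Sum>ts | length ts = length \<omega>s \<and> sorted ts \<and> set ts \<subseteq> {1..path_len \<alpha>}.
        (\<Prod>i<length \<omega>s. step_value (\<omega>s ! i) \<alpha> (ts ! i)) / (\<Prod>k\<in>set ts. fact (count_list ts k)))"

definition pullback_form ::
  "'v pair_pre_digraph \<Rightarrow> ('v \<Rightarrow> 'w) \<Rightarrow> ('w \<times> 'w \<Rightarrow> 'k::field_char_0) \<Rightarrow> 'v \<times> 'v \<Rightarrow> 'k" where
  "pullback_form G f \<omega> = (\<lambda>(u, v)\<in>parcs G. if f u = f v then 0 else \<omega> (f u, f v))"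


section \<open>Algebras over the field \<open>'k\<close>\<close>

text \<open>
  The locale \<open>algebra\<close> of HOL-Algebra only covers commutative algebras; these need not be.
\<close>

definition ground_algebra :: "('k::field, 'k) module" where
  "ground_algebra =
     \<lparr>carrier = UNIV, monoid.mult = (*), one = 1, zero = 0, add = (+), module.smult = (*)\<rparr>"

definition k_algebra :: "('k::field, 'a, 'm) module_scheme \<Rightarrow> bool" where
  "k_algebra A \<longleftrightarrow>
     ring A \<and> module (ground_algebra :: ('k, 'k) module) A \<and>
     (\<forall>c. \<forall>a\<in>carrier A. \<forall>b\<in>carrier A.
        (c \<odot>\<^bsub>A\<^esub> a) \<otimes>\<^bsub>A\<^esub> b = c \<odot>\<^bsub>A\<^esub> (a \<otimes>\<^bsub>A\<^esub> b) \<and>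
        a \<otimes>\<^bsub>A\<^esub> (c \<odot>\<^bsub>A\<^esub> b) = c \<odot>\<^bsub>A\<^esub> (a \<otimes>\<^bsub>A\<^esub> b))"

definition linear_maps ::
  "('k::field, 'a, 'm) module_scheme \<Rightarrow> ('k, 'b, 'n) module_scheme \<Rightarrow> ('a \<Rightarrow> 'b) set" where
  "linear_maps A B =
     {\<phi>. \<phi> ` carrier A \<subseteq> carrier B \<and>
        (\<forall>a\<in>carrier A. \<forall>a'\<in>carrier A. \<phi> (a \<oplus>\<^bsub>A\<^esub> a') = \<phi> a \<oplus>\<^bsub>B\<^esub> \<phi> a') \<and>
        (\<forall>c. \<forall>a\<in>carrier A. \<phi> (c \<odot>\<^bsub>A\<^esub> a) = c \<odot>\<^bsub>B\<^esub> \<phi> a)}"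

definition algebra_homs ::
  "('k::field, 'a, 'm) module_scheme \<Rightarrow> ('k, 'b, 'n) module_scheme \<Rightarrow> ('a \<Rightarrow> 'b) set" where
  "algebra_homs A B = ring_hom A B \<inter> linear_maps A B"

definition function_algebra :: "'p set \<Rightarrow> ('k::field, 'p \<Rightarrow> 'k) module" where
  "function_algebra X =
     \<lparr>carrier = X \<rightarrow>\<^sub>E UNIV,
      monoid.mult = (\<lambda>u v. \<lambda>\<alpha>\<in>X. u \<alpha> * v \<alpha>), one = (\<lambda>\<alpha>\<in>X. 1),
      zero = (\<lambda>\<alpha>\<in>X. 0), add = (\<lambda>u v. \<lambda>\<alpha>\<in>X. u \<alpha> + v \<alpha>),
      module.smult = (\<lambda>c u. \<lambda>\<alpha>\<in>X. c * u \<alpha>)\<rparr>"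

inductive_set generated_subalgebra :: "('k::field, 'a, 'm) module_scheme \<Rightarrow> 'a set \<Rightarrow> 'a set"
  for A S where
  one: "\<one>\<^bsub>A\<^esub> \<in> generated_subalgebra A S"
| incl: "a \<in> S \<Longrightarrow> a \<in> generated_subalgebra A S"
| add: "a \<in> generated_subalgebra A S \<Longrightarrow> b \<in> generated_subalgebra A S \<Longrightarrow>
    a \<oplus>\<^bsub>A\<^esub> b \<in> generated_subalgebra A S"
| mult: "a \<in> generated_subalgebra A S \<Longrightarrow> b \<in> generated_subalgebra A S \<Longrightarrow>
    a \<otimes>\<^bsub>A\<^esub> b \<in> generated_subalgebra A S"
| smult: "a \<in> generated_subalgebra A S \<Longrightarrow> c \<odot>\<^bsub>A\<^esub> a \<in> generated_subalgebra A S"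


section \<open>The algebras of iterated path and loop integrals\<close>

definition integral_on :: "'v path_map set \<Rightarrow> ('v \<times> 'v \<Rightarrow> 'k::field_char_0) list \<Rightarrow> 'v path_map \<Rightarrow> 'k" where
  "integral_on X \<omega>s = restrict (path_integral \<omega>s) X"

abbreviation path_integral_from ::
  "'v based_digraph \<Rightarrow> ('v \<times> 'v \<Rightarrow> 'k::field_char_0) list \<Rightarrow> 'v path_map \<Rightarrow> 'k" where
  "path_integral_from A \<equiv> integral_on (paths_from A)"

abbreviation loop_integral_at ::
  "'v based_digraph \<Rightarrow> ('v \<times> 'v \<Rightarrow> 'k::field_char_0) list \<Rightarrow> 'v path_map \<Rightarrow> 'k" where
  "loop_integral_at A \<equiv> integral_on (loops_at A)"

text \<open>Multiplication is the pointwise one, which by the shuffle formula is the shuffle product.\<close>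

definition integral_algebra ::
  "'v pair_pre_digraph \<Rightarrow> 'v path_map set \<Rightarrow> ('k::field_char_0, 'v path_map \<Rightarrow> 'k) module" where
  "integral_algebra G X =
     (function_algebra X)
       \<lparr>carrier := generated_subalgebra (function_algebra X)
          {integral_on X \<omega>s |\<omega>s. \<omega>s \<noteq> [] \<and> set \<omega>s \<subseteq> one_forms G}\<rparr>"

definition path_algebra :: "'v based_digraph \<Rightarrow> ('k::field_char_0, 'v path_map \<Rightarrow> 'k) module" where
  "path_algebra A = integral_algebra (fst A) (paths_from A)"

definition loop_algebra :: "'v based_digraph \<Rightarrow> ('k::field_char_0, 'v path_map \<Rightarrow> 'k) module" where
  "loop_algebra A = integral_algebra (fst A) (loops_at A)"


section \<open>\<open>C\<^sub>\<partial>\<close>-homotopy of path maps\<close>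

definition shrinking_map ::
  "nat \<Rightarrow> nat pair_pre_digraph \<Rightarrow> nat \<Rightarrow> nat pair_pre_digraph \<Rightarrow> (nat \<Rightarrow> nat) \<Rightarrow> bool" where
  "shrinking_map n I m J h \<longleftrightarrow>
     m \<le> n \<and> h \<in> digraph_maps I J \<and> h 0 = 0 \<and> h n = m \<and>
     (\<forall>i\<in>pverts I. \<forall>j\<in>pverts I. i \<le> j \<longrightarrow> h i \<le> h j)"

definition cylinder ::
  "nat pair_pre_digraph \<Rightarrow> nat pair_pre_digraph \<Rightarrow> (nat \<Rightarrow> nat) \<Rightarrow> (nat + nat) pair_pre_digraph" where
  "cylinder I J h =
     \<lparr>pverts = pverts I <+> pverts J,
      parcs = map_prod Inl Inl ` parcs I \<union> map_prod Inr Inr ` parcs J \<union>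
        {(Inl i, Inr (h i)) |i. i \<in> pverts I}\<rparr>"

definition inverse_cylinder ::
  "nat pair_pre_digraph \<Rightarrow> nat pair_pre_digraph \<Rightarrow> (nat \<Rightarrow> nat) \<Rightarrow> (nat + nat) pair_pre_digraph" where
  "inverse_cylinder I J h =
     \<lparr>pverts = pverts I <+> pverts J,
      parcs = map_prod Inl Inl ` parcs I \<union> map_prod Inr Inr ` parcs J \<union>
        {(Inr (h i), Inl i) |i. i \<in> pverts I}\<rparr>"

definition one_step_C_homotopic :: "'v pair_pre_digraph \<Rightarrow> 'v path_map \<Rightarrow> 'v path_map \<Rightarrow> bool" where
  "one_step_C_homotopic G \<alpha> \<beta> \<longleftrightarrow>
     \<alpha> \<in> path_maps G \<and> \<beta> \<in> path_maps G \<and>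
     path_fun \<alpha> 0 = path_fun \<beta> 0 \<and>
     path_fun \<alpha> (path_len \<alpha>) = path_fun \<beta> (path_len \<beta>) \<and>
     (\<exists>h. shrinking_map (path_len \<alpha>) (path_line \<alpha>) (path_len \<beta>) (path_line \<beta>) h \<and>
       (\<exists>F \<in> digraph_maps (cylinder (path_line \<alpha>) (path_line \<beta>) h) G \<union>
             digraph_maps (inverse_cylinder (path_line \<alpha>) (path_line \<beta>) h) G.
          (\<forall>i\<in>pverts (path_line \<alpha>). F (Inl i) = path_fun \<alpha> i) \<and>
          (\<forall>j\<in>pverts (path_line \<beta>). F (Inr j) = path_fun \<beta> j)))"

definition C_homotopic :: "'v pair_pre_digraph \<Rightarrow> 'v path_map \<Rightarrow> 'v path_map \<Rightarrow> bool" where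
  "C_homotopic G = equivclp (one_step_C_homotopic G)"

definition pi1_algebra :: "'v based_digraph \<Rightarrow> ('k::field_char_0, 'v path_map \<Rightarrow> 'k) module" where
  "pi1_algebra A =
     (loop_algebra A)
       \<lparr>carrier := {u \<in> carrier (loop_algebra A).
          \<forall>\<alpha>\<in>loops_at A. \<forall>\<alpha>'\<in>loops_at A. C_homotopic (fst A) \<alpha> \<alpha>' \<longrightarrow> u \<alpha> = u \<alpha>'}\<rparr>"


section \<open>Tensor products\<close>

text \<open>
  The tensor product of \<open>A\<close> and \<open>B\<close> is the quotient of the free vector space on
  \<open>carrier A \<times> carrier B\<close> by the bilinearity relations; its elements are cosets. Operations and
  maps are given on arbitrarily chosen representatives.
\<close>

type_synonym ('k, 'a, 'b) tensor = "('a \<times> 'b \<Rightarrow>\<^sub>0 'k) set"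

definition scale_formal :: "'k::field \<Rightarrow> ('z \<Rightarrow>\<^sub>0 'k) \<Rightarrow> ('z \<Rightarrow>\<^sub>0 'k)" where
  "scale_formal c p = Poly_Mapping.map ((*) c) p"

definition formal_tensors ::
  "('k::field, 'a, 'm) module_scheme \<Rightarrow> ('k, 'b, 'n) module_scheme \<Rightarrow> ('a \<times> 'b \<Rightarrow>\<^sub>0 'k) set" where
  "formal_tensors A B = {p. Poly_Mapping.keys p \<subseteq> carrier A \<times> carrier B}"

definition bilinear_relations ::
  "('k::field, 'a, 'm) module_scheme \<Rightarrow> ('k, 'b, 'n) module_scheme \<Rightarrow> ('a \<times> 'b \<Rightarrow>\<^sub>0 'k) set" where
  "bilinear_relations A B =
     {Poly_Mapping.single (a \<oplus>\<^bsub>A\<^esub> a', b) 1 - Poly_Mapping.single (a, b) 1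
        - Poly_Mapping.single (a', b) 1 |a a' b.
        a \<in> carrier A \<and> a' \<in> carrier A \<and> b \<in> carrier B} \<union>
     {Poly_Mapping.single (a, b \<oplus>\<^bsub>B\<^esub> b') 1 - Poly_Mapping.single (a, b) 1
        - Poly_Mapping.single (a, b') 1 |a b b'.
        a \<in> carrier A \<and> b \<in> carrier B \<and> b' \<in> carrier B} \<union>
     {Poly_Mapping.single (c \<odot>\<^bsub>A\<^esub> a, b) 1 - Poly_Mapping.single (a, b) c |c a b.
        a \<in> carrier A \<and> b \<in> carrier B} \<union>
     {Poly_Mapping.single (a, c \<odot>\<^bsub>B\<^esub> b) 1 - Poly_Mapping.single (a, b) c |c a b.
        a \<in> carrier A \<and> b \<in> carrier B}"

definition tensor_class ::
  "('k::field, 'a, 'm) module_scheme \<Rightarrow> ('k, 'b, 'n) module_scheme \<Rightarrow>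
    ('a \<times> 'b \<Rightarrow>\<^sub>0 'k) \<Rightarrow> ('k, 'a, 'b) tensor" where
  "tensor_class A B p =
     {q \<in> formal_tensors A B. q - p \<in> Modules.module.span scale_formal (bilinear_relations A B)}"

definition pure_tensor ::
  "('k::field, 'a, 'm) module_scheme \<Rightarrow> ('k, 'b, 'n) module_scheme \<Rightarrow>
    'a \<Rightarrow> 'b \<Rightarrow> ('k, 'a, 'b) tensor" where
  "pure_tensor A B a b = tensor_class A B (Poly_Mapping.single (a, b) 1)"

definition tensor_rep :: "('k::field, 'a, 'b) tensor \<Rightarrow> ('a \<times> 'b \<Rightarrow>\<^sub>0 'k)" where
  "tensor_rep T = (SOME p. p \<in> T)"

definition tensor_algebra ::
  "('k::field, 'a, 'm) module_scheme \<Rightarrow> ('k, 'b, 'n) module_scheme \<Rightarrow>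
    ('k, ('k, 'a, 'b) tensor) module" where
  "tensor_algebra A B =
     \<lparr>carrier = tensor_class A B ` formal_tensors A B,
      monoid.mult = (\<lambda>S T. tensor_class A B
        (\<Sum>z\<in>Poly_Mapping.keys (tensor_rep S). \<Sum>w\<in>Poly_Mapping.keys (tensor_rep T).
           Poly_Mapping.single (fst z \<otimes>\<^bsub>A\<^esub> fst w, snd z \<otimes>\<^bsub>B\<^esub> snd w)
             (Poly_Mapping.lookup (tensor_rep S) z * Poly_Mapping.lookup (tensor_rep T) w))),
      one = pure_tensor A B \<one>\<^bsub>A\<^esub> \<one>\<^bsub>B\<^esub>,
      zero = tensor_class A B 0,
      add = (\<lambda>S T. tensor_class A B (tensor_rep S + tensor_rep T)),
      module.smult = (\<lambda>c T. tensor_class A B (scale_formal c (tensor_rep T)))\<rparr>"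

text \<open>The linear map out of a tensor product induced by a bilinear map \<open>\<beta>\<close> with values in \<open>V\<close>.\<close>

definition tensor_lift ::
  "('k::field, 'v, 'm) module_scheme \<Rightarrow> ('a \<Rightarrow> 'b \<Rightarrow> 'v) \<Rightarrow> ('k, 'a, 'b) tensor \<Rightarrow> 'v" where
  "tensor_lift V \<beta> T =
     (\<Oplus>\<^bsub>V\<^esub>z\<in>Poly_Mapping.keys (tensor_rep T).
        Poly_Mapping.lookup (tensor_rep T) z \<odot>\<^bsub>V\<^esub> \<beta> (fst z) (snd z))"

definition tensor_map ::
  "('k::field, 'c, 'm) module_scheme \<Rightarrow> ('k, 'd, 'n) module_scheme \<Rightarrow>
    ('a \<Rightarrow> 'c) \<Rightarrow> ('b \<Rightarrow> 'd) \<Rightarrow> ('k, 'a, 'b) tensor \<Rightarrow> ('k, 'c, 'd) tensor" where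
  "tensor_map C D \<phi> \<psi> =
     tensor_lift (tensor_algebra C D) (\<lambda>a b. pure_tensor C D (\<phi> a) (\<psi> b))"

definition tensor_associator ::
  "('k::field, 'a, 'm) module_scheme \<Rightarrow> ('k, 'b, 'n) module_scheme \<Rightarrow> ('k, 'c, 'l) module_scheme \<Rightarrow>
    ('k, ('k, 'a, 'b) tensor, 'c) tensor \<Rightarrow> ('k, 'a, ('k, 'b, 'c) tensor) tensor" where
  "tensor_associator A B C =
     tensor_lift (tensor_algebra A (tensor_algebra B C))
       (\<lambda>T c. tensor_lift (tensor_algebra A (tensor_algebra B C))
         (\<lambda>a b. pure_tensor A (tensor_algebra B C) a (pure_tensor B C b c)) T)"


section \<open>Hopf algebras\<close>

record (overloaded) ('k::zero, 'a) hopf = "('k, 'a) module" +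
  comult :: "'a \<Rightarrow> ('k, 'a, 'a) tensor"
  counit :: "'a \<Rightarrow> 'k"
  antipode :: "'a \<Rightarrow> 'a"

definition hopf_algebra :: "('k::field, 'a) hopf \<Rightarrow> bool" where
  "hopf_algebra H \<longleftrightarrow>
     k_algebra H \<and>
     comult H \<in> algebra_homs H (tensor_algebra H H) \<and>
     counit H \<in> algebra_homs H ground_algebra \<and>
     antipode H \<in> linear_maps H H \<and>
     (\<forall>a\<in>carrier H.
        tensor_associator H H H (tensor_map (tensor_algebra H H) H (comult H) id (comult H a))
          = tensor_map H (tensor_algebra H H) id (comult H) (comult H a) \<and>
        tensor_lift H (\<lambda>b c. counit H b \<odot>\<^bsub>H\<^esub> c) (comult H a) = a \<and>
        tensor_lift H (\<lambda>b c. counit H c \<odot>\<^bsub>H\<^esub> b) (comult H a) = a \<and>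
        tensor_lift H (\<lambda>b c. antipode H b \<otimes>\<^bsub>H\<^esub> c) (comult H a) = counit H a \<odot>\<^bsub>H\<^esub> \<one>\<^bsub>H\<^esub> \<and>
        tensor_lift H (\<lambda>b c. b \<otimes>\<^bsub>H\<^esub> antipode H c) (comult H a) = counit H a \<odot>\<^bsub>H\<^esub> \<one>\<^bsub>H\<^esub>)"

definition hopf_homs :: "('k::field, 'a) hopf \<Rightarrow> ('k, 'b) hopf \<Rightarrow> ('a \<Rightarrow> 'b) set" where
  "hopf_homs H L =
     {\<phi> \<in> algebra_homs H L. \<forall>a\<in>carrier H.
        comult L (\<phi> a) = tensor_map L L \<phi> \<phi> (comult H a) \<and>
        counit L (\<phi> a) = counit H a \<and>
        antipode L (\<phi> a) = \<phi> (antipode H a)}"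

definition hopf_subalgebra :: "('k::field, 'a) hopf \<Rightarrow> ('k, 'a) hopf \<Rightarrow> bool" where
  "hopf_subalgebra L H \<longleftrightarrow> carrier L \<subseteq> carrier H \<and> (\<lambda>a. a) \<in> hopf_homs L H"


section \<open>Categories and contravariant functors\<close>

record ('o, 'm) cat =
  Obj :: "'o set"
  Hom :: "'o \<Rightarrow> 'o \<Rightarrow> 'm set"
  Id :: "'o \<Rightarrow> 'm"
  Comp :: "'o \<Rightarrow> 'o \<Rightarrow> 'o \<Rightarrow> 'm \<Rightarrow> 'm \<Rightarrow> 'm"

text \<open>\<open>Comp C X Y Z g f\<close> is the composite of \<open>f\<close> from \<open>X\<close> to \<open>Y\<close> and \<open>g\<close> from \<open>Y\<close> to \<open>Z\<close>.\<close>

definition category :: "('o, 'm) cat \<Rightarrow> bool" where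
  "category C \<longleftrightarrow>
     (\<forall>X\<in>Obj C. Id C X \<in> Hom C X X) \<and>
     (\<forall>X\<in>Obj C. \<forall>Y\<in>Obj C. \<forall>f\<in>Hom C X Y.
        Comp C X X Y f (Id C X) = f \<and> Comp C X Y Y (Id C Y) f = f) \<and>
     (\<forall>X\<in>Obj C. \<forall>Y\<in>Obj C. \<forall>Z\<in>Obj C. \<forall>f\<in>Hom C X Y. \<forall>g\<in>Hom C Y Z.
        Comp C X Y Z g f \<in> Hom C X Z) \<and>
     (\<forall>X\<in>Obj C. \<forall>Y\<in>Obj C. \<forall>Z\<in>Obj C. \<forall>W\<in>Obj C.
        \<forall>f\<in>Hom C X Y. \<forall>g\<in>Hom C Y Z. \<forall>h\<in>Hom C Z W.
          Comp C X Z W h (Comp C X Y Z g f) = Comp C X Y W (Comp C Y Z W h g) f)"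

definition contravariant_functor ::
  "('o, 'm) cat \<Rightarrow> ('p, 'n) cat \<Rightarrow> ('o \<Rightarrow> 'p) \<Rightarrow> ('o \<Rightarrow> 'o \<Rightarrow> 'm \<Rightarrow> 'n) \<Rightarrow> bool" where
  "contravariant_functor C D F \<Phi> \<longleftrightarrow>
     category C \<and> category D \<and>
     (\<forall>X\<in>Obj C. F X \<in> Obj D) \<and>
     (\<forall>X\<in>Obj C. \<forall>Y\<in>Obj C. \<forall>f\<in>Hom C X Y. \<Phi> X Y f \<in> Hom D (F Y) (F X)) \<and>
     (\<forall>X\<in>Obj C. \<Phi> X X (Id C X) = Id D (F X)) \<and>
     (\<forall>X\<in>Obj C. \<forall>Y\<in>Obj C. \<forall>Z\<in>Obj C. \<forall>f\<in>Hom C X Y. \<forall>g\<in>Hom C Y Z.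
        \<Phi> X Z (Comp C X Y Z g f) = Comp D (F Z) (F Y) (F X) (\<Phi> X Y f) (\<Phi> Y Z g))"

text \<open>
  The vertices of all objects are drawn from one type \<open>'v\<close>, which is arbitrary. Since digraphs are
  finite, every finite family of digraphs has isomorphic copies over any infinite \<open>'v\<close>, such as a
  sum of the given vertex types.
\<close>

definition dig_cat :: "('v based_digraph, 'v \<Rightarrow> 'v) cat" where
  "dig_cat =
     \<lparr>Obj = {A. based_digraph A}, Hom = based_maps,
      Id = (\<lambda>A. restrict id (pverts (fst A))),
      Comp = (\<lambda>A B C g f. compose (pverts (fst A)) g f)\<rparr>"

definition box_product ::
  "'v pair_pre_digraph \<Rightarrow> 'w pair_pre_digraph \<Rightarrow> ('v \<times> 'w) pair_pre_digraph" where
  "box_product G H =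
     \<lparr>pverts = pverts G \<times> pverts H,
      parcs = {((u, u'), (u, v')) |u u' v'. u \<in> pverts G \<and> (u', v') \<in> parcs H} \<union>
              {((u, u'), (v, u')) |u v u'. (u, v) \<in> parcs G \<and> u' \<in> pverts H}\<rparr>"

definition homotopic_maps ::
  "'v based_digraph \<Rightarrow> 'w based_digraph \<Rightarrow> ('v \<Rightarrow> 'w) \<Rightarrow> ('v \<Rightarrow> 'w) \<Rightarrow> bool" where
  "homotopic_maps A B f g \<longleftrightarrow>
     f \<in> based_maps A B \<and> g \<in> based_maps A B \<and>
     (\<exists>n I. line_digraph n I \<and>
        (\<exists>F\<in>digraph_maps (box_product (fst A) I) (fst B).
          (\<forall>v\<in>pverts (fst A). F (v, 0) = f v \<and> F (v, n) = g v) \<and>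
          (\<forall>t\<in>pverts I. F (snd A, t) = snd B)))"

definition homotopy_rel :: "'v based_digraph \<Rightarrow> 'w based_digraph \<Rightarrow> ('v \<Rightarrow> 'w) rel" where
  "homotopy_rel A B = {(f, g). homotopic_maps A B f g}"

definition homotopy_class ::
  "'v based_digraph \<Rightarrow> 'w based_digraph \<Rightarrow> ('v \<Rightarrow> 'w) \<Rightarrow> ('v \<Rightarrow> 'w) set" where
  "homotopy_class A B f = homotopy_rel A B `` {f}"

definition hdig_cat :: "('v based_digraph, ('v \<Rightarrow> 'v) set) cat" where
  "hdig_cat =
     \<lparr>Obj = {A. based_digraph A},
      Hom = (\<lambda>A B. based_maps A B // homotopy_rel A B),
      Id = (\<lambda>A. homotopy_class A A (restrict id (pverts (fst A)))),
      Comp = (\<lambda>A B C \<Psi> \<Phi>.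
        \<Union>g\<in>\<Psi>. \<Union>f\<in>\<Phi>. homotopy_class A C (compose (pverts (fst A)) g f))\<rparr>"

definition algebra_cat :: "(('k::field, 'a) module, 'a \<Rightarrow> 'a) cat" where
  "algebra_cat =
     \<lparr>Obj = {A. k_algebra A},
      Hom = (\<lambda>A B. algebra_homs A B \<inter> extensional (carrier A)),
      Id = (\<lambda>A. restrict id (carrier A)),
      Comp = (\<lambda>A B C \<psi> \<phi>. compose (carrier A) \<psi> \<phi>)\<rparr>"

definition hopf_cat :: "(('k::field, 'a) hopf, 'a \<Rightarrow> 'a) cat" where
  "hopf_cat =
     \<lparr>Obj = {H. hopf_algebra H},
      Hom = (\<lambda>H L. hopf_homs H L \<inter> extensional (carrier H)),
      Id = (\<lambda>H. restrict id (carrier H)),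
      Comp = (\<lambda>H L M \<psi> \<phi>. compose (carrier H) \<psi> \<phi>)\<rparr>"


section \<open>The Hopf structure on loop integrals, and pullback\<close>

text \<open>
  The comultiplication and the antipode are prescribed on the iterated integrals, which generate
  the algebra; that such maps exist is part of what it means for some \<open>Q\<close> to satisfy the following.
\<close>

definition loop_hopf :: "'v based_digraph \<Rightarrow> ('k::field_char_0, 'v path_map \<Rightarrow> 'k) hopf \<Rightarrow> bool" where
  "loop_hopf A Q \<longleftrightarrow>
     module.truncate Q = loop_algebra A \<and>
     (\<forall>u\<in>carrier Q. counit Q u = u (trivial_loop (snd A))) \<and>
     (\<forall>\<omega>s. set \<omega>s \<subseteq> one_forms (fst A) \<longrightarrow>
        comult Q (loop_integral_at A \<omega>s) =
          (\<Oplus>\<^bsub>tensor_algebra Q Q\<^esub>i\<in>{0..length \<omega>s}.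
             pure_tensor Q Q (loop_integral_at A (take i \<omega>s)) (loop_integral_at A (drop i \<omega>s))) \<and>
        antipode Q (loop_integral_at A \<omega>s) =
          (-1) ^ length \<omega>s \<odot>\<^bsub>Q\<^esub> loop_integral_at A (rev \<omega>s))"

definition acts_by_pullback ::
  "('v based_digraph \<Rightarrow> ('v \<times> 'v \<Rightarrow> 'k::field_char_0) list \<Rightarrow> 'v path_map \<Rightarrow> 'k) \<Rightarrow>
   ('v based_digraph \<Rightarrow> 'v based_digraph \<Rightarrow> ('v \<Rightarrow> 'v) \<Rightarrow>
     ('v path_map \<Rightarrow> 'k) \<Rightarrow> 'v path_map \<Rightarrow> 'k) \<Rightarrow> bool" where
  "acts_by_pullback J \<Phi> \<longleftrightarrow>
     (\<forall>A B f \<omega>s. based_digraph A \<longrightarrow> based_digraph B \<longrightarrow> f \<in> based_maps A B \<longrightarrow>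
        set \<omega>s \<subseteq> one_forms (fst B) \<longrightarrow>
        \<Phi> A B f (J B \<omega>s) = J A (map (pullback_form (fst A) f) \<omega>s))"

end

theory Submission
  imports Defs
begin

text \<open>
  The three functors are given by composition of functions with maps of path maps, and all statements
  about them are proved by evaluating functions at path maps.

  An iterated integral depends on a path only through the sequence of its steps, each step being a
  functional on \<open>1\<close>-forms. On words of forms it is the product, under convolution, of the exponentials of
  the steps (\<open>path_integral_eq_signature\<close>). Concatenation of paths therefore corresponds to convolution,
  which is dual to deconcatenation of words; reversal of paths corresponds to signed reversal of words;
  and a loop followed by its reverse has the integrals of the trivial loop, because \<open>exp(x) exp(-x) = 1\<close>.
  As far as integrals can tell, loops form a group under concatenation.

  The loop integrals thus form an algebra of functions on a group. Its comultiplication, counit and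
  antipode are composition with the product, the unit and the inverse: \<open>comult u\<close> is the tensor that takes
  the value \<open>u(\<alpha> \<beta>)\<close> at \<open>(\<alpha>, \<beta>)\<close>. Deconcatenation shows that it exists for the integrals, and hence for
  the algebra they generate. It is unique, since a tensor of functions is determined by its values at
  pairs of points (\<open>separated_tensor\<close>). The same holds for iterated tensor products, so each Hopf axiom
  and each property of a Hopf morphism becomes, at every point, one of the group laws
  (\<open>function_hopf.hopf_algebra\<close>, \<open>hopf_homs_by_eval\<close>).

  For homotopy invariant integrals it must be shown in addition that comultiplication and antipode stay
  among them. One-step homotopies are compatible with concatenation and reversal, so \<open>u(\<alpha> \<beta>)\<close> is
  invariant in each variable separately; and a tensor whose slices in each variable lie in a subspace
  belongs to the tensor square of that subspace (\<open>tensor_sum_slices\<close>, \<open>pi1_representative\<close>).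

  A based digraph map sends paths to paths and respects concatenation, reversal and one-step homotopies,
  so pullback along it is a morphism. Adjacent based maps send every loop to one-step homotopic
  loops (\<open>pullback_homotopic\<close>). Homotopy of maps is generated by adjacency (\<open>homotopic_maps_iff\<close>), so
  homotopic maps induce the same pullback on homotopy invariant integrals.
\<close>


section \<open>Modules over the ground field\<close>

lemma ground_algebra_simps [simp]:
  "carrier ground_algebra = UNIV"
  "a \<oplus>\<^bsub>ground_algebra\<^esub> b = a + b"
  "a \<otimes>\<^bsub>ground_algebra\<^esub> b = a * b"
  "a \<odot>\<^bsub>ground_algebra\<^esub> b = a * b"
  "\<zero>\<^bsub>ground_algebra\<^esub> = 0"
  "\<one>\<^bsub>ground_algebra\<^esub> = 1"
  by (simp_all add: ground_algebra_def)

lemma cring_ground_algebra: "cring (ground_algebra :: ('k::field, 'k) module)"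
proof (rule cringI)
  have "\<exists>y. y + x = 0" for x :: 'k
    by (rule exI[of _ "- x"]) simp
  then show "abelian_group (ground_algebra :: ('k, 'k) module)"
    by (intro abelian_groupI) (auto simp: algebra_simps)
  show "comm_monoid (ground_algebra :: ('k, 'k) module)"
    by (rule comm_monoidI) (auto simp: algebra_simps)
qed (auto simp: algebra_simps)

text \<open>
  Since the ground algebra has carrier \<open>UNIV\<close>, scalars carry no side conditions; the next facts are the
  module laws in that form.
\<close>

locale vector_module = module "ground_algebra :: ('k::field, 'k) module" V
  for V :: "('k::field, 'a, 'm) module_scheme" (structure)

lemma (in vector_module) smult_simps [simp]:
  "x \<in> carrier V \<Longrightarrow> c \<odot> x \<in> carrier V"
  "x \<in> carrier V \<Longrightarrow> 0 \<odot> x = \<zero>"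
  "x \<in> carrier V \<Longrightarrow> 1 \<odot> x = x"
  "c \<odot> \<zero> = \<zero>"
  using smult_l_null smult_one smult_r_null by simp_all

lemma vector_moduleI:
  fixes V :: "('k::field, 'a, 'm) module_scheme" (structure)
  assumes "\<zero> \<in> carrier V"
    and "\<And>a b. a \<in> carrier V \<Longrightarrow> b \<in> carrier V \<Longrightarrow> a \<oplus> b \<in> carrier V"
    and smult: "\<And>c a. a \<in> carrier V \<Longrightarrow> c \<odot> a \<in> carrier V"
    and "\<And>a b c. a \<in> carrier V \<Longrightarrow> b \<in> carrier V \<Longrightarrow> c \<in> carrier V \<Longrightarrow> (a \<oplus> b) \<oplus> c = a \<oplus> (b \<oplus> c)"
    and "\<And>a b. a \<in> carrier V \<Longrightarrow> b \<in> carrier V \<Longrightarrow> a \<oplus> b = b \<oplus> a"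
    and "\<And>a. a \<in> carrier V \<Longrightarrow> \<zero> \<oplus> a = a"
    and inv: "\<And>a. a \<in> carrier V \<Longrightarrow> (-1) \<odot> a \<oplus> a = \<zero>"
    and "\<And>c d a. a \<in> carrier V \<Longrightarrow> (c + d) \<odot> a = c \<odot> a \<oplus> d \<odot> a"
    and "\<And>c a b. a \<in> carrier V \<Longrightarrow> b \<in> carrier V \<Longrightarrow> c \<odot> (a \<oplus> b) = c \<odot> a \<oplus> c \<odot> b"
    and "\<And>c d a. a \<in> carrier V \<Longrightarrow> (c * d) \<odot> a = c \<odot> (d \<odot> a)"
    and "\<And>a. a \<in> carrier V \<Longrightarrow> 1 \<odot> a = a"
  shows "vector_module V"
proof -
  have "abelian_group V"
  proof (rule abelian_groupI)
    show "\<exists>b\<in>carrier V. b \<oplus> a = \<zero>" if "a \<in> carrier V" for a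
      using that smult inv by blast
  qed (fact assms)+
  then have "module (ground_algebra :: ('k, 'k) module) V"
    by (intro moduleI cring_ground_algebra) (simp_all only: ground_algebra_simps assms)
  then show ?thesis
    by (simp add: vector_module_def)
qed

lemma vector_module_ground_algebra: "vector_module (ground_algebra :: ('k::field, 'k) module)"
  by (rule vector_moduleI) (auto simp: algebra_simps)

lemma k_algebra_vector_module: "k_algebra A \<Longrightarrow> vector_module A"
  by (simp add: k_algebra_def vector_module_def)

lemma linear_mapsI:
  assumes "\<And>a. a \<in> carrier A \<Longrightarrow> \<phi> a \<in> carrier B"
    and "\<And>a b. a \<in> carrier A \<Longrightarrow> b \<in> carrier A \<Longrightarrow> \<phi> (a \<oplus>\<^bsub>A\<^esub> b) = \<phi> a \<oplus>\<^bsub>B\<^esub> \<phi> b"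
    and "\<And>c a. a \<in> carrier A \<Longrightarrow> \<phi> (c \<odot>\<^bsub>A\<^esub> a) = c \<odot>\<^bsub>B\<^esub> \<phi> a"
  shows "\<phi> \<in> linear_maps A B"
  using assms by (auto simp: linear_maps_def)

lemma linear_mapsD:
  assumes "\<phi> \<in> linear_maps A B"
  shows linear_maps_closed: "a \<in> carrier A \<Longrightarrow> \<phi> a \<in> carrier B"
    and linear_maps_add: "a \<in> carrier A \<Longrightarrow> b \<in> carrier A \<Longrightarrow> \<phi> (a \<oplus>\<^bsub>A\<^esub> b) = \<phi> a \<oplus>\<^bsub>B\<^esub> \<phi> b"
    and linear_maps_smult: "a \<in> carrier A \<Longrightarrow> \<phi> (c \<odot>\<^bsub>A\<^esub> a) = c \<odot>\<^bsub>B\<^esub> \<phi> a"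
  using assms by (auto simp: linear_maps_def)

lemma linear_maps_zero:
  assumes "vector_module A" "vector_module B" "\<phi> \<in> linear_maps A B"
  shows "\<phi> \<zero>\<^bsub>A\<^esub> = \<zero>\<^bsub>B\<^esub>"
proof -
  interpret A: vector_module A by fact
  interpret B: vector_module B by fact
  have "\<phi> (0 \<odot>\<^bsub>A\<^esub> \<zero>\<^bsub>A\<^esub>) = 0 \<odot>\<^bsub>B\<^esub> \<phi> \<zero>\<^bsub>A\<^esub>"
    by (rule linear_maps_smult[OF assms(3)]) simp
  then show ?thesis
    using A.smult_l_null B.smult_l_null linear_maps_closed[OF assms(3)] by simp
qed

lemma linear_maps_comp:
  assumes "\<phi> \<in> linear_maps A B" "\<psi> \<in> linear_maps B C"
  shows "(\<lambda>a. \<psi> (\<phi> a)) \<in> linear_maps A C"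
  using assms by (auto simp: linear_maps_def image_subset_iff)

lemma linear_maps_finsum:
  assumes "vector_module A" "vector_module B" "\<phi> \<in> linear_maps A B"
    and "finite S" "\<And>s. s \<in> S \<Longrightarrow> f s \<in> carrier A"
  shows "\<phi> (\<Oplus>\<^bsub>A\<^esub>s\<in>S. f s) = (\<Oplus>\<^bsub>B\<^esub>s\<in>S. \<phi> (f s))"
proof -
  interpret A: vector_module A by fact
  interpret B: vector_module B by fact
  from assms(4,5) show ?thesis
  proof (induction S)
    case (insert s S)
    then have "f \<in> S \<rightarrow> carrier A" "(\<lambda>s. \<phi> (f s)) \<in> S \<rightarrow> carrier B"
      using linear_maps_closed[OF assms(3)] by auto
    with insert show ?case
      by (simp add: linear_maps_add[OF assms(3)] linear_maps_closed[OF assms(3)] A.finsum_closed)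
  qed (simp add: linear_maps_zero[OF assms(1-3)])
qed

lemma finsum_ground_algebra:
  fixes f :: "'s \<Rightarrow> 'k::field"
  assumes "finite S"
  shows "(\<Oplus>\<^bsub>ground_algebra\<^esub>s\<in>S. f s) = sum f S"
proof -
  interpret vector_module "ground_algebra :: ('k, 'k) module"
    by (rule vector_module_ground_algebra)
  from assms show ?thesis
    by (induction S) simp_all
qed


section \<open>Tensor products as modules\<close>

subsection \<open>Formal linear combinations\<close>

lemma lookup_scale_formal [simp]:
  "Poly_Mapping.lookup (scale_formal c p) z = c * Poly_Mapping.lookup p z"
  by (simp add: scale_formal_def Poly_Mapping.map.rep_eq when_def)

interpretation formal: Modules.module "scale_formal :: 'k::field \<Rightarrow> ('z \<Rightarrow>\<^sub>0 'k) \<Rightarrow> _"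
  by standard (auto intro!: poly_mapping_eqI simp: lookup_add algebra_simps)

lemma keys_scale_formal: "Poly_Mapping.keys (scale_formal c p) \<subseteq> Poly_Mapping.keys p"
  by (auto simp: in_keys_iff)

lemma scale_formal_single [simp]:
  "scale_formal c (Poly_Mapping.single z d) = Poly_Mapping.single z (c * d)"
  by (rule poly_mapping_eqI) (simp add: lookup_single when_def)

lemma poly_mapping_as_sum:
  "p = (\<Sum>z\<in>Poly_Mapping.keys p. Poly_Mapping.single z (Poly_Mapping.lookup p z))"
proof (rule poly_mapping_eqI)
  fix k
  have "(\<Sum>z\<in>Poly_Mapping.keys p. Poly_Mapping.lookup p z when z = k) = Poly_Mapping.lookup p k"
    by (cases "k \<in> Poly_Mapping.keys p") (auto simp: when_def in_keys_iff sum.delta)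
  then show "Poly_Mapping.lookup p k = Poly_Mapping.lookup
      (\<Sum>z\<in>Poly_Mapping.keys p. Poly_Mapping.single z (Poly_Mapping.lookup p z)) k"
    by (simp add: lookup_sum lookup_single)
qed

text \<open>The linear map on formal combinations of which \<open>tensor_lift\<close> is the descent to tensors.\<close>

definition formal_lift :: "('k::field, 'v, 'm) module_scheme \<Rightarrow> ('z \<Rightarrow> 'v) \<Rightarrow> ('z \<Rightarrow>\<^sub>0 'k) \<Rightarrow> 'v" where
  "formal_lift V f p = (\<Oplus>\<^bsub>V\<^esub>z\<in>Poly_Mapping.keys p. Poly_Mapping.lookup p z \<odot>\<^bsub>V\<^esub> f z)"

context vector_module
begin

lemma formal_lift_superset:
  assumes "finite S" "Poly_Mapping.keys p \<subseteq> S" "f \<in> S \<rightarrow> carrier V"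
  shows "formal_lift V f p = (\<Oplus>z\<in>S. Poly_Mapping.lookup p z \<odot> f z)"
  unfolding formal_lift_def
proof (rule add.finprod_mono_neutral_cong_left[OF assms(1,2)])
  show "\<And>i. i \<in> S - Poly_Mapping.keys p \<Longrightarrow> Poly_Mapping.lookup p i \<odot> f i = \<zero>"
    using assms(3) by (auto simp: in_keys_iff Pi_iff)
qed (use assms(3) in auto)

lemma formal_lift_closed:
  assumes "f \<in> Poly_Mapping.keys p \<rightarrow> carrier V"
  shows "formal_lift V f p \<in> carrier V"
  unfolding formal_lift_def using assms by (auto intro!: finsum_closed)

lemma formal_lift_zero [simp]: "formal_lift V f 0 = \<zero>"
  by (simp add: formal_lift_def)

lemma formal_lift_single:
  assumes "f z \<in> carrier V"
  shows "formal_lift V f (Poly_Mapping.single z c) = c \<odot> f z"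
proof -
  have "formal_lift V f (Poly_Mapping.single z c)
      = (\<Oplus>i\<in>{z}. Poly_Mapping.lookup (Poly_Mapping.single z c) i \<odot> f i)"
    using assms by (intro formal_lift_superset) auto
  then show ?thesis
    using assms by simp
qed

lemma formal_lift_add:
  assumes "f \<in> Poly_Mapping.keys p \<rightarrow> carrier V" "f \<in> Poly_Mapping.keys q \<rightarrow> carrier V"
  shows "formal_lift V f (p + q) = formal_lift V f p \<oplus> formal_lift V f q"
proof -
  define S where "S = Poly_Mapping.keys p \<union> Poly_Mapping.keys q"
  have S: "finite S" "f \<in> S \<rightarrow> carrier V" "Poly_Mapping.keys (p + q) \<subseteq> S"
    using assms keys_add[of p q] by (auto simp: S_def)
  then have "formal_lift V f (p + q) = (\<Oplus>z\<in>S. Poly_Mapping.lookup (p + q) z \<odot> f z)"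
    by (intro formal_lift_superset)
  also have "\<dots> = (\<Oplus>z\<in>S. Poly_Mapping.lookup p z \<odot> f z \<oplus> Poly_Mapping.lookup q z \<odot> f z)"
    using S by (intro finsum_cong') (auto simp: lookup_add Pi_iff smult_l_distr[simplified])
  also have "\<dots> = (\<Oplus>z\<in>S. Poly_Mapping.lookup p z \<odot> f z) \<oplus> (\<Oplus>z\<in>S. Poly_Mapping.lookup q z \<odot> f z)"
    using S by (intro finsum_addf) auto
  also have "\<dots> = formal_lift V f p \<oplus> formal_lift V f q"
    using S by (subst (1 2) formal_lift_superset[of S]) (auto simp: S_def)
  finally show ?thesis .
qed

lemma formal_lift_scale:
  assumes "f \<in> Poly_Mapping.keys p \<rightarrow> carrier V"
  shows "formal_lift V f (scale_formal c p) = c \<odot> formal_lift V f p"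
proof -
  have "formal_lift V f (scale_formal c p) = (\<Oplus>z\<in>Poly_Mapping.keys p. c \<odot> (Poly_Mapping.lookup p z \<odot> f z))"
    using assms keys_scale_formal[of c p]
    by (subst formal_lift_superset[of "Poly_Mapping.keys p"])
       (auto intro!: finsum_cong' simp: Pi_iff smult_assoc1[simplified])
  also have "\<dots> = c \<odot> formal_lift V f p"
    unfolding formal_lift_def using assms by (intro finsum_smult_ldistr[symmetric]) auto
  finally show ?thesis .
qed

lemma formal_lift_sum:
  assumes "finite S" "\<And>s. s \<in> S \<Longrightarrow> f \<in> Poly_Mapping.keys (p s) \<rightarrow> carrier V"
  shows "formal_lift V f (\<Sum>s\<in>S. p s) = (\<Oplus>s\<in>S. formal_lift V f (p s))"
  using assms
proof (induction S)
  case (insert s S)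
  have "f \<in> Poly_Mapping.keys (\<Sum>s\<in>S. p s) \<rightarrow> carrier V"
  proof
    fix z assume "z \<in> Poly_Mapping.keys (\<Sum>s\<in>S. p s)"
    then have "(\<Sum>s\<in>S. Poly_Mapping.lookup (p s) z) \<noteq> 0"
      by (simp add: in_keys_iff lookup_sum)
    then obtain t where "t \<in> S" "z \<in> Poly_Mapping.keys (p t)"
      by (rule sum.not_neutral_contains_not_neutral) (simp add: in_keys_iff)
    with insert.prems show "f z \<in> carrier V" by blast
  qed
  moreover have "(\<lambda>s. formal_lift V f (p s)) \<in> S \<rightarrow> carrier V"
    using insert.prems by (auto intro!: formal_lift_closed)
  moreover have "f \<in> Poly_Mapping.keys (p s) \<rightarrow> carrier V"
    using insert.prems by blast
  ultimately show ?case
    using insert.hyps insert.IH insert.prems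
    by (simp add: formal_lift_add formal_lift_closed)
qed simp

end

subsection \<open>Classes of formal tensors\<close>

locale tensor_factors = A: vector_module A + B: vector_module B
  for A :: "('k::field, 'a, 'm) module_scheme" and B :: "('k, 'b, 'n) module_scheme"
begin

abbreviation "T \<equiv> tensor_algebra A B"
abbreviation "formals \<equiv> formal_tensors A B"
abbreviation "relations \<equiv> formal.span (bilinear_relations A B)"
abbreviation "cls \<equiv> tensor_class A B"

lemma subspace_formals: "formal.subspace formals"
proof (rule formal.subspaceI)
  show "p + q \<in> formals" if "p \<in> formals" "q \<in> formals" for p q
    using that keys_add[of p q] by (auto simp: formal_tensors_def)
  show "scale_formal c p \<in> formals" if "p \<in> formals" for c p
    using that keys_scale_formal[of c p] by (auto simp: formal_tensors_def)
qed (simp add: formal_tensors_def)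

lemma formals_closed:
  "0 \<in> formals" "p \<in> formals \<Longrightarrow> q \<in> formals \<Longrightarrow> p + q \<in> formals"
  "p \<in> formals \<Longrightarrow> q \<in> formals \<Longrightarrow> p - q \<in> formals"
  "p \<in> formals \<Longrightarrow> - p \<in> formals"
  "p \<in> formals \<Longrightarrow> scale_formal c p \<in> formals"
  "(\<And>s. s \<in> S \<Longrightarrow> f s \<in> formals) \<Longrightarrow> sum f S \<in> formals"
  by (fact formal.subspace_0[OF subspace_formals] formal.subspace_add[OF subspace_formals]
      formal.subspace_diff[OF subspace_formals]
      formal.subspace_neg[OF subspace_formals] formal.subspace_scale[OF subspace_formals]
      formal.subspace_sum[OF subspace_formals])+

lemma single_formals: "a \<in> carrier A \<Longrightarrow> b \<in> carrier B \<Longrightarrow> Poly_Mapping.single (a, b) c \<in> formals"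
  by (auto simp: formal_tensors_def)

lemma relations_formals: "relations \<subseteq> formals"
proof (rule formal.span_minimal[OF _ subspace_formals])
  show "bilinear_relations A B \<subseteq> formals"
    unfolding bilinear_relations_def
    by (auto intro!: formals_closed single_formals)
qed

lemma cls_eq_iff: "p \<in> formals \<Longrightarrow> cls p = cls q \<longleftrightarrow> p - q \<in> relations"
proof
  assume "p \<in> formals" "cls p = cls q"
  moreover from this(1) have "p \<in> cls p"
    by (simp add: tensor_class_def formal.span_zero)
  ultimately show "p - q \<in> relations"
    by (simp add: tensor_class_def)
next
  assume pq: "p - q \<in> relations"
  have "r - p \<in> relations \<longleftrightarrow> r - q \<in> relations" for r
    using formal.span_add_eq[OF pq, of "r - p"] formal.span_add_eq2[OF pq, of "r - p"] by simp
  then show "cls p = cls q"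
    by (simp add: tensor_class_def)
qed

text \<open>
  The operations on tensors are given on arbitrary representatives. This lemma is what makes the choice
  immaterial: the rules for \<open>cls\<close> that follow from it are the only way in which representatives are used
  to compute sums and scalar multiples.
\<close>

lemma tensor_rep:
  assumes "p \<in> formals"
  shows "tensor_rep (cls p) \<in> formals" "tensor_rep (cls p) - p \<in> relations"
proof -
  have "p \<in> cls p"
    using assms by (simp add: tensor_class_def formal.span_zero)
  then have "tensor_rep (cls p) \<in> cls p"
    unfolding tensor_rep_def by (rule someI)
  then show "tensor_rep (cls p) \<in> formals" "tensor_rep (cls p) - p \<in> relations"
    by (simp_all add: tensor_class_def)
qed

lemma cls_tensor_rep: "p \<in> formals \<Longrightarrow> cls (tensor_rep (cls p)) = cls p"
  using tensor_rep by (simp add: cls_eq_iff)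

lemma tensor_carrier: "carrier T = cls ` formals"
  by (simp add: tensor_algebra_def)

lemma cls_carrier: "p \<in> formals \<Longrightarrow> cls p \<in> carrier T"
  by (simp add: tensor_carrier)

lemma carrier_cases:
  assumes "t \<in> carrier T"
  obtains p where "p \<in> formals" "t = cls p"
  using assms by (auto simp: tensor_carrier)

lemma tensor_rep_carrier:
  assumes "t \<in> carrier T"
  shows "tensor_rep t \<in> formals" "cls (tensor_rep t) = t"
  using assms tensor_rep cls_tensor_rep by (auto elim!: carrier_cases)

lemma cls_add:
  assumes "p \<in> formals" "q \<in> formals"
  shows "cls p \<oplus>\<^bsub>T\<^esub> cls q = cls (p + q)"
proof -
  have "(tensor_rep (cls p) + tensor_rep (cls q)) - (p + q)
      = (tensor_rep (cls p) - p) + (tensor_rep (cls q) - q)"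
    by simp
  then have "(tensor_rep (cls p) + tensor_rep (cls q)) - (p + q) \<in> relations"
    using tensor_rep assms by (simp only: formal.span_add)
  then show ?thesis
    using tensor_rep assms by (simp add: tensor_algebra_def cls_eq_iff formals_closed)
qed

lemma cls_scale:
  assumes "p \<in> formals"
  shows "c \<odot>\<^bsub>T\<^esub> cls p = cls (scale_formal c p)"
proof -
  have "scale_formal c (tensor_rep (cls p)) - scale_formal c p \<in> relations"
    using formal.span_scale[OF tensor_rep(2)[OF assms], of c]
    by (simp add: formal.scale_right_diff_distrib)
  then show ?thesis
    using tensor_rep assms by (simp add: tensor_algebra_def cls_eq_iff formals_closed)
qed

lemma cls_zero: "\<zero>\<^bsub>T\<^esub> = cls 0"
  by (simp add: tensor_algebra_def)

lemma vector_module_tensor: "vector_module T"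
proof (rule vector_moduleI)
  show "\<zero>\<^bsub>T\<^esub> \<in> carrier T"
    by (simp add: cls_zero cls_carrier formals_closed)
qed (auto elim!: carrier_cases
       simp: cls_add cls_scale cls_zero cls_carrier formals_closed
         add_ac formal.scale_left_distrib formal.scale_right_distrib)

sublocale T: vector_module T
  by (rule vector_module_tensor)

lemma finsum_cls:
  assumes "finite S" "\<And>s. s \<in> S \<Longrightarrow> p s \<in> formals"
  shows "(\<Oplus>\<^bsub>T\<^esub>s\<in>S. cls (p s)) = cls (\<Sum>s\<in>S. p s)"
  using assms
proof (induction S)
  case (insert s S)
  then have "(\<lambda>s. cls (p s)) \<in> S \<rightarrow> carrier T"
    using cls_carrier by auto
  with insert show ?case
    by (simp add: cls_carrier cls_add formals_closed)
qed (simp add: cls_zero)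

subsection \<open>Pure tensors\<close>

abbreviation "pure \<equiv> pure_tensor A B"

lemma pure_closed: "a \<in> carrier A \<Longrightarrow> b \<in> carrier B \<Longrightarrow> pure a b \<in> carrier T"
  by (simp add: pure_tensor_def cls_carrier single_formals)

lemma cls_single:
  assumes "a \<in> carrier A" "b \<in> carrier B"
  shows "cls (Poly_Mapping.single (a, b) c) = c \<odot>\<^bsub>T\<^esub> pure a b"
  using assms by (simp add: pure_tensor_def cls_scale single_formals)

lemma pure_add_left:
  assumes "a \<in> carrier A" "a' \<in> carrier A" "b \<in> carrier B"
  shows "pure (a \<oplus>\<^bsub>A\<^esub> a') b = pure a b \<oplus>\<^bsub>T\<^esub> pure a' b"
proof -
  have "Poly_Mapping.single (a \<oplus>\<^bsub>A\<^esub> a', b) 1 - (Poly_Mapping.single (a, b) 1 + Poly_Mapping.single (a', b) 1)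
      \<in> relations"
    using assms unfolding bilinear_relations_def diff_diff_add[symmetric]
    by (intro formal.span_base) blast
  then show ?thesis
    using assms by (simp add: pure_tensor_def cls_add single_formals cls_eq_iff)
qed

lemma pure_add_right:
  assumes "a \<in> carrier A" "b \<in> carrier B" "b' \<in> carrier B"
  shows "pure a (b \<oplus>\<^bsub>B\<^esub> b') = pure a b \<oplus>\<^bsub>T\<^esub> pure a b'"
proof -
  have "Poly_Mapping.single (a, b \<oplus>\<^bsub>B\<^esub> b') 1 - (Poly_Mapping.single (a, b) 1 + Poly_Mapping.single (a, b') 1)
      \<in> relations"
    using assms unfolding bilinear_relations_def diff_diff_add[symmetric]
    by (intro formal.span_base) blast
  then show ?thesis
    using assms by (simp add: pure_tensor_def cls_add single_formals cls_eq_iff)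
qed

lemma pure_smult_left:
  assumes "a \<in> carrier A" "b \<in> carrier B"
  shows "pure (c \<odot>\<^bsub>A\<^esub> a) b = c \<odot>\<^bsub>T\<^esub> pure a b"
proof -
  have "Poly_Mapping.single (c \<odot>\<^bsub>A\<^esub> a, b) 1 - Poly_Mapping.single (a, b) c \<in> relations"
    using assms unfolding bilinear_relations_def by (intro formal.span_base) blast
  then show ?thesis
    using assms by (simp add: pure_tensor_def cls_scale single_formals cls_eq_iff)
qed

lemma pure_smult_right:
  assumes "a \<in> carrier A" "b \<in> carrier B"
  shows "pure a (c \<odot>\<^bsub>B\<^esub> b) = c \<odot>\<^bsub>T\<^esub> pure a b"
proof -
  have "Poly_Mapping.single (a, c \<odot>\<^bsub>B\<^esub> b) 1 - Poly_Mapping.single (a, b) c \<in> relations"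
    using assms unfolding bilinear_relations_def by (intro formal.span_base) blast
  then show ?thesis
    using assms by (simp add: pure_tensor_def cls_scale single_formals cls_eq_iff)
qed

lemma tensor_as_finsum:
  assumes "t \<in> carrier T"
  shows "t = (\<Oplus>\<^bsub>T\<^esub>z\<in>Poly_Mapping.keys (tensor_rep t).
      Poly_Mapping.lookup (tensor_rep t) z \<odot>\<^bsub>T\<^esub> pure (fst z) (snd z))"
proof -
  let ?p = "tensor_rep t"
  have keys: "Poly_Mapping.keys ?p \<subseteq> carrier A \<times> carrier B"
    using tensor_rep_carrier(1)[OF assms] by (simp add: formal_tensors_def)
  have single: "Poly_Mapping.single z (Poly_Mapping.lookup ?p z) \<in> formals"
    if "z \<in> Poly_Mapping.keys ?p" for z
    using that keys by (cases z) (auto intro: single_formals)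
  have "t = cls (\<Sum>z\<in>Poly_Mapping.keys ?p. Poly_Mapping.single z (Poly_Mapping.lookup ?p z))"
    using tensor_rep_carrier(2)[OF assms] by (simp flip: poly_mapping_as_sum)
  also have "\<dots> = (\<Oplus>\<^bsub>T\<^esub>z\<in>Poly_Mapping.keys ?p. cls (Poly_Mapping.single z (Poly_Mapping.lookup ?p z)))"
    using single by (simp add: finsum_cls)
  also have "\<dots> = (\<Oplus>\<^bsub>T\<^esub>z\<in>Poly_Mapping.keys ?p. Poly_Mapping.lookup ?p z \<odot>\<^bsub>T\<^esub> pure (fst z) (snd z))"
  proof (rule T.finsum_cong')
    show "(\<lambda>z. Poly_Mapping.lookup ?p z \<odot>\<^bsub>T\<^esub> pure (fst z) (snd z)) \<in> Poly_Mapping.keys ?p \<rightarrow> carrier T"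
      using keys by (auto intro!: pure_closed T.smult_closed)
    show "cls (Poly_Mapping.single z (Poly_Mapping.lookup ?p z))
        = Poly_Mapping.lookup ?p z \<odot>\<^bsub>T\<^esub> pure (fst z) (snd z)" if "z \<in> Poly_Mapping.keys ?p" for z
      using that keys cls_single[of "fst z" "snd z"] by auto
  qed simp
  finally show ?thesis .
qed

text \<open>Since scalars can be absorbed into the first factor, sums of pure tensors exhaust the tensor product.\<close>

lemma tensor_induct [consumes 1, case_names zero add]:
  assumes "t \<in> carrier T"
    and zero: "P \<zero>\<^bsub>T\<^esub>"
    and add: "\<And>a b t. a \<in> carrier A \<Longrightarrow> b \<in> carrier B \<Longrightarrow> t \<in> carrier T \<Longrightarrow> P t \<Longrightarrow> P (pure a b \<oplus>\<^bsub>T\<^esub> t)"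
  shows "P t"
proof -
  define c where "c = Poly_Mapping.lookup (tensor_rep t)"
  have keys: "Poly_Mapping.keys (tensor_rep t) \<subseteq> carrier A \<times> carrier B"
    using tensor_rep_carrier(1)[OF assms(1)] by (simp add: formal_tensors_def)
  have "P (\<Oplus>\<^bsub>T\<^esub>z\<in>S. c z \<odot>\<^bsub>T\<^esub> pure (fst z) (snd z))" if "finite S" "S \<subseteq> carrier A \<times> carrier B" for S
    using that
  proof (induction S)
    case (insert z S)
    have cl: "c z \<odot>\<^bsub>T\<^esub> pure (fst z) (snd z) \<in> carrier T" if "z \<in> carrier A \<times> carrier B" for z
      using that by (auto intro!: pure_closed)
    with insert have "(\<lambda>z. c z \<odot>\<^bsub>T\<^esub> pure (fst z) (snd z)) \<in> S \<rightarrow> carrier T"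
      by blast
    with insert cl show ?case
      by (auto simp flip: pure_smult_left intro!: add T.finsum_closed)
  qed (simp add: zero)
  then show ?thesis
    by (subst tensor_as_finsum[OF assms(1)]) (simp add: c_def[symmetric] keys)
qed

lemma tensor_ext:
  assumes "vector_module V" "\<phi> \<in> linear_maps T V" "\<psi> \<in> linear_maps T V"
    and eq: "\<And>a b. a \<in> carrier A \<Longrightarrow> b \<in> carrier B \<Longrightarrow> \<phi> (pure a b) = \<psi> (pure a b)"
    and "t \<in> carrier T"
  shows "\<phi> t = \<psi> t"
  using assms(5)
proof (induction t rule: tensor_induct)
  case zero
  show ?case
    using assms T.vector_module_axioms by (simp add: linear_maps_zero)
next
  case (add a b t)
  then show ?case
    by (simp add: linear_maps_add[OF assms(2)] linear_maps_add[OF assms(3)] pure_closed eq)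
qed

end

subsection \<open>Linear maps out of a tensor product\<close>

definition bilinear_on ::
  "('k::field, 'a, 'm) module_scheme \<Rightarrow> ('k, 'b, 'n) module_scheme \<Rightarrow> ('k, 'c, 'l) module_scheme \<Rightarrow>
    ('a \<Rightarrow> 'b \<Rightarrow> 'c) \<Rightarrow> bool" where
  "bilinear_on A B V \<beta> \<longleftrightarrow>
     (\<forall>a\<in>carrier A. \<beta> a \<in> linear_maps B V) \<and> (\<forall>b\<in>carrier B. (\<lambda>a. \<beta> a b) \<in> linear_maps A V)"

lemma bilinear_onI:
  assumes "\<And>a. a \<in> carrier A \<Longrightarrow> \<beta> a \<in> linear_maps B V"
    and "\<And>b. b \<in> carrier B \<Longrightarrow> (\<lambda>a. \<beta> a b) \<in> linear_maps A V"
  shows "bilinear_on A B V \<beta>"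
  using assms by (simp add: bilinear_on_def)

lemma bilinear_onD:
  assumes "bilinear_on A B V \<beta>"
  shows "a \<in> carrier A \<Longrightarrow> \<beta> a \<in> linear_maps B V"
    and "b \<in> carrier B \<Longrightarrow> (\<lambda>a. \<beta> a b) \<in> linear_maps A V"
  using assms by (simp_all add: bilinear_on_def)

context tensor_factors
begin

lemma bilinear_on_pure: "bilinear_on A B T pure"
  by (intro bilinear_onI linear_mapsI)
     (simp_all add: pure_closed pure_add_left pure_add_right pure_smult_left pure_smult_right)

context
  fixes V :: "('k, 'v, 'l) module_scheme" and \<beta> :: "'a \<Rightarrow> 'b \<Rightarrow> 'v"
  assumes V: "vector_module V" and \<beta>: "bilinear_on A B V \<beta>"
begin

interpretation V: vector_module V by (rule V)

lemma bilinear_closed: "a \<in> carrier A \<Longrightarrow> b \<in> carrier B \<Longrightarrow> \<beta> a b \<in> carrier V"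
  by (rule linear_maps_closed[OF bilinear_onD(1)[OF \<beta>]])

lemma bilinear_Pi: "p \<in> formals \<Longrightarrow> (\<lambda>z. \<beta> (fst z) (snd z)) \<in> Poly_Mapping.keys p \<rightarrow> carrier V"
  by (auto simp: formal_tensors_def intro!: bilinear_closed)

lemma tensor_lift_eq_formal_lift:
  "tensor_lift V \<beta> t = formal_lift V (\<lambda>z. \<beta> (fst z) (snd z)) (tensor_rep t)"
  by (simp add: tensor_lift_def formal_lift_def)

text \<open>
  Well-definedness of \<open>tensor_lift\<close>: the four kinds of relations are the four parts of bilinearity.
\<close>

lemma formal_lift_relations:
  assumes "p \<in> relations"
  shows "formal_lift V (\<lambda>z. \<beta> (fst z) (snd z)) p = \<zero>\<^bsub>V\<^esub>"
proof -
  let ?L = "formal_lift V (\<lambda>z. \<beta> (fst z) (snd z))"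
  have minus: "?L (p - q) = ?L p \<oplus>\<^bsub>V\<^esub> (- 1) \<odot>\<^bsub>V\<^esub> ?L q" if "p \<in> formals" "q \<in> formals" for p q
  proof -
    have "p - q = p + scale_formal (- 1) q"
      by (simp add: formal.scale_minus_left)
    then show ?thesis
      using that formals_closed(5)[OF that(2), of "- 1"]
      by (simp only: V.formal_lift_add V.formal_lift_scale bilinear_Pi)
  qed
  have single: "?L (Poly_Mapping.single (a, b) c) = c \<odot>\<^bsub>V\<^esub> \<beta> a b" if "a \<in> carrier A" "b \<in> carrier B" for a b c
    using that by (simp add: V.formal_lift_single bilinear_closed)
  have neg: "(- 1) \<odot>\<^bsub>V\<^esub> x = \<ominus>\<^bsub>V\<^esub> x" if "x \<in> carrier V" for x
    using that V.smult_l_distr[of "- 1" 1 x] V.smult_l_null[of x]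
    by (intro V.minus_equality[symmetric]) simp_all
  have cancel: "(x \<oplus>\<^bsub>V\<^esub> y) \<oplus>\<^bsub>V\<^esub> (- 1) \<odot>\<^bsub>V\<^esub> x \<oplus>\<^bsub>V\<^esub> (- 1) \<odot>\<^bsub>V\<^esub> y = \<zero>\<^bsub>V\<^esub>"
    if "x \<in> carrier V" "y \<in> carrier V" for x y
    using that V.r_neg[of "x \<oplus>\<^bsub>V\<^esub> y"] by (simp add: neg V.minus_add V.a_assoc)
  have "relations \<subseteq> {p \<in> formals. ?L p = \<zero>\<^bsub>V\<^esub>}"
  proof (rule formal.span_minimal[OF subsetI])
    show "formal.subspace {p \<in> formals. ?L p = \<zero>\<^bsub>V\<^esub>}"
      by (rule formal.subspaceI)
         (auto simp: formals_closed V.formal_lift_add V.formal_lift_scale bilinear_Pi)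
    show "p \<in> {p \<in> formals. ?L p = \<zero>\<^bsub>V\<^esub>}" if "p \<in> bilinear_relations A B" for p
      using that unfolding bilinear_relations_def
    proof (elim UnE CollectE exE conjE)
      fix a a' b
      assume "p = Poly_Mapping.single (a \<oplus>\<^bsub>A\<^esub> a', b) 1 - Poly_Mapping.single (a, b) 1 - Poly_Mapping.single (a', b) 1"
        and "a \<in> carrier A" "a' \<in> carrier A" "b \<in> carrier B"
      then show "p \<in> {p \<in> formals. ?L p = \<zero>\<^bsub>V\<^esub>}"
        by (simp add: minus single formals_closed single_formals bilinear_closed cancel
            linear_maps_add[OF bilinear_onD(2)[OF \<beta>]] linear_maps_closed[OF bilinear_onD(2)[OF \<beta>]])
    next
      fix a b b'
      assume "p = Poly_Mapping.single (a, b \<oplus>\<^bsub>B\<^esub> b') 1 - Poly_Mapping.single (a, b) 1 - Poly_Mapping.single (a, b') 1"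
        and "a \<in> carrier A" "b \<in> carrier B" "b' \<in> carrier B"
      then show "p \<in> {p \<in> formals. ?L p = \<zero>\<^bsub>V\<^esub>}"
        by (simp add: minus single formals_closed single_formals bilinear_closed cancel
            linear_maps_add[OF bilinear_onD(1)[OF \<beta>]])
    next
      fix c a b
      assume "p = Poly_Mapping.single (c \<odot>\<^bsub>A\<^esub> a, b) 1 - Poly_Mapping.single (a, b) c"
        and "a \<in> carrier A" "b \<in> carrier B"
      then show "p \<in> {p \<in> formals. ?L p = \<zero>\<^bsub>V\<^esub>}"
        by (simp add: minus single single_formals formals_closed bilinear_closed neg V.r_neg
            linear_maps_smult[OF bilinear_onD(2)[OF \<beta>]])
    next
      fix c a b
      assume "p = Poly_Mapping.single (a, c \<odot>\<^bsub>B\<^esub> b) 1 - Poly_Mapping.single (a, b) c"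
        and "a \<in> carrier A" "b \<in> carrier B"
      then show "p \<in> {p \<in> formals. ?L p = \<zero>\<^bsub>V\<^esub>}"
        by (simp add: minus single single_formals formals_closed bilinear_closed neg V.r_neg
            linear_maps_smult[OF bilinear_onD(1)[OF \<beta>]])
    qed
  qed
  then show ?thesis using assms by blast
qed

lemma tensor_lift_cls:
  assumes "p \<in> formals"
  shows "tensor_lift V \<beta> (cls p) = formal_lift V (\<lambda>z. \<beta> (fst z) (snd z)) p"
proof -
  let ?L = "formal_lift V (\<lambda>z. \<beta> (fst z) (snd z))"
  define r where "r = tensor_rep (cls p) - p"
  have r: "r \<in> relations" "r \<in> formals" "tensor_rep (cls p) = p + r"
    using tensor_rep[OF assms] relations_formals by (auto simp: r_def)
  then show ?thesis
    using assms formal_lift_relations[OF r(1)]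
    by (simp add: tensor_lift_eq_formal_lift V.formal_lift_add bilinear_Pi V.formal_lift_closed)
qed

lemma tensor_lift_linear: "tensor_lift V \<beta> \<in> linear_maps T V"
  by (rule linear_mapsI)
     (auto elim!: carrier_cases simp: tensor_lift_cls formals_closed cls_add cls_scale
        V.formal_lift_add V.formal_lift_scale V.formal_lift_closed bilinear_Pi)

lemma tensor_lift_pure:
  "a \<in> carrier A \<Longrightarrow> b \<in> carrier B \<Longrightarrow> tensor_lift V \<beta> (pure a b) = \<beta> a b"
  by (simp add: pure_tensor_def tensor_lift_cls single_formals V.formal_lift_single bilinear_closed)

lemma tensor_lift_closed: "t \<in> carrier T \<Longrightarrow> tensor_lift V \<beta> t \<in> carrier V"
  by (rule linear_maps_closed[OF tensor_lift_linear])

text \<open>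
  Applied to the evaluation of functions at a point, this turns every linear map out of a tensor
  product into a scalar-valued one.
\<close>

lemma linear_tensor_lift:
  assumes "vector_module W" "g \<in> linear_maps V W" "t \<in> carrier T"
  shows "g (tensor_lift V \<beta> t) = tensor_lift W (\<lambda>a b. g (\<beta> a b)) t"
proof -
  have Pi: "Poly_Mapping.lookup (tensor_rep t) z \<odot>\<^bsub>V\<^esub> \<beta> (fst z) (snd z) \<in> carrier V"
    "g (Poly_Mapping.lookup (tensor_rep t) z \<odot>\<^bsub>V\<^esub> \<beta> (fst z) (snd z))
      = Poly_Mapping.lookup (tensor_rep t) z \<odot>\<^bsub>W\<^esub> g (\<beta> (fst z) (snd z))"
    "g (\<beta> (fst z) (snd z)) \<in> carrier W"
    if "z \<in> Poly_Mapping.keys (tensor_rep t)" for z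
    using that bilinear_Pi[OF tensor_rep_carrier(1)[OF assms(3)]] linear_maps_closed[OF assms(2)]
      linear_maps_smult[OF assms(2)] by (auto simp: Pi_iff)
  interpret W: vector_module W by fact
  show ?thesis
    unfolding tensor_lift_def using Pi
    by (subst linear_maps_finsum[OF V assms(1,2)]) (auto intro!: W.finsum_cong')
qed

end

lemma tensor_lift_cong:
  assumes "t \<in> carrier T" "\<And>a b. a \<in> carrier A \<Longrightarrow> b \<in> carrier B \<Longrightarrow> \<beta> a b = \<beta>' a b"
    and V: "vector_module V" and "bilinear_on A B V \<beta>'"
  shows "tensor_lift V \<beta> t = tensor_lift V \<beta>' t"
proof -
  interpret V: vector_module V by fact
  have keys: "Poly_Mapping.keys (tensor_rep t) \<subseteq> carrier A \<times> carrier B"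
    using tensor_rep_carrier(1)[OF assms(1)] by (simp add: formal_tensors_def)
  show ?thesis
    unfolding tensor_lift_def
  proof (rule V.finsum_cong')
    show "(\<lambda>z. Poly_Mapping.lookup (tensor_rep t) z \<odot>\<^bsub>V\<^esub> \<beta>' (fst z) (snd z))
        \<in> Poly_Mapping.keys (tensor_rep t) \<rightarrow> carrier V"
      using keys bilinear_closed[OF assms(3,4)] by auto
  qed (use keys assms(2) in auto)
qed

end

lemma tensor_factorsI: "vector_module A \<Longrightarrow> vector_module B \<Longrightarrow> tensor_factors A B"
  by (simp add: tensor_factors_def)

lemma vector_module_tensor_algebra:
  "vector_module A \<Longrightarrow> vector_module B \<Longrightarrow> vector_module (tensor_algebra A B)"
  by (rule tensor_factors.vector_module_tensor[OF tensor_factorsI])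

context
  fixes A :: "('k::field, 'a, 'm) module_scheme" and B :: "('k, 'b, 'n) module_scheme"
    and C :: "('k, 'c, 'l) module_scheme" and D :: "('k, 'd, 'o) module_scheme"
    and \<phi> :: "'a \<Rightarrow> 'c" and \<psi> :: "'b \<Rightarrow> 'd"
  assumes modules: "vector_module A" "vector_module B" "vector_module C" "vector_module D"
    and \<phi>: "\<phi> \<in> linear_maps A C" and \<psi>: "\<psi> \<in> linear_maps B D"
begin

interpretation AB: tensor_factors A B by (rule tensor_factorsI modules)+
interpretation CD: tensor_factors C D by (rule tensor_factorsI modules)+

lemma bilinear_on_tensor_map: "bilinear_on A B (tensor_algebra C D) (\<lambda>a b. pure_tensor C D (\<phi> a) (\<psi> b))"
proof (rule bilinear_onI)
  show "(\<lambda>b. pure_tensor C D (\<phi> a) (\<psi> b)) \<in> linear_maps B (tensor_algebra C D)" if "a \<in> carrier A" for a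
    by (rule linear_maps_comp[OF \<psi> bilinear_onD(1)[OF CD.bilinear_on_pure]])
       (rule linear_maps_closed[OF \<phi> that])
  show "(\<lambda>a. pure_tensor C D (\<phi> a) (\<psi> b)) \<in> linear_maps A (tensor_algebra C D)" if "b \<in> carrier B" for b
    by (rule linear_maps_comp[OF \<phi> bilinear_onD(2)[OF CD.bilinear_on_pure]])
       (rule linear_maps_closed[OF \<psi> that])
qed

lemma tensor_map_linear: "tensor_map C D \<phi> \<psi> \<in> linear_maps (tensor_algebra A B) (tensor_algebra C D)"
  unfolding tensor_map_def
  by (rule AB.tensor_lift_linear[OF CD.vector_module_tensor bilinear_on_tensor_map])

lemma tensor_map_pure:
  assumes "a \<in> carrier A" "b \<in> carrier B"
  shows "tensor_map C D \<phi> \<psi> (pure_tensor A B a b) = pure_tensor C D (\<phi> a) (\<psi> b)"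
  unfolding tensor_map_def
  by (rule AB.tensor_lift_pure[OF CD.vector_module_tensor bilinear_on_tensor_map assms])

lemma tensor_map_cong:
  assumes "t \<in> carrier (tensor_algebra A B)"
    and eq: "\<And>a. a \<in> carrier A \<Longrightarrow> \<phi>' a = \<phi> a" "\<And>b. b \<in> carrier B \<Longrightarrow> \<psi>' b = \<psi> b"
  shows "tensor_map C D \<phi>' \<psi>' t = tensor_map C D \<phi> \<psi> t"
  unfolding tensor_map_def
  by (rule AB.tensor_lift_cong[OF assms(1) _ CD.vector_module_tensor bilinear_on_tensor_map])
     (simp add: eq)

lemma tensor_lift_tensor_map:
  assumes V: "vector_module V" and \<beta>: "bilinear_on C D V \<beta>" and t: "t \<in> carrier (tensor_algebra A B)"
  shows "tensor_lift V \<beta> (tensor_map C D \<phi> \<psi> t) = tensor_lift V (\<lambda>a b. \<beta> (\<phi> a) (\<psi> b)) t"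
proof -
  have "tensor_lift V \<beta> (tensor_map C D \<phi> \<psi> t)
      = tensor_lift V (\<lambda>a b. tensor_lift V \<beta> (pure_tensor C D (\<phi> a) (\<psi> b))) t"
    unfolding tensor_map_def
    by (rule AB.linear_tensor_lift[OF CD.vector_module_tensor bilinear_on_tensor_map V
          CD.tensor_lift_linear[OF V \<beta>] t])
  also have "\<dots> = tensor_lift V (\<lambda>a b. \<beta> (\<phi> a) (\<psi> b)) t"
  proof (rule AB.tensor_lift_cong[OF t _ V])
    show "tensor_lift V \<beta> (pure_tensor C D (\<phi> a) (\<psi> b)) = \<beta> (\<phi> a) (\<psi> b)"
      if "a \<in> carrier A" "b \<in> carrier B" for a b
      using that by (intro CD.tensor_lift_pure[OF V \<beta>] linear_maps_closed[OF \<phi>] linear_maps_closed[OF \<psi>])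
    show "bilinear_on A B V (\<lambda>a b. \<beta> (\<phi> a) (\<psi> b))"
      by (intro bilinear_onI linear_maps_comp[OF \<psi> bilinear_onD(1)[OF \<beta>]]
          linear_maps_comp[OF \<phi> bilinear_onD(2)[OF \<beta>]] linear_maps_closed[OF \<phi>] linear_maps_closed[OF \<psi>])
  qed
  finally show ?thesis .
qed

end

lemma linear_maps_id: "(\<lambda>a. a) \<in> linear_maps A A"
  by (simp add: linear_maps_def)

lemma tensor_map_id:
  assumes "vector_module A" "vector_module B" "t \<in> carrier (tensor_algebra A B)"
  shows "tensor_map A B (\<lambda>a. a) (\<lambda>b. b) t = t"
proof -
  interpret AB: tensor_factors A B using assms by (intro tensor_factorsI)
  show ?thesis
  proof (rule AB.tensor_ext[OF AB.vector_module_tensor _ linear_maps_id _ assms(3)])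
    show "tensor_map A B (\<lambda>a. a) (\<lambda>b. b) \<in> linear_maps AB.T AB.T"
      by (rule tensor_map_linear[OF assms(1,2,1,2) linear_maps_id linear_maps_id])
    show "tensor_map A B (\<lambda>a. a) (\<lambda>b. b) (pure_tensor A B a b) = pure_tensor A B a b"
      if "a \<in> carrier A" "b \<in> carrier B" for a b
      by (rule tensor_map_pure[OF assms(1,2,1,2) linear_maps_id linear_maps_id that])
  qed
qed

lemma tensor_map_comp:
  assumes "vector_module A" "vector_module B" "vector_module C"
    and \<phi>: "\<phi> \<in> linear_maps A B" and \<psi>: "\<psi> \<in> linear_maps B C" and t: "t \<in> carrier (tensor_algebra A A)"
  shows "tensor_map C C \<psi> \<psi> (tensor_map B B \<phi> \<phi> t) = tensor_map C C (\<lambda>a. \<psi> (\<phi> a)) (\<lambda>a. \<psi> (\<phi> a)) t"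
  unfolding tensor_map_def[of C C]
  by (rule tensor_lift_tensor_map[OF assms(1,1,2,2) \<phi> \<phi> vector_module_tensor_algebra[OF assms(3,3)]
        bilinear_on_tensor_map[OF assms(2,2,3,3) \<psi> \<psi>] t])


section \<open>The categories of algebras and of Hopf algebras\<close>

text \<open>
  Based digraphs, algebras and Hopf algebras all form categories of functions between sets, with
  composition restricted to the source; for such data the unit and associativity laws hold automatically.
\<close>

lemma category_of_maps:
  assumes "\<And>A B f. A \<in> Ob \<Longrightarrow> B \<in> Ob \<Longrightarrow> f \<in> M A B \<Longrightarrow> f \<in> S A \<rightarrow>\<^sub>E S B"
    and "\<And>A. A \<in> Ob \<Longrightarrow> restrict id (S A) \<in> M A A"
    and "\<And>A B C f g. A \<in> Ob \<Longrightarrow> B \<in> Ob \<Longrightarrow> C \<in> Ob \<Longrightarrow> f \<in> M A B \<Longrightarrow> g \<in> M B C \<Longrightarrow>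
      compose (S A) g f \<in> M A C"
  shows "category \<lparr>Obj = Ob, Hom = M, Id = (\<lambda>A. restrict id (S A)), Comp = (\<lambda>A B C g f. compose (S A) g f)\<rparr>"
proof -
  have unit: "compose (S A) f (restrict id (S A)) = f" "compose (S A) (restrict id (S B)) f = f"
    if "f \<in> S A \<rightarrow>\<^sub>E S B" for A B f
    using that by (auto intro!: extensionalityI[of _ "S A"] simp: compose_def PiE_iff Pi_iff)
  have assoc: "compose (S A) h (compose (S A) g f) = compose (S A) (compose (S B) h g) f"
    if "f \<in> S A \<rightarrow>\<^sub>E S B" for A B f g h
    using that by (intro compose_assoc) blast
  show ?thesis
    unfolding category_def cat.simps
    by (intro conjI ballI) (rule assms unit assoc; (rule assms)?; assumption)+
qed

lemma algebra_homs_id: "(\<lambda>a. a) \<in> algebra_homs A A"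
  by (auto simp: algebra_homs_def ring_hom_def linear_maps_id)

lemma algebra_homs_comp:
  assumes "\<phi> \<in> algebra_homs A B" "\<psi> \<in> algebra_homs B C"
  shows "(\<lambda>a. \<psi> (\<phi> a)) \<in> algebra_homs A C"
  using assms linear_maps_comp[of \<phi> A B \<psi> C]
  by (auto simp: algebra_homs_def ring_hom_def Pi_iff)

lemma algebra_homs_linear: "\<phi> \<in> algebra_homs A B \<Longrightarrow> \<phi> \<in> linear_maps A B"
  by (simp add: algebra_homs_def)

text \<open>
  Homomorphisms only matter on the carrier, whereas morphisms of the categories are extensional; this
  lemma passes from one to the other.
\<close>

lemma algebra_homs_cong:
  assumes "k_algebra A" "\<phi> \<in> algebra_homs A B" "\<And>a. a \<in> carrier A \<Longrightarrow> \<phi>' a = \<phi> a"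
  shows "\<phi>' \<in> algebra_homs A B"
proof -
  interpret ring A using assms(1) by (simp add: k_algebra_def)
  interpret A: vector_module A using assms(1) by (rule k_algebra_vector_module)
  show ?thesis
    using assms(2,3) by (auto simp: algebra_homs_def ring_hom_def linear_maps_def Pi_iff)
qed

lemma category_algebra_cat: "category (algebra_cat :: (('k::field, 'a) module, 'a \<Rightarrow> 'a) cat)"
  unfolding algebra_cat_def
proof (rule category_of_maps[where S = carrier])
  fix A B C :: "('k, 'a) module" and \<phi> \<psi>
  assume A: "A \<in> {A. k_algebra A}"
  then show "restrict id (carrier A) \<in> algebra_homs A A \<inter> extensional (carrier A)"
    using algebra_homs_cong[OF _ algebra_homs_id, of A "restrict id (carrier A)"] by simp
  assume \<phi>: "\<phi> \<in> algebra_homs A B \<inter> extensional (carrier A)"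
  then show "\<phi> \<in> carrier A \<rightarrow>\<^sub>E carrier B"
    by (auto simp: algebra_homs_def linear_maps_def extensional_def)
  assume "\<psi> \<in> algebra_homs B C \<inter> extensional (carrier B)"
  with A \<phi> have "compose (carrier A) \<psi> \<phi> \<in> algebra_homs A C"
    by (intro algebra_homs_cong[OF _ algebra_homs_comp[of \<phi> A B \<psi> C]]) (auto simp: compose_def)
  then show "compose (carrier A) \<psi> \<phi> \<in> algebra_homs A C \<inter> extensional (carrier A)"
    by simp
qed

lemma hopf_algebraD:
  assumes "hopf_algebra H"
  shows "k_algebra H" "vector_module H"
    and "a \<in> carrier H \<Longrightarrow> comult H a \<in> carrier (tensor_algebra H H)"
    and "a \<in> carrier H \<Longrightarrow> antipode H a \<in> carrier H"
proof -
  note d = assms[unfolded hopf_algebra_def]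
  have *: "k_algebra H" "comult H \<in> algebra_homs H (tensor_algebra H H)" "antipode H \<in> linear_maps H H"
    using conjunct1[OF d] conjunct1[OF conjunct2[OF d]] conjunct1[OF conjunct2[OF conjunct2[OF conjunct2[OF d]]]]
    by simp_all
  show "k_algebra H"
    by (fact *)
  then show "vector_module H"
    by (rule k_algebra_vector_module)
  show "comult H a \<in> carrier (tensor_algebra H H)" if "a \<in> carrier H"
    using linear_maps_closed[OF algebra_homs_linear[OF *(2)] that] .
  show "antipode H a \<in> carrier H" if "a \<in> carrier H"
    using linear_maps_closed[OF *(3) that] .
qed

lemma hopf_homs_algebra: "\<phi> \<in> hopf_homs H L \<Longrightarrow> \<phi> \<in> algebra_homs H L"
  by (simp add: hopf_homs_def)

lemma hopf_homs_linear: "\<phi> \<in> hopf_homs H L \<Longrightarrow> \<phi> \<in> linear_maps H L"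
  by (simp add: hopf_homs_def algebra_homs_linear)

lemma hopf_homs_cong:
  assumes H: "hopf_algebra H" and L: "hopf_algebra L" and \<phi>: "\<phi> \<in> hopf_homs H L"
    and eq: "\<And>a. a \<in> carrier H \<Longrightarrow> \<phi>' a = \<phi> a"
  shows "\<phi>' \<in> hopf_homs H L"
proof -
  note H' = hopf_algebraD(2)[OF H] and L' = hopf_algebraD(2)[OF L]
  have "tensor_map L L \<phi>' \<phi>' (comult H a) = tensor_map L L \<phi> \<phi> (comult H a)" if "a \<in> carrier H" for a
    by (rule tensor_map_cong[OF H' H' L' L' hopf_homs_linear[OF \<phi>] hopf_homs_linear[OF \<phi>]
          hopf_algebraD(3)[OF H that] eq eq])
  moreover have "\<phi>' \<in> algebra_homs H L"
    by (rule algebra_homs_cong[OF hopf_algebraD(1)[OF H] hopf_homs_algebra[OF \<phi>] eq])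
  moreover have "\<phi>' (antipode H a) = \<phi> (antipode H a)" if "a \<in> carrier H" for a
    by (rule eq[OF hopf_algebraD(4)[OF H that]])
  ultimately show ?thesis
    using \<phi> unfolding hopf_homs_def by (simp add: eq)
qed

lemma hopf_homs_id:
  assumes "hopf_algebra H"
  shows "(\<lambda>a. a) \<in> hopf_homs H H"
  using hopf_algebraD[OF assms] by (simp add: hopf_homs_def algebra_homs_id tensor_map_id)

lemma hopf_homs_comp:
  assumes "hopf_algebra H" "hopf_algebra L" "hopf_algebra M"
    and \<phi>: "\<phi> \<in> hopf_homs H L" and \<psi>: "\<psi> \<in> hopf_homs L M"
  shows "(\<lambda>a. \<psi> (\<phi> a)) \<in> hopf_homs H M"
proof -
  have cl: "\<phi> a \<in> carrier L" if "a \<in> carrier H" for a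
    using linear_maps_closed[OF hopf_homs_linear[OF \<phi>] that] .
  have "tensor_map M M \<psi> \<psi> (tensor_map L L \<phi> \<phi> (comult H a))
      = tensor_map M M (\<lambda>a. \<psi> (\<phi> a)) (\<lambda>a. \<psi> (\<phi> a)) (comult H a)" if "a \<in> carrier H" for a
    by (rule tensor_map_comp[OF hopf_algebraD(2)[OF assms(1)] hopf_algebraD(2)[OF assms(2)]
          hopf_algebraD(2)[OF assms(3)] hopf_homs_linear[OF \<phi>] hopf_homs_linear[OF \<psi>]
          hopf_algebraD(3)[OF assms(1) that]])
  then show ?thesis
    using algebra_homs_comp[OF hopf_homs_algebra[OF \<phi>] hopf_homs_algebra[OF \<psi>]] \<phi> \<psi> cl
    by (simp add: hopf_homs_def)
qed

lemma category_hopf_cat: "category (hopf_cat :: (('k::field, 'a) hopf, 'a \<Rightarrow> 'a) cat)"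
  unfolding hopf_cat_def
proof (rule category_of_maps[where S = carrier])
  fix A B C :: "('k, 'a) hopf" and \<phi> \<psi>
  assume "A \<in> {A. hopf_algebra A}"
  then have A: "hopf_algebra A" by simp
  show "restrict id (carrier A) \<in> hopf_homs A A \<inter> extensional (carrier A)"
    using hopf_homs_cong[OF A A hopf_homs_id[OF A], of "restrict id (carrier A)"] by simp
  assume \<phi>: "\<phi> \<in> hopf_homs A B \<inter> extensional (carrier A)"
  then show "\<phi> \<in> carrier A \<rightarrow>\<^sub>E carrier B"
    by (auto simp: hopf_homs_def algebra_homs_def linear_maps_def extensional_def)
  assume "B \<in> {A. hopf_algebra A}" "C \<in> {A. hopf_algebra A}" "\<psi> \<in> hopf_homs B C \<inter> extensional (carrier B)"
  then have "compose (carrier A) \<psi> \<phi> \<in> hopf_homs A C"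
    using \<phi> by (intro hopf_homs_cong[OF A _ hopf_homs_comp[OF A, of B C \<phi> \<psi>]]) (auto simp: compose_def)
  then show "compose (carrier A) \<psi> \<phi> \<in> hopf_homs A C \<inter> extensional (carrier A)"
    by simp
qed


section \<open>Modules separated by evaluation\<close>

text \<open>
  The elements of such a module behave like functions on the set \<open>P\<close> of points, \<open>e\<close> being evaluation. Modules
  of functions are of this kind, and below it is shown that tensor products are again, over pairs of
  points. An equation between iterated tensors can then be checked at points, where it becomes an
  equation of scalars.
\<close>

locale separated_module = vector_module V
  for V :: "('k::field, 'a, 'm) module_scheme" (structure) +
  fixes P :: "'p set" and e :: "'a \<Rightarrow> 'p \<Rightarrow> 'k"
  assumes eval_linear: "p \<in> P \<Longrightarrow> (\<lambda>a. e a p) \<in> linear_maps V ground_algebra"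
    and separated: "a \<in> carrier V \<Longrightarrow> (\<And>p. p \<in> P \<Longrightarrow> e a p = 0) \<Longrightarrow> a = \<zero>"
begin

lemma eval_add: "p \<in> P \<Longrightarrow> a \<in> carrier V \<Longrightarrow> b \<in> carrier V \<Longrightarrow> e (a \<oplus> b) p = e a p + e b p"
  using linear_maps_add[OF eval_linear] by simp

lemma eval_smult: "p \<in> P \<Longrightarrow> a \<in> carrier V \<Longrightarrow> e (c \<odot> a) p = c * e a p"
  using linear_maps_smult[OF eval_linear] by simp

lemma eval_zero: "p \<in> P \<Longrightarrow> e \<zero> p = 0"
  using linear_maps_zero[OF vector_module_axioms vector_module_ground_algebra eval_linear] by simp

lemma eval_inject:
  assumes "a \<in> carrier V" "b \<in> carrier V" and eq: "\<And>p. p \<in> P \<Longrightarrow> e a p = e b p"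
  shows "a = b"
proof -
  have "(- 1) \<odot> b \<oplus> b = \<zero>"
    using assms(2) smult_l_distr[of "- 1" 1 b] by simp
  moreover have "(- 1) \<odot> b \<oplus> a = \<zero>"
    using assms by (intro separated) (simp_all add: eval_add eval_smult)
  ultimately show ?thesis
    using assms(1,2) a_assoc[of b "(- 1) \<odot> b" a] by (simp add: a_comm)
qed

end

definition tensor_eval :: "('a \<Rightarrow> 'p \<Rightarrow> 'k::field) \<Rightarrow> ('b \<Rightarrow> 'q \<Rightarrow> 'k) \<Rightarrow> ('k, 'a, 'b) tensor \<Rightarrow> 'p \<times> 'q \<Rightarrow> 'k" where
  "tensor_eval e f t = (\<lambda>(x, y). tensor_lift ground_algebra (\<lambda>a b. e a x * f b y) t)"

locale separated_factors = A: separated_module A P e + B: separated_module B P' f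
  for A :: "('k::field, 'a, 'm) module_scheme" and P :: "'p set" and e
    and B :: "('k, 'b, 'n) module_scheme" and P' :: "'q set" and f
begin

sublocale tensor_factors A B ..

lemma bilinear_on_eval:
  assumes "x \<in> P" "y \<in> P'"
  shows "bilinear_on A B ground_algebra (\<lambda>a b. e a x * f b y)"
  using assms
  by (intro bilinear_onI linear_mapsI)
     (simp_all add: A.eval_add A.eval_smult B.eval_add B.eval_smult algebra_simps)

lemma tensor_eval_linear:
  assumes "z \<in> P \<times> P'"
  shows "(\<lambda>t. tensor_eval e f t z) \<in> linear_maps T ground_algebra"
  using assms tensor_lift_linear[OF vector_module_ground_algebra bilinear_on_eval]
  by (auto simp: tensor_eval_def)

lemma tensor_eval_pure:
  assumes "x \<in> P" "y \<in> P'" "a \<in> carrier A" "b \<in> carrier B"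
  shows "tensor_eval e f (pure a b) (x, y) = e a x * f b y"
  using assms by (simp add: tensor_eval_def tensor_lift_pure[OF vector_module_ground_algebra bilinear_on_eval])

lemma tensor_eval_add:
  assumes "z \<in> P \<times> P'" "s \<in> carrier T" "t \<in> carrier T"
  shows "tensor_eval e f (s \<oplus>\<^bsub>T\<^esub> t) z = tensor_eval e f s z + tensor_eval e f t z"
  using linear_maps_add[OF tensor_eval_linear[OF assms(1)] assms(2,3)] by simp

lemma tensor_eval_smult:
  assumes "z \<in> P \<times> P'" "t \<in> carrier T"
  shows "tensor_eval e f (c \<odot>\<^bsub>T\<^esub> t) z = c * tensor_eval e f t z"
  using linear_maps_smult[OF tensor_eval_linear[OF assms(1)] assms(2)] by simp

lemma tensor_eval_zero: "z \<in> P \<times> P' \<Longrightarrow> tensor_eval e f \<zero>\<^bsub>T\<^esub> z = 0"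
  using linear_maps_zero[OF vector_module_tensor vector_module_ground_algebra tensor_eval_linear] by simp

definition tensor_sum :: "('a \<times> 'b) list \<Rightarrow> ('k, 'a, 'b) tensor" where
  "tensor_sum zs = foldr (\<lambda>z t. pure (fst z) (snd z) \<oplus>\<^bsub>T\<^esub> t) zs \<zero>\<^bsub>T\<^esub>"

lemma tensor_sum_simps [simp]:
  "tensor_sum [] = \<zero>\<^bsub>T\<^esub>"
  "tensor_sum (z # zs) = pure (fst z) (snd z) \<oplus>\<^bsub>T\<^esub> tensor_sum zs"
  by (simp_all add: tensor_sum_def)

lemma tensor_sum_closed: "set zs \<subseteq> carrier A \<times> carrier B \<Longrightarrow> tensor_sum zs \<in> carrier T"
  by (induction zs) (auto intro!: pure_closed)

lemma tensor_sum_cases: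
  assumes "t \<in> carrier T"
  obtains zs where "set zs \<subseteq> carrier A \<times> carrier B" "t = tensor_sum zs"
proof -
  have "\<exists>zs. set zs \<subseteq> carrier A \<times> carrier B \<and> t = tensor_sum zs"
    using assms
  proof (induction t rule: tensor_induct)
    case zero
    show ?case by (rule exI[of _ "[]"]) simp
  next
    case (add a b t)
    then obtain zs where "set zs \<subseteq> carrier A \<times> carrier B" "t = tensor_sum zs"
      by blast
    with add.hyps show ?case
      by (intro exI[of _ "(a, b) # zs"]) simp
  qed
  with that show thesis by blast
qed

lemma tensor_eval_sum:
  assumes "x \<in> P" "y \<in> P'" "set zs \<subseteq> carrier A \<times> carrier B"
  shows "tensor_eval e f (tensor_sum zs) (x, y) = (\<Sum>(a, b)\<leftarrow>zs. e a x * f b y)"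
  using assms
  by (induction zs)
     (auto simp: tensor_eval_zero tensor_eval_add tensor_eval_pure tensor_sum_closed pure_closed)

text \<open>
  The key fact about tensor products of function spaces: a tensor in \<open>A \<otimes> B\<close> all of whose slices
  \<open>t(-, y)\<close> lie in a subspace \<open>U\<close> of \<open>A\<close> comes from \<open>U \<otimes> B\<close>. The proof is Gaussian elimination on the number
  of summands. Let \<open>a \<otimes> b\<close> be the first one; if \<open>b = 0\<close>, it can be dropped. Otherwise take a point \<open>y0\<close> with
  \<open>b(y0) \<noteq> 0\<close> and let \<open>w\<close> in \<open>U\<close> be the slice at \<open>y0\<close>. It expresses \<open>a\<close> by \<open>w\<close> and the other left factors;
  substituting this leaves \<open>w \<otimes> b\<close>, up to a scalar, and a sum with one term less, whose slices still lie
  in \<open>U\<close>.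

  For \<open>U = 0\<close> this says that a tensor is determined by its values; applied on both sides it yields
  \<open>(U \<otimes> B) \<inter> (A \<otimes> W) = U \<otimes> W\<close>, which puts the comultiplication of homotopy invariant integrals into
  the right space.
\<close>

lemma tensor_sum_slices:
  assumes U: "\<zero>\<^bsub>A\<^esub> \<in> U" "\<And>u v. u \<in> U \<Longrightarrow> v \<in> U \<Longrightarrow> u \<oplus>\<^bsub>A\<^esub> v \<in> U" "\<And>c u. u \<in> U \<Longrightarrow> c \<odot>\<^bsub>A\<^esub> u \<in> U"
      "U \<subseteq> carrier A"
    and "set zs \<subseteq> carrier A \<times> carrier B"
    and "\<And>y. y \<in> P' \<Longrightarrow> \<exists>u\<in>U. \<forall>x\<in>P. tensor_eval e f (tensor_sum zs) (x, y) = e u x"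
  shows "\<exists>zs'. set zs' \<subseteq> U \<times> carrier B \<and> tensor_sum zs' = tensor_sum zs"
  using assms(5,6)
proof (induction "length zs" arbitrary: zs)
  case 0
  then show ?case by (intro exI[of _ "[]"]) simp
next
  case (Suc n)
  then obtain a b zs1 where zs: "zs = (a, b) # zs1" and n: "n = length zs1"
    by (cases zs) auto
  with Suc.prems have ab: "a \<in> carrier A" "b \<in> carrier B" and zs1: "set zs1 \<subseteq> carrier A \<times> carrier B"
    by auto
  have sum1: "tensor_sum zs1 \<in> carrier T"
    using zs1 by (rule tensor_sum_closed)
  show ?case
  proof (cases "\<exists>y0\<in>P'. f b y0 \<noteq> 0")
    case False
    then have "b = \<zero>\<^bsub>B\<^esub>"
      using ab by (intro B.separated) auto
    then have "pure a b = \<zero>\<^bsub>T\<^esub>"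
      using pure_smult_right[of a "\<zero>\<^bsub>B\<^esub>" 0] ab pure_closed[of a "\<zero>\<^bsub>B\<^esub>"] by simp
    then have "tensor_sum zs = tensor_sum zs1"
      using sum1 by (simp add: zs)
    with Suc.hyps(1)[OF n zs1] Suc.prems(2) show ?thesis
      by metis
  next
    case True
    then obtain y0 where y0: "y0 \<in> P'" "f b y0 \<noteq> 0"
      by blast
    with Suc.prems(2) obtain w where w: "w \<in> U" "\<And>x. x \<in> P \<Longrightarrow> tensor_eval e f (tensor_sum zs) (x, y0) = e w x"
      by metis
    \<comment> \<open>Solving the slice equation at \<open>y0\<close> for \<open>a\<close> gives \<open>a = s w + l\<close>, where \<open>l\<close> combines the other
      left factors with coefficients \<open>r\<close>; moving \<open>l \<otimes> b\<close> into the other terms turns \<open>zs1\<close> into \<open>zs2\<close>.\<close>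
    define s where "s = 1 / f b y0"
    define r where "r b' = - (f b' y0 / f b y0)" for b'
    define zs2 where "zs2 = map (\<lambda>(a', b'). (a', b' \<oplus>\<^bsub>B\<^esub> r b' \<odot>\<^bsub>B\<^esub> b)) zs1"
    define l where "l zs' = foldr (\<lambda>(a', b') v. r b' \<odot>\<^bsub>A\<^esub> a' \<oplus>\<^bsub>A\<^esub> v) zs' \<zero>\<^bsub>A\<^esub>" for zs'
    have l_closed: "l zs' \<in> carrier A" if "set zs' \<subseteq> carrier A \<times> carrier B" for zs'
      using that by (induction zs') (auto simp: l_def)
    have zs2: "set zs2 \<subseteq> carrier A \<times> carrier B" "n = length zs2"
      using zs1 ab n by (auto simp: zs2_def)
    have "tensor_sum (map (\<lambda>(a', b'). (a', b' \<oplus>\<^bsub>B\<^esub> r b' \<odot>\<^bsub>B\<^esub> b)) zs') = tensor_sum zs' \<oplus>\<^bsub>T\<^esub> pure (l zs') b"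
      if "set zs' \<subseteq> carrier A \<times> carrier B" for zs'
      using that
    proof (induction zs')
      case Nil
      have "pure \<zero>\<^bsub>A\<^esub> b = \<zero>\<^bsub>T\<^esub>"
        using pure_smult_left[of "\<zero>\<^bsub>A\<^esub>" b 0] ab pure_closed[of "\<zero>\<^bsub>A\<^esub>" b] by simp
      then show ?case by (simp add: l_def)
    next
      case (Cons z zs')
      obtain a' b' where z: "z = (a', b')" by (cases z)
      with Cons.prems have cl: "a' \<in> carrier A" "b' \<in> carrier B" "set zs' \<subseteq> carrier A \<times> carrier B"
        by auto
      have "l (z # zs') = r b' \<odot>\<^bsub>A\<^esub> a' \<oplus>\<^bsub>A\<^esub> l zs'"
        by (simp add: l_def z)
      with Cons.IH[OF cl(3)] cl ab l_closed[OF cl(3)] tensor_sum_closed[OF cl(3)] show ?case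
        by (simp add: z pure_add_left pure_add_right pure_smult_left pure_smult_right pure_closed T.a_ac)
    qed
    from this[OF zs1] have sum2: "tensor_sum zs2 = tensor_sum zs1 \<oplus>\<^bsub>T\<^esub> pure (l zs1) b"
      by (simp add: zs2_def)
    have w': "w \<in> carrier A" "s \<odot>\<^bsub>A\<^esub> w \<in> carrier A"
      using w(1) U(4) by auto
    have "e (l zs') x = - s * tensor_eval e f (tensor_sum zs') (x, y0)"
      if "x \<in> P" "set zs' \<subseteq> carrier A \<times> carrier B" for x zs'
      using that(2)
    proof (induction zs')
      case (Cons z zs')
      obtain a' b' where z: "z = (a', b')" by (cases z)
      with Cons.prems have cl: "a' \<in> carrier A" "b' \<in> carrier B" "set zs' \<subseteq> carrier A \<times> carrier B"
        by auto
      have "l (z # zs') = r b' \<odot>\<^bsub>A\<^esub> a' \<oplus>\<^bsub>A\<^esub> l zs'"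
        by (simp add: l_def z)
      with Cons.IH[OF cl(3)] cl that(1) y0 l_closed[OF cl(3)] tensor_sum_closed[OF cl(3)] show ?case
        by (simp add: z A.eval_add A.eval_smult tensor_eval_add tensor_eval_pure pure_closed
            r_def s_def field_simps)
    qed (use that y0 in \<open>simp add: l_def A.eval_zero tensor_eval_zero\<close>)
    note eval_l = this[OF _ zs1]
    have a: "a = s \<odot>\<^bsub>A\<^esub> w \<oplus>\<^bsub>A\<^esub> l zs1"
    proof (rule A.eval_inject)
      fix x assume x: "x \<in> P"
      have "e w x = e a x * f b y0 + tensor_eval e f (tensor_sum zs1) (x, y0)"
        using w(2)[OF x] x y0 ab sum1 by (simp add: zs tensor_eval_add tensor_eval_pure pure_closed)
      with x y0 w' l_closed[OF zs1] show "e a x = e (s \<odot>\<^bsub>A\<^esub> w \<oplus>\<^bsub>A\<^esub> l zs1) x"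
        by (simp add: A.eval_add A.eval_smult eval_l s_def field_simps)
    qed (use ab w' l_closed[OF zs1] in auto)
    have sum: "tensor_sum zs = pure (s \<odot>\<^bsub>A\<^esub> w) b \<oplus>\<^bsub>T\<^esub> tensor_sum zs2"
      unfolding zs tensor_sum_simps fst_conv snd_conv sum2
      using ab w' sum1 l_closed[OF zs1]
      by (subst a) (simp add: pure_add_left pure_closed T.a_ac)
    have "\<exists>u\<in>U. \<forall>x\<in>P. tensor_eval e f (tensor_sum zs2) (x, y) = e u x" if y: "y \<in> P'" for y
    proof -
      obtain u where u: "u \<in> U" "\<And>x. x \<in> P \<Longrightarrow> tensor_eval e f (tensor_sum zs) (x, y) = e u x"
        using Suc.prems(2)[OF y] by blast
      have "tensor_eval e f (tensor_sum zs2) (x, y) = e (u \<oplus>\<^bsub>A\<^esub> (- s * f b y) \<odot>\<^bsub>A\<^esub> w) x" if "x \<in> P" for x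
        using u(1) u(2)[OF that] that y w' ab U(4) tensor_sum_closed[OF zs2(1)]
        by (auto simp: sum tensor_eval_add tensor_eval_pure pure_closed A.eval_add A.eval_smult algebra_simps)
      with u(1) w(1) show ?thesis
        by (intro bexI[of _ "u \<oplus>\<^bsub>A\<^esub> (- s * f b y) \<odot>\<^bsub>A\<^esub> w"] U) auto
    qed
    with Suc.hyps(1)[OF zs2(2,1)] obtain zs' where "set zs' \<subseteq> U \<times> carrier B" "tensor_sum zs' = tensor_sum zs2"
      by blast
    then show ?thesis
      using w(1) ab by (intro exI[of _ "(s \<odot>\<^bsub>A\<^esub> w, b) # zs'"]) (simp add: sum U)
  qed
qed

lemma separated_tensor: "separated_module T (P \<times> P') (tensor_eval e f)"
proof
  fix t assume t: "t \<in> carrier T" "\<And>z. z \<in> P \<times> P' \<Longrightarrow> tensor_eval e f t z = 0"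
  obtain zs where zs: "set zs \<subseteq> carrier A \<times> carrier B" "t = tensor_sum zs"
    using tensor_sum_cases[OF t(1)] .
  have "\<exists>zs'. set zs' \<subseteq> {\<zero>\<^bsub>A\<^esub>} \<times> carrier B \<and> tensor_sum zs' = tensor_sum zs"
    using zs t(2) by (intro tensor_sum_slices) (auto simp: A.eval_zero)
  then obtain zs' where zs': "set zs' \<subseteq> {\<zero>\<^bsub>A\<^esub>} \<times> carrier B" "tensor_sum zs' = t"
    using zs(2) by blast
  have "pure \<zero>\<^bsub>A\<^esub> b = \<zero>\<^bsub>T\<^esub>" if "b \<in> carrier B" for b
    using pure_smult_left[of "\<zero>\<^bsub>A\<^esub>" b 0] that pure_closed[of "\<zero>\<^bsub>A\<^esub>" b] by simp
  with zs'(1) have "tensor_sum zs' = \<zero>\<^bsub>T\<^esub>"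
    by (induction zs') auto
  with zs'(2) show "t = \<zero>\<^bsub>T\<^esub>" by simp
qed (rule tensor_eval_linear)

end

lemma separated_factorsI:
  "separated_module A P e \<Longrightarrow> separated_module B P' f \<Longrightarrow> separated_factors A P e B P' f"
  by (simp add: separated_factors_def)

context separated_factors
begin

text \<open>
  All linear maps out of tensor products that occur in the Hopf axioms are handled by this context. The
  value of \<open>\<beta> a b\<close> at a point \<open>r\<close> is the product of values of \<open>a\<close> and \<open>b\<close> at points depending on \<open>r\<close>, up to a
  scalar \<open>\<kappa> r\<close>. The scalar is needed for the associator, where a third factor is held fixed.
\<close>

context
  fixes V :: "('k, 'v, 'l) module_scheme" and R :: "'r set" and g :: "'v \<Rightarrow> 'r \<Rightarrow> 'k"
    and \<beta> :: "'a \<Rightarrow> 'b \<Rightarrow> 'v" and \<kappa> :: "'r \<Rightarrow> 'k" and x :: "'r \<Rightarrow> 'p" and y :: "'r \<Rightarrow> 'q"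
  assumes V: "separated_module V R g"
    and closed: "\<And>a b. a \<in> carrier A \<Longrightarrow> b \<in> carrier B \<Longrightarrow> \<beta> a b \<in> carrier V"
    and points: "\<And>r. r \<in> R \<Longrightarrow> x r \<in> P" "\<And>r. r \<in> R \<Longrightarrow> y r \<in> P'"
    and eval: "\<And>r a b. r \<in> R \<Longrightarrow> a \<in> carrier A \<Longrightarrow> b \<in> carrier B \<Longrightarrow>
      g (\<beta> a b) r = \<kappa> r * (e a (x r) * f b (y r))"
begin

interpretation V: separated_module V R g by (rule V)

lemma bilinear_on_by_eval: "bilinear_on A B V \<beta>"
proof (intro bilinear_onI linear_mapsI)
  fix a b b' c assume "a \<in> carrier A" "b \<in> carrier B" "b' \<in> carrier B"
  then show "\<beta> a (b \<oplus>\<^bsub>B\<^esub> b') = \<beta> a b \<oplus>\<^bsub>V\<^esub> \<beta> a b'"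
    by (intro V.eval_inject) (simp_all add: closed eval points V.eval_add B.eval_add algebra_simps)
next
  fix a b c assume "a \<in> carrier A" "b \<in> carrier B"
  then show "\<beta> a (c \<odot>\<^bsub>B\<^esub> b) = c \<odot>\<^bsub>V\<^esub> \<beta> a b" "\<beta> (c \<odot>\<^bsub>A\<^esub> a) b = c \<odot>\<^bsub>V\<^esub> \<beta> a b"
    by (intro V.eval_inject; simp add: closed eval points V.eval_smult A.eval_smult B.eval_smult)+
next
  fix a a' b assume "a \<in> carrier A" "a' \<in> carrier A" "b \<in> carrier B"
  then show "\<beta> (a \<oplus>\<^bsub>A\<^esub> a') b = \<beta> a b \<oplus>\<^bsub>V\<^esub> \<beta> a' b"
    by (intro V.eval_inject) (simp_all add: closed eval points V.eval_add A.eval_add algebra_simps)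
qed (simp_all add: closed)

lemma tensor_lift_closed_by_eval: "t \<in> carrier T \<Longrightarrow> tensor_lift V \<beta> t \<in> carrier V"
  by (rule tensor_lift_closed[OF V.vector_module_axioms bilinear_on_by_eval])

lemma eval_tensor_lift:
  assumes r: "r \<in> R" and t: "t \<in> carrier T"
  shows "g (tensor_lift V \<beta> t) r = \<kappa> r * tensor_eval e f t (x r, y r)"
proof -
  have "g (tensor_lift V \<beta> t) r = tensor_lift ground_algebra (\<lambda>a b. g (\<beta> a b) r) t"
    by (rule linear_tensor_lift[OF V.vector_module_axioms bilinear_on_by_eval
          vector_module_ground_algebra V.eval_linear[OF r] t])
  also have "\<dots> = tensor_lift ground_algebra (\<lambda>a b. \<kappa> r * (e a (x r) * f b (y r))) t"
  proof (rule tensor_lift_cong[OF t _ vector_module_ground_algebra])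
    show "bilinear_on A B ground_algebra (\<lambda>a b. \<kappa> r * (e a (x r) * f b (y r)))"
      using r by (intro bilinear_onI linear_mapsI)
        (simp_all add: points A.eval_add A.eval_smult B.eval_add B.eval_smult algebra_simps)
  qed (simp add: eval r)
  also have "\<dots> = \<kappa> r * tensor_lift ground_algebra (\<lambda>a b. e a (x r) * f b (y r)) t"
  proof (rule linear_tensor_lift[symmetric, OF vector_module_ground_algebra bilinear_on_eval
        vector_module_ground_algebra _ t])
    show "(*) (\<kappa> r) \<in> linear_maps ground_algebra ground_algebra"
      by (rule linear_mapsI) (simp_all add: algebra_simps)
  qed (simp_all add: points r)
  finally show ?thesis by (simp add: tensor_eval_def)
qed

end

text \<open>
  The product of two tensors is a double sum over chosen representatives; evaluated at points, this sum
  factors.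
\<close>

lemma eval_tensor_mult:
  assumes mult: "\<And>a a'. a \<in> carrier A \<Longrightarrow> a' \<in> carrier A \<Longrightarrow> a \<otimes>\<^bsub>A\<^esub> a' \<in> carrier A"
      "\<And>b b'. b \<in> carrier B \<Longrightarrow> b' \<in> carrier B \<Longrightarrow> b \<otimes>\<^bsub>B\<^esub> b' \<in> carrier B"
    and eval: "\<And>x a a'. x \<in> P \<Longrightarrow> a \<in> carrier A \<Longrightarrow> a' \<in> carrier A \<Longrightarrow> e (a \<otimes>\<^bsub>A\<^esub> a') x = e a x * e a' x"
      "\<And>y b b'. y \<in> P' \<Longrightarrow> b \<in> carrier B \<Longrightarrow> b' \<in> carrier B \<Longrightarrow> f (b \<otimes>\<^bsub>B\<^esub> b') y = f b y * f b' y"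
    and st: "s \<in> carrier T" "t \<in> carrier T"
  shows "s \<otimes>\<^bsub>T\<^esub> t \<in> carrier T"
    and "z \<in> P \<times> P' \<Longrightarrow> tensor_eval e f (s \<otimes>\<^bsub>T\<^esub> t) z = tensor_eval e f s z * tensor_eval e f t z"
proof -
  let ?p = "tensor_rep s" and ?q = "tensor_rep t"
  define u where "u v w = Poly_Mapping.single (fst v \<otimes>\<^bsub>A\<^esub> fst w, snd v \<otimes>\<^bsub>B\<^esub> snd w)
      (Poly_Mapping.lookup ?p v * Poly_Mapping.lookup ?q w)" for v w
  have keys: "Poly_Mapping.keys ?p \<subseteq> carrier A \<times> carrier B" "Poly_Mapping.keys ?q \<subseteq> carrier A \<times> carrier B"
    using tensor_rep_carrier(1) st by (simp_all add: formal_tensors_def)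
  have mem: "fst v \<in> carrier A" "snd v \<in> carrier B" if "v \<in> carrier A \<times> carrier B" for v
    using that by auto
  have u: "u v w \<in> formals" if "v \<in> Poly_Mapping.keys ?p" "w \<in> Poly_Mapping.keys ?q" for v w
    using that keys unfolding u_def by (intro single_formals mult mem) blast+
  have uu: "(\<Sum>w\<in>Poly_Mapping.keys ?q. u v w) \<in> formals" if "v \<in> Poly_Mapping.keys ?p" for v
    using u that by (intro formals_closed(6)) blast
  have st_eq: "s \<otimes>\<^bsub>T\<^esub> t = cls (\<Sum>v\<in>Poly_Mapping.keys ?p. \<Sum>w\<in>Poly_Mapping.keys ?q. u v w)"
    by (simp add: tensor_algebra_def u_def)
  with uu show "s \<otimes>\<^bsub>T\<^esub> t \<in> carrier T"
    by (simp add: cls_carrier formals_closed)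
  assume "z \<in> P \<times> P'"
  then obtain x y where z: "z = (x, y)" and xy: "x \<in> P" "y \<in> P'"
    by blast
  interpret K: vector_module "ground_algebra :: ('k, 'k) module"
    by (rule vector_module_ground_algebra)
  let ?h = "\<lambda>v. e (fst v) x * f (snd v) y"
  have lift_u: "formal_lift ground_algebra ?h (u v w)
      = Poly_Mapping.lookup ?p v * ?h v * (Poly_Mapping.lookup ?q w * ?h w)"
    if "v \<in> Poly_Mapping.keys ?p" "w \<in> Poly_Mapping.keys ?q" for v w
  proof -
    have "fst v \<in> carrier A" "snd v \<in> carrier B" "fst w \<in> carrier A" "snd w \<in> carrier B"
      using that keys mem by blast+
    then show ?thesis
      using xy by (simp add: u_def K.formal_lift_single eval)
  qed
  have rep: "tensor_eval e f r z
      = (\<Sum>v\<in>Poly_Mapping.keys (tensor_rep r). Poly_Mapping.lookup (tensor_rep r) v * ?h v)" for r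
    by (simp add: z tensor_eval_def tensor_lift_def finsum_ground_algebra)
  have "tensor_eval e f (s \<otimes>\<^bsub>T\<^esub> t) z
      = formal_lift ground_algebra ?h (\<Sum>v\<in>Poly_Mapping.keys ?p. \<Sum>w\<in>Poly_Mapping.keys ?q. u v w)"
    unfolding st_eq z tensor_eval_def prod.case
    by (intro tensor_lift_cls[OF vector_module_ground_algebra bilinear_on_eval] formals_closed(6) uu xy)
  also have "\<dots> = (\<Sum>v\<in>Poly_Mapping.keys ?p. \<Sum>w\<in>Poly_Mapping.keys ?q. formal_lift ground_algebra ?h (u v w))"
    by (simp add: K.formal_lift_sum finsum_ground_algebra Pi_iff)
  also have "\<dots> = tensor_eval e f s z * tensor_eval e f t z"
    by (simp add: rep sum_product lift_u)
  finally show "tensor_eval e f (s \<otimes>\<^bsub>T\<^esub> t) z = tensor_eval e f s z * tensor_eval e f t z" .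
qed

end


section \<open>Algebras of functions\<close>

text \<open>
  The operations are required as equations rather than through the definition of \<open>function_algebra\<close>, so
  that the locale applies to algebras and to Hopf algebras alike.
\<close>

locale function_subalgebra =
  fixes X :: "'p set" and H :: "('k::field, 'p \<Rightarrow> 'k, 'm) module_scheme" (structure)
  assumes extensional: "carrier H \<subseteq> extensional X"
    and operations:
      "u \<otimes> v = (\<lambda>x\<in>X. u x * v x)" "\<one> = (\<lambda>x\<in>X. 1)" "\<zero> = (\<lambda>x\<in>X. 0)"
      "u \<oplus> v = (\<lambda>x\<in>X. u x + v x)" "c \<odot> u = (\<lambda>x\<in>X. c * u x)"
    and one_in: "\<one> \<in> carrier H"
    and add_in: "u \<in> carrier H \<Longrightarrow> v \<in> carrier H \<Longrightarrow> u \<oplus> v \<in> carrier H"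
    and mult_in: "u \<in> carrier H \<Longrightarrow> v \<in> carrier H \<Longrightarrow> u \<otimes> v \<in> carrier H"
    and smult_in: "u \<in> carrier H \<Longrightarrow> c \<odot> u \<in> carrier H"
begin

lemma function_eqI: "u \<in> carrier H \<Longrightarrow> v \<in> carrier H \<Longrightarrow> (\<And>x. x \<in> X \<Longrightarrow> u x = v x) \<Longrightarrow> u = v"
  using extensional by (blast intro: extensionalityI)

lemma zero_in: "\<zero> \<in> carrier H"
proof -
  have "\<zero> = 0 \<odot> \<one>"
    by (simp add: operations restrict_def)
  with smult_in[OF one_in] show ?thesis by metis
qed

lemma operations_apply [simp]:
  "x \<in> X \<Longrightarrow> (u \<otimes> v) x = u x * v x" "x \<in> X \<Longrightarrow> \<one> x = 1" "x \<in> X \<Longrightarrow> \<zero> x = 0"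
  "x \<in> X \<Longrightarrow> (u \<oplus> v) x = u x + v x" "x \<in> X \<Longrightarrow> (c \<odot> u) x = c * u x"
  by (simp_all add: operations)

lemma vector_module_functions: "vector_module H"
  by (rule vector_moduleI; (intro function_eqI)?)
     (simp_all add: zero_in add_in smult_in algebra_simps)

lemma separated_functions: "separated_module H X (\<lambda>u. u)"
proof -
  interpret vector_module H by (rule vector_module_functions)
  show ?thesis
    by unfold_locales (auto intro!: linear_mapsI function_eqI)
qed

lemma k_algebra_functions: "k_algebra H"
proof -
  interpret vector_module H by (rule vector_module_functions)
  have "ring H"
  proof (rule ringI)
    show "Group.monoid H"
      by (rule Group.monoidI; (intro function_eqI)?) (simp_all add: one_in mult_in algebra_simps)
    show "abelian_group H" ..
  qed (rule function_eqI; simp add: add_in mult_in algebra_simps)+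
  moreover have "module (ground_algebra :: ('k, 'k) module) H" ..
  moreover have "(c \<odot> a) \<otimes> b = c \<odot> (a \<otimes> b)" "a \<otimes> (c \<odot> b) = c \<odot> (a \<otimes> b)" if "a \<in> carrier H" "b \<in> carrier H" for a b c
    using that by (intro function_eqI; simp add: mult_in)+
  ultimately show ?thesis
    by (simp add: k_algebra_def)
qed

sublocale fun_pair: separated_factors H X "\<lambda>u. u" H X "\<lambda>u. u"
  by (intro separated_factorsI separated_functions)

abbreviation "HH \<equiv> tensor_algebra H H"
abbreviation "ev \<equiv> tensor_eval (\<lambda>u :: 'p \<Rightarrow> 'k. u) (\<lambda>u :: 'p \<Rightarrow> 'k. u)"

lemma ev_mult:
  assumes "s \<in> carrier HH" "t \<in> carrier HH"
  shows "s \<otimes>\<^bsub>HH\<^esub> t \<in> carrier HH" "z \<in> X \<times> X \<Longrightarrow> ev (s \<otimes>\<^bsub>HH\<^esub> t) z = ev s z * ev t z"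
  using fun_pair.eval_tensor_mult[OF mult_in mult_in _ _ assms] by simp_all

lemma ev_one: "\<one>\<^bsub>HH\<^esub> \<in> carrier HH" "z \<in> X \<times> X \<Longrightarrow> ev \<one>\<^bsub>HH\<^esub> z = 1"
proof -
  have one: "\<one>\<^bsub>HH\<^esub> = pure_tensor H H \<one>\<^bsub>H\<^esub> \<one>\<^bsub>H\<^esub>"
    by (simp add: tensor_algebra_def)
  show "\<one>\<^bsub>HH\<^esub> \<in> carrier HH"
    unfolding one by (intro fun_pair.pure_closed one_in)
  show "ev \<one>\<^bsub>HH\<^esub> z = 1" if "z \<in> X \<times> X"
    unfolding one using that by (auto simp: fun_pair.tensor_eval_pure one_in)
qed

end


section \<open>Hopf algebras of functions\<close>

text \<open>
  The functions on a group whose translates span finite-dimensional spaces form a Hopf algebra, with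
  \<open>comult u\<close> representing \<open>(x, y) \<mapsto> u(x y)\<close>. Here \<open>m\<close>, \<open>e\<close> and \<open>i\<close> are only required to satisfy the group
  laws as far as functions in \<open>H\<close> can tell: a loop followed by its reverse is not the trivial loop, but
  loop integrals do not distinguish the two.
\<close>

locale function_hopf = function_subalgebra X H
  for X :: "'p set" and H :: "('k::field, 'p \<Rightarrow> 'k) hopf" +
  fixes m :: "'p \<Rightarrow> 'p \<Rightarrow> 'p" and e :: 'p and i :: "'p \<Rightarrow> 'p"
  assumes m_in: "x \<in> X \<Longrightarrow> y \<in> X \<Longrightarrow> m x y \<in> X" and e_in: "e \<in> X" and i_in: "x \<in> X \<Longrightarrow> i x \<in> X"
    and assoc: "u \<in> carrier H \<Longrightarrow> x \<in> X \<Longrightarrow> y \<in> X \<Longrightarrow> z \<in> X \<Longrightarrow> u (m (m x y) z) = u (m x (m y z))"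
    and unit: "u \<in> carrier H \<Longrightarrow> x \<in> X \<Longrightarrow> u (m e x) = u x" "u \<in> carrier H \<Longrightarrow> x \<in> X \<Longrightarrow> u (m x e) = u x"
    and inverse: "u \<in> carrier H \<Longrightarrow> x \<in> X \<Longrightarrow> u (m (i x) x) = u e"
      "u \<in> carrier H \<Longrightarrow> x \<in> X \<Longrightarrow> u (m x (i x)) = u e"
    and comult_in: "u \<in> carrier H \<Longrightarrow> comult H u \<in> carrier (tensor_algebra H H)"
    and comult_eval: "u \<in> carrier H \<Longrightarrow> x \<in> X \<Longrightarrow> y \<in> X \<Longrightarrow>
      tensor_eval (\<lambda>u. u) (\<lambda>u. u) (comult H u) (x, y) = u (m x y)"
    and counit_eq: "u \<in> carrier H \<Longrightarrow> counit H u = u e"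
    and antipode_in: "u \<in> carrier H \<Longrightarrow> antipode H u \<in> carrier H"
    and antipode_eval: "u \<in> carrier H \<Longrightarrow> x \<in> X \<Longrightarrow> antipode H u x = u (i x)"
begin

interpretation HH: separated_module HH "X \<times> X" ev
  by (rule fun_pair.separated_tensor)

interpretation left: separated_factors HH "X \<times> X" ev H X "\<lambda>u. u"
  by (intro separated_factorsI separated_functions fun_pair.separated_tensor)

interpretation right: separated_factors H X "\<lambda>u. u" HH "X \<times> X" ev
  by (intro separated_factorsI separated_functions fun_pair.separated_tensor)

interpretation HHH: separated_module "tensor_algebra H HH" "X \<times> X \<times> X" "tensor_eval (\<lambda>u. u) ev"
  by (rule right.separated_tensor)

lemma comult_hom: "comult H \<in> algebra_homs H HH"
proof -
  have "comult H \<one>\<^bsub>H\<^esub> = \<one>\<^bsub>HH\<^esub>"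
    by (rule HH.eval_inject) (auto simp: comult_in one_in ev_one comult_eval m_in)
  moreover have "comult H (u \<otimes>\<^bsub>H\<^esub> v) = comult H u \<otimes>\<^bsub>HH\<^esub> comult H v"
    if "u \<in> carrier H" "v \<in> carrier H" for u v
    using that by (intro HH.eval_inject) (auto simp: comult_in mult_in ev_mult comult_eval m_in)
  moreover have "comult H (u \<oplus>\<^bsub>H\<^esub> v) = comult H u \<oplus>\<^bsub>HH\<^esub> comult H v"
    if "u \<in> carrier H" "v \<in> carrier H" for u v
    using that by (intro HH.eval_inject) (auto simp: comult_in add_in HH.eval_add comult_eval m_in)
  moreover have "comult H (c \<odot>\<^bsub>H\<^esub> u) = c \<odot>\<^bsub>HH\<^esub> comult H u" if "u \<in> carrier H" for c u
    using that by (intro HH.eval_inject) (auto simp: comult_in smult_in HH.eval_smult comult_eval m_in)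
  ultimately show ?thesis
    using comult_in by (auto simp: algebra_homs_def ring_hom_def linear_maps_def)
qed

lemma counit_hom: "counit H \<in> algebra_homs H ground_algebra"
  using e_in by (auto simp: algebra_homs_def ring_hom_def linear_maps_def counit_eq
      one_in add_in mult_in smult_in)

lemma antipode_linear: "antipode H \<in> linear_maps H H"
proof (rule linear_mapsI)
  fix u v assume "u \<in> carrier H" "v \<in> carrier H"
  then show "antipode H (u \<oplus>\<^bsub>H\<^esub> v) = antipode H u \<oplus>\<^bsub>H\<^esub> antipode H v"
    by (intro function_eqI) (simp_all add: antipode_in add_in antipode_eval i_in)
next
  fix c u assume "u \<in> carrier H"
  then show "antipode H (c \<odot>\<^bsub>H\<^esub> u) = c \<odot>\<^bsub>H\<^esub> antipode H u"
    by (intro function_eqI) (simp_all add: antipode_in smult_in antipode_eval i_in)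
qed (rule antipode_in)

text \<open>
  The axioms for coassociativity, counit and antipode concern maps \<open>tensor_lift V \<beta>\<close> applied to
  \<open>comult H u\<close>; evaluating such a map at a point gives the value of \<open>u\<close> at a product of points.
\<close>

lemma lift_comult:
  assumes V: "separated_module V R g"
    and closed: "\<And>a b. a \<in> carrier H \<Longrightarrow> b \<in> carrier H \<Longrightarrow> \<beta> a b \<in> carrier V"
    and points: "\<And>r. r \<in> R \<Longrightarrow> x r \<in> X" "\<And>r. r \<in> R \<Longrightarrow> y r \<in> X"
    and eval: "\<And>r a b. r \<in> R \<Longrightarrow> a \<in> carrier H \<Longrightarrow> b \<in> carrier H \<Longrightarrow> g (\<beta> a b) r = a (x r) * b (y r)"
    and u: "u \<in> carrier H"
  shows "tensor_lift V \<beta> (comult H u) \<in> carrier V"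
    and "r \<in> R \<Longrightarrow> g (tensor_lift V \<beta> (comult H u)) r = u (m (x r) (y r))"
proof -
  have eval': "g (\<beta> a b) r = 1 * (a (x r) * b (y r))" if "r \<in> R" "a \<in> carrier H" "b \<in> carrier H" for r a b
    using eval that by simp
  show "tensor_lift V \<beta> (comult H u) \<in> carrier V"
    by (rule fun_pair.tensor_lift_closed_by_eval[where x = x and y = y and \<kappa> = "\<lambda>_. 1",
          OF V closed points eval' comult_in[OF u]])
  show "g (tensor_lift V \<beta> (comult H u)) r = u (m (x r) (y r))" if r: "r \<in> R"
  proof -
    have "g (tensor_lift V \<beta> (comult H u)) r = 1 * ev (comult H u) (x r, y r)"
      by (rule fun_pair.eval_tensor_lift[where x = x and y = y and \<kappa> = "\<lambda>_. 1",
            OF V closed points eval' r comult_in[OF u]])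
    then show ?thesis
      by (simp only: comult_eval[OF u points(1)[OF r] points(2)[OF r]] mult_1)
  qed
qed

lemma coassociative:
  assumes "u \<in> carrier H"
  shows "tensor_associator H H H (tensor_map HH H (comult H) id (comult H u))
    = tensor_map H HH id (comult H) (comult H u)"
proof -
  let ?ev3 = "tensor_eval (\<lambda>u. u) ev"
  have L: "tensor_map HH H (comult H) id (comult H u) \<in> carrier (tensor_algebra HH H)"
    "\<And>r. r \<in> (X \<times> X) \<times> X \<Longrightarrow> tensor_eval ev (\<lambda>u. u) (tensor_map HH H (comult H) id (comult H u)) r
      = u (m (m (fst (fst r)) (snd (fst r))) (snd r))"
    unfolding tensor_map_def using assms
    by (intro lift_comult[where x = "\<lambda>r. m (fst (fst r)) (snd (fst r))" and y = snd, OF left.separated_tensor];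
        auto simp: left.pure_closed comult_in left.tensor_eval_pure comult_eval m_in)+
  have R: "tensor_map H HH id (comult H) (comult H u) \<in> carrier (tensor_algebra H HH)"
    "\<And>r. r \<in> X \<times> X \<times> X \<Longrightarrow> ?ev3 (tensor_map H HH id (comult H) (comult H u)) r
      = u (m (fst r) (m (fst (snd r)) (snd (snd r))))"
    unfolding tensor_map_def using assms
    by (intro lift_comult[where x = fst and y = "\<lambda>r. m (fst (snd r)) (snd (snd r))", OF right.separated_tensor];
        auto simp: right.pure_closed comult_in right.tensor_eval_pure comult_eval m_in)+
  \<comment> \<open>The inner of the two nested lifts in the associator; the scalar factor is \<open>c\<close> at the last point.\<close>
  define \<gamma> where "\<gamma> T c = tensor_lift (tensor_algebra H HH) (\<lambda>a b. pure_tensor H HH a (pure_tensor H H b c)) T"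
    for T and c :: "'p \<Rightarrow> 'k"
  have \<gamma>: "\<gamma> T c \<in> carrier (tensor_algebra H HH)"
    "\<And>r. r \<in> X \<times> X \<times> X \<Longrightarrow> ?ev3 (\<gamma> T c) r = c (snd (snd r)) * ev T (fst r, fst (snd r))"
    if T: "T \<in> carrier HH" and c: "c \<in> carrier H" for T c
    unfolding \<gamma>_def using c
    by (intro fun_pair.tensor_lift_closed_by_eval[where x = fst and y = "\<lambda>r. fst (snd r)" and \<kappa> = "\<lambda>r. c (snd (snd r))", OF right.separated_tensor _ _ _ _ T]
          fun_pair.eval_tensor_lift[where x = fst and y = "\<lambda>r. fst (snd r)" and \<kappa> = "\<lambda>r. c (snd (snd r))", OF right.separated_tensor _ _ _ _ _ T];
        auto simp: right.pure_closed fun_pair.pure_closed right.tensor_eval_pure fun_pair.tensor_eval_pure)+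
  have \<gamma>': "?ev3 (\<gamma> T c) r = 1 * (ev T (fst r, fst (snd r)) * c (snd (snd r)))"
    if "r \<in> X \<times> X \<times> X" "T \<in> carrier HH" "c \<in> carrier H" for T c r
    using \<gamma>(2)[OF that(2,3,1)] by simp
  have assoc_def: "tensor_associator H H H = tensor_lift (tensor_algebra H HH) \<gamma>"
    by (simp add: tensor_associator_def \<gamma>_def[abs_def])
  have points: "(fst r, fst (snd r)) \<in> X \<times> X" "snd (snd r) \<in> X" if "r \<in> X \<times> X \<times> X" for r
    using that by auto
  show ?thesis
  proof (rule HHH.eval_inject)
    show "tensor_associator H H H (tensor_map HH H (comult H) id (comult H u)) \<in> carrier (tensor_algebra H HH)"
      unfolding assoc_def
      by (rule left.tensor_lift_closed_by_eval[where x = "\<lambda>r. (fst r, fst (snd r))" and y = "\<lambda>r. snd (snd r)" and \<kappa> = "\<lambda>_. 1",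
          OF right.separated_tensor \<gamma>(1) points \<gamma>' L(1)])
    fix r assume r: "r \<in> X \<times> X \<times> X"
    have "?ev3 (tensor_associator H H H (tensor_map HH H (comult H) id (comult H u))) r
        = 1 * tensor_eval ev (\<lambda>u. u) (tensor_map HH H (comult H) id (comult H u))
            ((fst r, fst (snd r)), snd (snd r))"
      unfolding assoc_def
      by (rule left.eval_tensor_lift[where x = "\<lambda>r. (fst r, fst (snd r))" and y = "\<lambda>r. snd (snd r)"
            and \<kappa> = "\<lambda>_. 1", OF right.separated_tensor \<gamma>(1) points \<gamma>' r L(1)])
    also have "\<dots> = u (m (m (fst r) (fst (snd r))) (snd (snd r)))"
      using points[OF r] by (subst L(2)) simp_all
    also have "\<dots> = ?ev3 (tensor_map H HH id (comult H) (comult H u)) r"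
      using r assms by (auto simp: R(2) assoc)
    finally show "?ev3 (tensor_associator H H H (tensor_map HH H (comult H) id (comult H u))) r
        = ?ev3 (tensor_map H HH id (comult H) (comult H u)) r" .
  qed (rule R(1))
qed

theorem hopf_algebra: "hopf_algebra H"
  unfolding hopf_algebra_def
proof (intro conjI ballI k_algebra_functions comult_hom counit_hom antipode_linear coassociative)
  fix u assume u: "u \<in> carrier H"
  note lift = lift_comult[OF separated_functions _ _ _ _ u]
  show "tensor_lift H (\<lambda>b c. counit H b \<odot>\<^bsub>H\<^esub> c) (comult H u) = u"
    by (rule function_eqI; (subst lift(2)[where x = "\<lambda>_. e" and y = "\<lambda>r. r"] | rule lift(1)[where x = "\<lambda>_. e" and y = "\<lambda>r. r"])?)
       (simp_all add: u e_in smult_in counit_eq unit)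
  show "tensor_lift H (\<lambda>b c. counit H c \<odot>\<^bsub>H\<^esub> b) (comult H u) = u"
    by (rule function_eqI; (subst lift(2)[where y = "\<lambda>_. e" and x = "\<lambda>r. r"] | rule lift(1)[where y = "\<lambda>_. e" and x = "\<lambda>r. r"])?)
       (simp_all add: u e_in smult_in counit_eq unit)
  show "tensor_lift H (\<lambda>b c. antipode H b \<otimes>\<^bsub>H\<^esub> c) (comult H u) = counit H u \<odot>\<^bsub>H\<^esub> \<one>\<^bsub>H\<^esub>"
    by (rule function_eqI; (subst lift(2)[where x = i and y = "\<lambda>r. r"] | rule lift(1)[where x = i and y = "\<lambda>r. r"])?)
       (simp_all add: u e_in i_in smult_in one_in mult_in counit_eq inverse antipode_in antipode_eval)
  show "tensor_lift H (\<lambda>b c. b \<otimes>\<^bsub>H\<^esub> antipode H c) (comult H u) = counit H u \<odot>\<^bsub>H\<^esub> \<one>\<^bsub>H\<^esub>"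
    by (rule function_eqI; (subst lift(2)[where y = i and x = "\<lambda>r. r"] | rule lift(1)[where y = i and x = "\<lambda>r. r"])?)
       (simp_all add: u e_in i_in smult_in one_in mult_in counit_eq inverse antipode_in antipode_eval)
qed

end

lemma algebra_homs_by_eval:
  assumes "function_subalgebra X H" "function_subalgebra Y L"
    and closed: "\<And>u. u \<in> carrier L \<Longrightarrow> \<phi> u \<in> carrier H"
    and F: "\<And>x. x \<in> X \<Longrightarrow> F x \<in> Y"
    and eval: "\<And>u x. u \<in> carrier L \<Longrightarrow> x \<in> X \<Longrightarrow> \<phi> u x = u (F x)"
  shows "\<phi> \<in> algebra_homs L H"
proof -
  interpret H: function_subalgebra X H by fact
  interpret L: function_subalgebra Y L by fact
  have "\<phi> \<one>\<^bsub>L\<^esub> = \<one>\<^bsub>H\<^esub>"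
    by (rule H.function_eqI) (simp_all add: closed L.one_in H.one_in eval F)
  moreover have "\<phi> (u \<otimes>\<^bsub>L\<^esub> v) = \<phi> u \<otimes>\<^bsub>H\<^esub> \<phi> v" "\<phi> (u \<oplus>\<^bsub>L\<^esub> v) = \<phi> u \<oplus>\<^bsub>H\<^esub> \<phi> v"
    if "u \<in> carrier L" "v \<in> carrier L" for u v
    using that
    by (intro H.function_eqI; simp add: closed L.mult_in H.mult_in L.add_in H.add_in eval F)+
  moreover have "\<phi> (c \<odot>\<^bsub>L\<^esub> u) = c \<odot>\<^bsub>H\<^esub> \<phi> u" if "u \<in> carrier L" for c u
    using that by (intro H.function_eqI) (simp_all add: closed L.smult_in H.smult_in eval F)
  ultimately show ?thesis
    using closed by (auto simp: algebra_homs_def ring_hom_def linear_maps_def)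
qed

text \<open>
  Composition with a map \<open>F\<close> is a morphism as soon as \<open>F\<close> respects the group structures in the eyes of the
  functions in \<open>L\<close>. This also covers inclusions of Hopf subalgebras, with \<open>F\<close> the identity.
\<close>

lemma hopf_homs_by_eval:
  assumes "function_hopf X H m e i" "function_hopf Y L m' e' i'"
    and closed: "\<And>u. u \<in> carrier L \<Longrightarrow> \<phi> u \<in> carrier H"
    and F: "\<And>x. x \<in> X \<Longrightarrow> F x \<in> Y"
    and eval: "\<And>u x. u \<in> carrier L \<Longrightarrow> x \<in> X \<Longrightarrow> \<phi> u x = u (F x)"
    and m: "\<And>u x y. u \<in> carrier L \<Longrightarrow> x \<in> X \<Longrightarrow> y \<in> X \<Longrightarrow> u (F (m x y)) = u (m' (F x) (F y))"
    and e: "\<And>u. u \<in> carrier L \<Longrightarrow> u (F e) = u e'"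
    and i: "\<And>u x. u \<in> carrier L \<Longrightarrow> x \<in> X \<Longrightarrow> u (F (i x)) = u (i' (F x))"
  shows "\<phi> \<in> hopf_homs L H"
proof -
  interpret H: function_hopf X H m e i by fact
  interpret L: function_hopf Y L m' e' i' by fact
  interpret HH: separated_module "tensor_algebra H H" "X \<times> X" H.ev
    by (rule H.fun_pair.separated_tensor)
  have "\<phi> \<in> algebra_homs L H"
    by (rule algebra_homs_by_eval[where F = F, OF H.function_subalgebra_axioms L.function_subalgebra_axioms closed F eval])
  moreover have "comult H (\<phi> u) = tensor_map H H \<phi> \<phi> (comult L u)" if u: "u \<in> carrier L" for u
  proof -
    have map: "tensor_map H H \<phi> \<phi> (comult L u) \<in> carrier (tensor_algebra H H)"
      "\<And>r. r \<in> X \<times> X \<Longrightarrow> H.ev (tensor_map H H \<phi> \<phi> (comult L u)) r = u (m' (F (fst r)) (F (snd r)))"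
      unfolding tensor_map_def
      by (intro L.lift_comult[where x = "\<lambda>r. F (fst r)" and y = "\<lambda>r. F (snd r)", OF H.fun_pair.separated_tensor _ _ _ _ u];
          auto simp: H.fun_pair.pure_closed H.fun_pair.tensor_eval_pure closed eval F)+
    show ?thesis
      by (rule HH.eval_inject) (auto simp: u map H.comult_in H.comult_eval closed eval H.m_in m)
  qed
  moreover have "counit H (\<phi> u) = counit L u" if "u \<in> carrier L" for u
    using that by (simp add: H.counit_eq L.counit_eq closed eval H.e_in e)
  moreover have "antipode H (\<phi> u) = \<phi> (antipode L u)" if "u \<in> carrier L" for u
    using that by (intro H.function_eqI)
      (simp_all add: closed H.antipode_in L.antipode_in H.antipode_eval L.antipode_eval eval H.i_in F i)
  ultimately show ?thesis
    by (simp add: hopf_homs_def)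
qed

text \<open>
  The comultiplication is chosen among the tensors with the right values; by \<open>separated_tensor\<close> there is at
  most one.
\<close>

definition representative_hopf ::
  "'p set \<Rightarrow> ('k::field, 'p \<Rightarrow> 'k) module \<Rightarrow> ('p \<Rightarrow> 'p \<Rightarrow> 'p) \<Rightarrow> 'p \<Rightarrow> ('p \<Rightarrow> 'p) \<Rightarrow> ('k, 'p \<Rightarrow> 'k) hopf" where
  "representative_hopf X A m e i = module.extend A (hopf.fields
     (\<lambda>u. SOME t. t \<in> carrier (tensor_algebra A A) \<and>
       (\<forall>x\<in>X. \<forall>y\<in>X. tensor_eval (\<lambda>u. u) (\<lambda>u. u) t (x, y) = u (m x y)))
     (\<lambda>u. u e)
     (\<lambda>u. \<lambda>x\<in>X. u (i x)))"

lemma truncate_representative_hopf: "module.truncate (representative_hopf X A m e i) = A"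
  by (simp add: representative_hopf_def module.defs)

lemma representative_hopf_simps [simp]:
  "carrier (representative_hopf X A m e i) = carrier A"
  "a \<otimes>\<^bsub>representative_hopf X A m e i\<^esub> b = a \<otimes>\<^bsub>A\<^esub> b"
  "\<one>\<^bsub>representative_hopf X A m e i\<^esub> = \<one>\<^bsub>A\<^esub>"
  "\<zero>\<^bsub>representative_hopf X A m e i\<^esub> = \<zero>\<^bsub>A\<^esub>"
  "a \<oplus>\<^bsub>representative_hopf X A m e i\<^esub> b = a \<oplus>\<^bsub>A\<^esub> b"
  "c \<odot>\<^bsub>representative_hopf X A m e i\<^esub> a = c \<odot>\<^bsub>A\<^esub> a"
  by (simp_all add: representative_hopf_def module.defs)

lemma tensor_algebra_representative_hopf:
  "tensor_algebra (representative_hopf X A m e i) (representative_hopf X A m e i) = tensor_algebra A A"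
  by (simp add: tensor_algebra_def pure_tensor_def tensor_class_def formal_tensors_def bilinear_relations_def)

lemma function_hopf_representative_hopf:
  assumes A: "function_subalgebra X A"
    and closed: "\<And>x y. x \<in> X \<Longrightarrow> y \<in> X \<Longrightarrow> m x y \<in> X" "e \<in> X" "\<And>x. x \<in> X \<Longrightarrow> i x \<in> X"
    and assoc: "\<And>u x y z. u \<in> carrier A \<Longrightarrow> x \<in> X \<Longrightarrow> y \<in> X \<Longrightarrow> z \<in> X \<Longrightarrow> u (m (m x y) z) = u (m x (m y z))"
    and unit: "\<And>u x. u \<in> carrier A \<Longrightarrow> x \<in> X \<Longrightarrow> u (m e x) = u x" "\<And>u x. u \<in> carrier A \<Longrightarrow> x \<in> X \<Longrightarrow> u (m x e) = u x"
    and inverse: "\<And>u x. u \<in> carrier A \<Longrightarrow> x \<in> X \<Longrightarrow> u (m (i x) x) = u e"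
      "\<And>u x. u \<in> carrier A \<Longrightarrow> x \<in> X \<Longrightarrow> u (m x (i x)) = u e"
    and representative: "\<And>u. u \<in> carrier A \<Longrightarrow> \<exists>t. t \<in> carrier (tensor_algebra A A) \<and>
      (\<forall>x\<in>X. \<forall>y\<in>X. tensor_eval (\<lambda>u. u) (\<lambda>u. u) t (x, y) = u (m x y))"
    and reversed: "\<And>u. u \<in> carrier A \<Longrightarrow> (\<lambda>x\<in>X. u (i x)) \<in> carrier A"
  shows "function_hopf X (representative_hopf X A m e i) m e i"
proof -
  let ?H = "representative_hopf X A m e i"
  interpret A: function_subalgebra X A by fact
  have comult: "comult ?H u \<in> carrier (tensor_algebra A A) \<and>
      (\<forall>x\<in>X. \<forall>y\<in>X. tensor_eval (\<lambda>u. u) (\<lambda>u. u) (comult ?H u) (x, y) = u (m x y))"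
    if "u \<in> carrier A" for u
    using someI_ex[OF representative[OF that]] by (simp add: representative_hopf_def module.defs hopf.defs)
  have rest: "counit ?H u = u e" "antipode ?H u = (\<lambda>x\<in>X. u (i x))" for u
    by (simp_all add: representative_hopf_def module.defs hopf.defs)
  show ?thesis
    by unfold_locales
      (use assms comult A.extensional A.one_in A.add_in A.mult_in A.smult_in in
        \<open>simp_all add: tensor_algebra_representative_hopf rest A.operations\<close>)
qed


section \<open>Convolution and signatures\<close>

text \<open>
  Functions on words form an algebra under the product dual to splitting a word into a prefix and a
  suffix. The recursive form makes associativity a plain induction; \<open>convolution_eq_sum\<close> is the usual sum.
\<close>

fun convolution :: "('f list \<Rightarrow> 'k) \<Rightarrow> ('f list \<Rightarrow> 'k) \<Rightarrow> 'f list \<Rightarrow> 'k::comm_ring_1" where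
  "convolution F G [] = F [] * G []"
| "convolution F G (w # ws) = F [] * G (w # ws) + convolution (\<lambda>vs. F (w # vs)) G ws"

lemma convolution_eq_sum: "convolution F G ws = (\<Sum>i\<le>length ws. F (take i ws) * G (drop i ws))"
proof (induction ws arbitrary: F)
  case (Cons w ws)
  show ?case
    by (simp add: Cons.IH sum.atMost_Suc_shift del: sum.atMost_Suc)
qed simp

lemma convolution_add_left:
  "convolution (\<lambda>vs. F vs + F' vs) G ws = convolution F G ws + convolution F' G ws"
  by (simp add: convolution_eq_sum sum.distrib algebra_simps)

lemma convolution_scale_left: "convolution (\<lambda>vs. c * F vs) G ws = c * convolution F G ws"
  by (simp add: convolution_eq_sum sum_distrib_left algebra_simps)

lemma convolution_assoc: "convolution (convolution F G) H = convolution F (convolution G H)"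
proof
  fix ws
  show "convolution (convolution F G) H ws = convolution F (convolution G H) ws"
  proof (induction ws arbitrary: F)
    case (Cons w ws)
    show ?case
      by (simp add: convolution_add_left convolution_scale_left Cons.IH algebra_simps)
  qed (simp add: algebra_simps)
qed

definition convolution_unit :: "'f list \<Rightarrow> 'k::comm_ring_1" where
  "convolution_unit ws = (if ws = [] then 1 else 0)"

lemma convolution_zero_left: "convolution (\<lambda>vs. 0) F ws = 0"
  by (induction ws) simp_all

lemma convolution_unit_left: "convolution convolution_unit F = F"
proof
  show "convolution convolution_unit F ws = F ws" for ws
    by (cases ws) (simp_all add: convolution_unit_def convolution_zero_left)
qed

lemma convolution_unit_right: "convolution F convolution_unit = F"
proof
  show "convolution F convolution_unit ws = F ws" for ws
    by (induction ws arbitrary: F) (simp_all add: convolution_unit_def)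
qed

text \<open>The operation on functions of words that corresponds to reversing a path.\<close>

definition signed_reversal :: "('f list \<Rightarrow> 'k) \<Rightarrow> 'f list \<Rightarrow> 'k::comm_ring_1" where
  "signed_reversal F ws = (- 1) ^ length ws * F (rev ws)"

lemma signed_reversal_convolution:
  fixes F G :: "'f list \<Rightarrow> 'k::comm_ring_1"
  shows "signed_reversal (convolution F G) = convolution (signed_reversal G) (signed_reversal F)"
proof
  fix ws :: "'f list"
  let ?n = "length ws"
  have "signed_reversal (convolution F G) ws
      = (\<Sum>i\<le>?n. (- 1) ^ ?n * (F (rev (drop (?n - i) ws)) * G (rev (take (?n - i) ws))))"
    by (simp add: signed_reversal_def convolution_eq_sum sum_distrib_left take_rev drop_rev)
  also have "\<dots> = (\<Sum>i\<le>?n. (- 1) ^ ?n * (F (rev (drop i ws)) * G (rev (take i ws))))"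
    by (rule sum.reindex_bij_witness[of _ "\<lambda>i. ?n - i" "\<lambda>i. ?n - i"]) auto
  also have "\<dots> = convolution (signed_reversal G) (signed_reversal F) ws"
    unfolding convolution_eq_sum
  proof (rule sum.cong)
    fix i assume "i \<in> {..?n}"
    then have "(- 1 :: 'k) ^ ?n = (- 1) ^ i * (- 1) ^ (?n - i)"
      by (simp flip: power_add)
    with \<open>i \<in> {..?n}\<close> show "(- 1) ^ ?n * (F (rev (drop i ws)) * G (rev (take i ws)))
        = signed_reversal G (take i ws) * signed_reversal F (drop i ws)"
      by (simp add: signed_reversal_def min_def algebra_simps)
  qed simp
  finally show "signed_reversal (convolution F G) ws
      = convolution (signed_reversal G) (signed_reversal F) ws" .
qed

text \<open>
  The value on \<open>ws\<close> of the exponential of a linear functional \<open>x\<close> in the convolution algebra: the word \<open>ws\<close> is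
  only reached by the power of \<open>x\<close> whose exponent is its length.
\<close>

definition letter_exponential :: "('f \<Rightarrow> 'k) \<Rightarrow> 'f list \<Rightarrow> 'k::field_char_0" where
  "letter_exponential x ws = prod_list (map x ws) / fact (length ws)"

lemma prod_list_map_uminus:
  "prod_list (map (\<lambda>w. - x w :: 'k::comm_ring_1) ws) = (- 1) ^ length ws * prod_list (map x ws)"
  by (induction ws) simp_all

text \<open>
  The exponentials of \<open>x\<close> and \<open>-x\<close> are inverse to each other: on a word of length \<open>n\<close> the convolution sum is
  a multiple of the binomial expansion of \<open>(1 - 1)\<^sup>n\<close>.
\<close>

lemma convolution_letter_exponential_uminus:
  fixes x :: "'f \<Rightarrow> 'k::field_char_0"
  shows "convolution (letter_exponential x) (letter_exponential (\<lambda>w. - x w)) = convolution_unit"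
proof
  fix ws :: "'f list"
  let ?n = "length ws"
  have "letter_exponential x (take i ws) * letter_exponential (\<lambda>w. - x w) (drop i ws)
      = prod_list (map x ws) / fact ?n * (of_nat (?n choose i) * 1 ^ i * (- 1) ^ (?n - i))"
    if "i \<le> ?n" for i
  proof -
    have "prod_list (map x ws) = prod_list (map x (take i ws)) * prod_list (map x (drop i ws))"
      by (metis append_take_drop_id map_append prod_list.append)
    moreover have "(of_nat (?n choose i) :: 'k) = fact ?n / (fact i * fact (?n - i))"
      using that by (rule binomial_fact)
    ultimately show ?thesis
      using that by (simp add: letter_exponential_def prod_list_map_uminus)
  qed
  then have "convolution (letter_exponential x) (letter_exponential (\<lambda>w. - x w)) ws
      = prod_list (map x ws) / fact ?n * (1 + - 1) ^ ?n"
    unfolding convolution_eq_sum binomial_ring sum_distrib_left by (intro sum.cong) auto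
  then show "convolution (letter_exponential x) (letter_exponential (\<lambda>w. - x w)) ws = convolution_unit ws"
    by (cases ws) (simp_all add: convolution_unit_def)
qed

lemma signed_reversal_letter_exponential:
  "signed_reversal (letter_exponential x) = letter_exponential (\<lambda>w. - x w)"
proof
  show "signed_reversal (letter_exponential x) ws = letter_exponential (\<lambda>w. - x w) ws" for ws
    by (simp add: signed_reversal_def letter_exponential_def prod_list_map_uminus rev_map[symmetric]
        prod_list.rev)
qed

text \<open>
  The discrete form of Chen's signature of a path. Each step is a functional on forms, the steps are
  exponentiated, and the results are multiplied in order.
\<close>

fun signature :: "('f \<Rightarrow> 'k) list \<Rightarrow> 'f list \<Rightarrow> 'k::field_char_0" where
  "signature [] = convolution_unit"
| "signature (x # xs) = convolution (letter_exponential x) (signature xs)"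

lemma signature_append: "signature (xs @ ys) = convolution (signature xs) (signature ys)"
  by (induction xs) (simp_all add: convolution_unit_left convolution_assoc)

lemma signature_empty_word: "signature xs [] = 1"
  by (induction xs) (simp_all add: convolution_unit_def letter_exponential_def)

definition inverse_steps :: "('f \<Rightarrow> 'k::field_char_0) list \<Rightarrow> ('f \<Rightarrow> 'k) list" where
  "inverse_steps xs = rev (map (\<lambda>x w. - x w) xs)"

lemma inverse_steps_simps [simp]:
  "inverse_steps [] = []" "inverse_steps (x # xs) = inverse_steps xs @ [\<lambda>w. - x w]"
  by (simp_all add: inverse_steps_def)

lemma inverse_steps_append: "inverse_steps (xs @ ys) = inverse_steps ys @ inverse_steps xs"
  by (simp add: inverse_steps_def)

lemma inverse_steps_inverse_steps [simp]: "inverse_steps (inverse_steps xs) = xs"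
  by (simp add: inverse_steps_def rev_map comp_def)

lemma signature_single: "signature [x] = letter_exponential x"
  by (simp add: convolution_unit_right)

lemma signature_inverse_steps: "signature (inverse_steps xs) = signed_reversal (signature xs)"
proof (induction xs)
  case Nil
  show ?case
    by (auto simp: fun_eq_iff signed_reversal_def convolution_unit_def)
next
  case (Cons x xs)
  have "signature (inverse_steps (x # xs))
      = convolution (signed_reversal (signature xs)) (signed_reversal (letter_exponential x))"
    by (simp only: inverse_steps_simps signature_append Cons.IH signature_single
        signed_reversal_letter_exponential)
  then show ?case
    by (simp add: signed_reversal_convolution)
qed

text \<open>A path followed by its reverse: the exponentials cancel in pairs from the middle.\<close>

lemma signature_cancel_right: "signature (xs @ inverse_steps xs) = convolution_unit"
proof (induction xs)
  case (Cons x xs)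
  have "signature ((x # xs) @ inverse_steps (x # xs))
      = convolution (letter_exponential x)
          (convolution (signature (xs @ inverse_steps xs)) (letter_exponential (\<lambda>w. - x w)))"
    unfolding signature_single[symmetric] signature_append[symmetric] by simp
  also have "\<dots> = convolution_unit"
    by (simp add: Cons.IH convolution_letter_exponential_uminus convolution_unit_left)
  finally show ?case .
qed simp

lemma signature_cancel_left: "signature (inverse_steps xs @ xs) = convolution_unit"
  using signature_cancel_right[of "inverse_steps xs"] by simp

subsection \<open>Iterated sums as signatures\<close>

text \<open>
  The index set and the summands of iterated integrals, for arbitrary step values \<open>s t\<close>.
\<close>

definition simplex :: "nat \<Rightarrow> nat \<Rightarrow> nat list set" where
  "simplex n r = {ts. length ts = r \<and> sorted ts \<and> set ts \<subseteq> {1..n}}"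

definition simplex_weight :: "(nat \<Rightarrow> 'f \<Rightarrow> 'k::field_char_0) \<Rightarrow> 'f list \<Rightarrow> nat list \<Rightarrow> 'k" where
  "simplex_weight s ws ts =
     (\<Prod>i<length ws. s (ts ! i) (ws ! i)) / (\<Prod>k\<in>set ts. fact (count_list ts k))"

lemma finite_simplex: "finite (simplex n r)"
  by (rule finite_subset[OF _ finite_lists_length_eq[of "{1..n}" r]]) (auto simp: simplex_def)

text \<open>
  Elements that do not occur contribute \<open>fact 0 = 1\<close>; so the index set may be enlarged, which makes the
  denominators of different lists comparable.
\<close>

lemma prod_fact_count_list:
  assumes "finite K" "set ts \<subseteq> K"
  shows "(\<Prod>k\<in>set ts. fact (count_list ts k)) = (\<Prod>k\<in>K. fact (count_list ts k) :: 'k::field_char_0)"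
  using assms by (intro prod.mono_neutral_left) (auto simp: count_list_0_iff)

lemma sorted_split_last:
  assumes "sorted ts" "set ts \<subseteq> {1..Suc n}"
  shows "ts = filter (\<lambda>t. t \<le> n) ts @ replicate (length ts - length (filter (\<lambda>t. t \<le> n) ts)) (Suc n)"
  using assms
proof (induction ts)
  case (Cons t ts)
  show ?case
  proof (cases "t \<le> n")
    case True
    with Cons show ?thesis by simp
  next
    case False
    with Cons.prems have "\<forall>t'\<in>set (t # ts). t' = Suc n"
      by fastforce
    then have "filter (\<lambda>t. t \<le> n) (t # ts) = []" "replicate (length (t # ts)) (Suc n) = t # ts"
      by (auto simp: filter_empty_conv intro!: replicate_length_same)
    then show ?thesis by (metis append_Nil diff_zero list.size(3))
  qed
qed simp

lemma simplex_weight_append_replicate: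
  fixes s :: "nat \<Rightarrow> 'f \<Rightarrow> 'k::field_char_0"
  assumes "ts \<in> simplex n j" "j \<le> length ws"
  shows "simplex_weight s ws (ts @ replicate (length ws - j) (Suc n))
    = simplex_weight s (take j ws) ts * letter_exponential (s (Suc n)) (drop j ws)"
proof -
  let ?r = "length ws" and ?us = "replicate (length ws - j) (Suc n)"
  have ts: "length ts = j" "set ts \<subseteq> {1..n}"
    using assms by (auto simp: simplex_def)
  have "(\<Prod>i<?r. s ((ts @ ?us) ! i) (ws ! i))
      = (\<Prod>i<j. s ((ts @ ?us) ! i) (ws ! i)) * (\<Prod>i=j..<?r. s ((ts @ ?us) ! i) (ws ! i))"
    using prod.atLeastLessThan_concat[of 0 j ?r "\<lambda>i. s ((ts @ ?us) ! i) (ws ! i)"] assms(2)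
    by (simp add: atLeast0LessThan)
  also have "(\<Prod>i<j. s ((ts @ ?us) ! i) (ws ! i)) = (\<Prod>i<j. s (ts ! i) (take j ws ! i))"
    using ts by (intro prod.cong) (auto simp: nth_append)
  also have "(\<Prod>i=j..<?r. s ((ts @ ?us) ! i) (ws ! i)) = (\<Prod>i=j..<?r. s (Suc n) (ws ! i))"
    using ts by (intro prod.cong) (auto simp: nth_append)
  also have "\<dots> = prod_list (map (s (Suc n)) (drop j ws))"
    using assms(2) prod.shift_bounds_nat_ivl[of "\<lambda>i. s (Suc n) (ws ! i)" 0 j "?r - j"]
    by (simp add: prod.list_conv_set_nth add.commute)
  finally have num: "(\<Prod>i<?r. s ((ts @ ?us) ! i) (ws ! i))
      = (\<Prod>i<j. s (ts ! i) (take j ws ! i)) * prod_list (map (s (Suc n)) (drop j ws))" .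
  have count: "count_list (replicate l (Suc n)) k = (if k = Suc n then l else 0)" for l k
    by (induction l) auto
  have "count_list ts (Suc n) = 0"
    using ts by (auto simp: count_list_0_iff)
  note count = count this
  have "(\<Prod>k\<in>set (ts @ ?us). fact (count_list (ts @ ?us) k))
      = (\<Prod>k\<in>{1..Suc n}. fact (count_list (ts @ ?us) k) :: 'k)"
    using ts by (intro prod_fact_count_list) auto
  also have "\<dots> = (\<Prod>k\<in>{1..n}. fact (count_list ts k)) * fact (?r - j)"
    using ts by (subst prod.nat_ivl_Suc') (auto simp: count intro!: prod.cong)
  also have "(\<Prod>k\<in>{1..n}. fact (count_list ts k)) = (\<Prod>k\<in>set ts. fact (count_list ts k) :: 'k)"
    using ts by (intro prod_fact_count_list[symmetric]) auto
  finally have den: "(\<Prod>k\<in>set (ts @ ?us). fact (count_list (ts @ ?us) k))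
      = (\<Prod>k\<in>set ts. fact (count_list ts k) :: 'k) * fact (?r - j)" .
  show ?thesis
    unfolding simplex_weight_def num den using assms(2)
    by (simp add: letter_exponential_def min_def)
qed

text \<open>
  A weakly increasing list over \<open>{1..Suc n}\<close> is a list over \<open>{1..n}\<close> followed by a block of entries \<open>Suc n\<close>. The
  block contributes the value of an exponential, whose factorial is the one in the denominator.
\<close>

lemma sum_simplex_Suc:
  "(\<Sum>ts\<in>simplex (Suc n) (length ws). simplex_weight s ws ts)
    = convolution (\<lambda>vs. \<Sum>ts\<in>simplex n (length vs). simplex_weight s vs ts)
        (letter_exponential (s (Suc n))) ws"
proof -
  let ?r = "length ws"
  let ?S = "SIGMA j:{..?r}. simplex n j"
  let ?f = "\<lambda>(j, ts). ts @ replicate (?r - j) (Suc n)"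
  let ?g = "\<lambda>ts. (length (filter (\<lambda>t. t \<le> n) ts), filter (\<lambda>t. t \<le> n) ts)"
  have "convolution (\<lambda>vs. \<Sum>ts\<in>simplex n (length vs). simplex_weight s vs ts)
        (letter_exponential (s (Suc n))) ws
      = (\<Sum>j\<le>?r. \<Sum>ts\<in>simplex n j. simplex_weight s (take j ws) ts * letter_exponential (s (Suc n)) (drop j ws))"
    by (simp add: convolution_eq_sum sum_distrib_right min.absorb2)
  also have "\<dots> = (\<Sum>(j, ts)\<in>?S. simplex_weight s (take j ws) ts * letter_exponential (s (Suc n)) (drop j ws))"
    by (rule sum.Sigma) (auto simp: finite_simplex)
  also have "\<dots> = (\<Sum>ts\<in>simplex (Suc n) ?r. simplex_weight s ws ts)"
  proof (rule sum.reindex_bij_witness[of _ ?g ?f])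
    fix z assume "z \<in> ?S"
    then obtain j ts where z: "z = (j, ts)" "j \<le> ?r" "ts \<in> simplex n j"
      by auto
    then have ts: "length ts = j" "sorted ts" "set ts \<subseteq> {1..n}"
      by (auto simp: simplex_def)
    then have "filter (\<lambda>t. t \<le> n) ts = ts"
      by (auto simp: filter_id_conv)
    with ts show "?g (?f z) = z"
      by (simp add: z)
    show "?f z \<in> simplex (Suc n) ?r"
      using ts z(2) by (auto simp: z(1) simplex_def sorted_append le_SucI)
    show "simplex_weight s ws (?f z)
        = (case z of (j, ts) \<Rightarrow> simplex_weight s (take j ws) ts * letter_exponential (s (Suc n)) (drop j ws))"
      using z by (simp add: simplex_weight_append_replicate)
  next
    fix ts assume "ts \<in> simplex (Suc n) ?r"
    then have ts: "length ts = ?r" "sorted ts" "set ts \<subseteq> {1..Suc n}"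
      by (auto simp: simplex_def)
    show "?f (?g ts) = ts"
      using sorted_split_last[OF ts(2,3)] ts(1) by simp
    have "length (filter (\<lambda>t. t \<le> n) ts) \<le> ?r"
      using length_filter_le[of _ ts] ts(1) by simp
    then show "?g ts \<in> ?S"
      using ts by (auto simp: simplex_def sorted_wrt_filter)
  qed
  finally show ?thesis ..
qed

lemma sum_simplex_eq_signature:
  "(\<Sum>ts\<in>simplex n (length ws). simplex_weight s ws ts) = signature (map s [1..<Suc n]) ws"
proof (induction n arbitrary: ws)
  case 0
  have "simplex 0 (length ws) = (if ws = [] then {[]} else {})"
    by (auto simp: simplex_def)
  then show ?case
    by (simp add: simplex_weight_def convolution_unit_def)
next
  case (Suc n)
  have "map s [1..<Suc (Suc n)] = map s [1..<Suc n] @ [s (Suc n)]"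
    by simp
  then show ?case
    by (simp only: sum_simplex_Suc Suc.IH signature_append signature_single)
qed


section \<open>Path maps and their steps\<close>

lemma line_digraph_arcD:
  assumes "line_digraph n I" "(i, j) \<in> parcs I"
  shows "i \<le> n" "j \<le> n" "j = Suc i \<or> i = Suc j"
  using assms by (auto simp: line_digraph_def)

lemma line_digraph_pverts: "line_digraph n I \<Longrightarrow> pverts I = {0..n}"
  by (simp add: line_digraph_def)

lemma line_digraph_Suc_iff: "line_digraph n I \<Longrightarrow> i < n \<Longrightarrow> (Suc i, i) \<in> parcs I \<longleftrightarrow> (i, Suc i) \<notin> parcs I"
  by (auto simp: line_digraph_def)

lemma line_digraphI:
  assumes "pverts I = {0..n}"
    and "\<And>i j. (i, j) \<in> parcs I \<Longrightarrow> i \<le> n \<and> j \<le> n \<and> (j = Suc i \<or> i = Suc j)"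
    and "\<And>i. i < n \<Longrightarrow> (Suc i, i) \<in> parcs I \<longleftrightarrow> (i, Suc i) \<notin> parcs I"
  shows "line_digraph n I"
proof -
  have "parcs I \<subseteq> (\<Union>i<n. {(i, Suc i), (Suc i, i)})"
    using assms(2) by (fastforce simp: Suc_le_eq)
  then show ?thesis
    using assms(1,3) by (auto simp: line_digraph_def)
qed

abbreviation weak_arc :: "'v pair_pre_digraph \<Rightarrow> 'v \<Rightarrow> 'v \<Rightarrow> bool" where
  "weak_arc G u v \<equiv> u = v \<or> (u, v) \<in> parcs G"

lemma digraph_mapsD:
  assumes "f \<in> digraph_maps G H"
  shows "v \<in> pverts G \<Longrightarrow> f v \<in> pverts H"
    and "(u, v) \<in> parcs G \<Longrightarrow> weak_arc H (f u) (f v)"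
    and "f \<in> extensional (pverts G)"
  using assms by (auto simp: digraph_maps_def PiE_def)

lemma digraph_mapsI:
  assumes "f \<in> extensional (pverts G)" "\<And>v. v \<in> pverts G \<Longrightarrow> f v \<in> pverts H"
    and "\<And>u v. (u, v) \<in> parcs G \<Longrightarrow> weak_arc H (f u) (f v)"
  shows "f \<in> digraph_maps G H"
  using assms by (auto simp: digraph_maps_def PiE_def)

lemma path_mapsD:
  assumes "\<alpha> \<in> path_maps G"
  shows "line_digraph (path_len \<alpha>) (path_line \<alpha>)" "path_fun \<alpha> \<in> digraph_maps (path_line \<alpha>) G"
    and "i \<le> path_len \<alpha> \<Longrightarrow> path_fun \<alpha> i \<in> pverts G"
    and "(i, j) \<in> parcs (path_line \<alpha>) \<Longrightarrow>
      weak_arc G (path_fun \<alpha> i) (path_fun \<alpha> j)"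
proof -
  show *: "line_digraph (path_len \<alpha>) (path_line \<alpha>)" "path_fun \<alpha> \<in> digraph_maps (path_line \<alpha>) G"
    using assms by (simp_all add: path_maps_def)
  show "path_fun \<alpha> i \<in> pverts G" if "i \<le> path_len \<alpha>"
    using digraph_mapsD(1)[OF *(2)] that by (simp add: line_digraph_pverts[OF *(1)])
  show "weak_arc G (path_fun \<alpha> i) (path_fun \<alpha> j)"
    if "(i, j) \<in> parcs (path_line \<alpha>)"
    using digraph_mapsD(2)[OF *(2) that] .
qed

lemma path_mapsI:
  assumes "line_digraph (path_len \<alpha>) (path_line \<alpha>)"
    and "path_fun \<alpha> \<in> extensional {0..path_len \<alpha>}"
    and "\<And>i. i \<le> path_len \<alpha> \<Longrightarrow> path_fun \<alpha> i \<in> pverts G"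
    and "\<And>i j. (i, j) \<in> parcs (path_line \<alpha>) \<Longrightarrow>
      weak_arc G (path_fun \<alpha> i) (path_fun \<alpha> j)"
  shows "\<alpha> \<in> path_maps G"
  using assms unfolding path_maps_def
  by (auto intro!: digraph_mapsI simp: line_digraph_pverts[OF assms(1)])

text \<open>
  All integrals along a path are determined by this sequence, and concatenation and reversal of paths act
  on it as on lists.
\<close>

definition path_steps :: "'v path_map \<Rightarrow> (('v \<times> 'v \<Rightarrow> 'k) \<Rightarrow> 'k::field_char_0) list" where
  "path_steps \<alpha> = map (\<lambda>t \<omega>. step_value \<omega> \<alpha> t) [1..<Suc (path_len \<alpha>)]"

lemma length_path_steps [simp]: "length (path_steps \<alpha>) = path_len \<alpha>"
  by (simp add: path_steps_def)

lemma nth_path_steps: "i < path_len \<alpha> \<Longrightarrow> path_steps \<alpha> ! i = (\<lambda>\<omega>. step_value \<omega> \<alpha> (Suc i))"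
  by (simp add: path_steps_def nth_upt del: upt_Suc)

lemma path_integral_eq_signature: "path_integral \<omega>s \<alpha> = signature (path_steps \<alpha>) \<omega>s"
proof -
  have "path_integral \<omega>s \<alpha>
      = (\<Sum>ts\<in>simplex (path_len \<alpha>) (length \<omega>s). simplex_weight (\<lambda>t \<omega>. step_value \<omega> \<alpha> t) \<omega>s ts)"
    by (simp add: path_integral_def simplex_def simplex_weight_def)
  then show ?thesis
    by (simp only: sum_simplex_eq_signature path_steps_def)
qed

definition path_concat :: "'v path_map \<Rightarrow> 'v path_map \<Rightarrow> 'v path_map" where
  "path_concat \<alpha> \<beta> =
     \<lparr>path_len = path_len \<alpha> + path_len \<beta>,
      path_line =
        \<lparr>pverts = {0..path_len \<alpha> + path_len \<beta>},
         parcs = parcs (path_line \<alpha>) \<union> {(path_len \<alpha> + i, path_len \<alpha> + j) |i j. (i, j) \<in> parcs (path_line \<beta>)}\<rparr>,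
      path_fun = (\<lambda>i\<in>{0..path_len \<alpha> + path_len \<beta>}.
        if i \<le> path_len \<alpha> then path_fun \<alpha> i else path_fun \<beta> (i - path_len \<alpha>))\<rparr>"

definition path_reverse :: "'v path_map \<Rightarrow> 'v path_map" where
  "path_reverse \<alpha> =
     \<lparr>path_len = path_len \<alpha>,
      path_line =
        \<lparr>pverts = {0..path_len \<alpha>},
         parcs = {(path_len \<alpha> - i, path_len \<alpha> - j) |i j. (i, j) \<in> parcs (path_line \<alpha>)}\<rparr>,
      path_fun = (\<lambda>i\<in>{0..path_len \<alpha>}. path_fun \<alpha> (path_len \<alpha> - i))\<rparr>"

definition path_image :: "('v \<Rightarrow> 'w) \<Rightarrow> 'v path_map \<Rightarrow> 'w path_map" where
  "path_image f \<alpha> =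
     \<lparr>path_len = path_len \<alpha>, path_line = path_line \<alpha>,
      path_fun = (\<lambda>i\<in>{0..path_len \<alpha>}. f (path_fun \<alpha> i))\<rparr>"

subsection \<open>Concatenation\<close>

lemma path_concat_simps [simp]:
  "path_len (path_concat \<alpha> \<beta>) = path_len \<alpha> + path_len \<beta>"
  "pverts (path_line (path_concat \<alpha> \<beta>)) = {0..path_len \<alpha> + path_len \<beta>}"
  by (simp_all add: path_concat_def)

lemma path_concat_fun_left [simp]: "i \<le> path_len \<alpha> \<Longrightarrow> path_fun (path_concat \<alpha> \<beta>) i = path_fun \<alpha> i"
  by (simp add: path_concat_def)

lemma path_concat_fun_right:
  "path_fun \<alpha> (path_len \<alpha>) = path_fun \<beta> 0 \<Longrightarrow> i \<le> path_len \<beta> \<Longrightarrow>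
    path_fun (path_concat \<alpha> \<beta>) (path_len \<alpha> + i) = path_fun \<beta> i"
  by (auto simp: path_concat_def)

lemma path_concat_arc_iff:
  "(i, j) \<in> parcs (path_line (path_concat \<alpha> \<beta>)) \<longleftrightarrow>
    (i, j) \<in> parcs (path_line \<alpha>) \<or>
    path_len \<alpha> \<le> i \<and> path_len \<alpha> \<le> j \<and> (i - path_len \<alpha>, j - path_len \<alpha>) \<in> parcs (path_line \<beta>)"
  by (auto simp: path_concat_def)

lemma path_concat_line_left:
  assumes "line_digraph (path_len \<alpha>) (path_line \<alpha>)" "i < path_len \<alpha>"
  shows "(i, Suc i) \<in> parcs (path_line (path_concat \<alpha> \<beta>)) \<longleftrightarrow> (i, Suc i) \<in> parcs (path_line \<alpha>)"
    and "(Suc i, i) \<in> parcs (path_line (path_concat \<alpha> \<beta>)) \<longleftrightarrow> (Suc i, i) \<in> parcs (path_line \<alpha>)"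
  using assms by (auto simp: path_concat_arc_iff)

lemma path_concat_line_right:
  assumes "line_digraph (path_len \<alpha>) (path_line \<alpha>)"
  shows "(path_len \<alpha> + i, Suc (path_len \<alpha> + i)) \<in> parcs (path_line (path_concat \<alpha> \<beta>)) \<longleftrightarrow>
      (i, Suc i) \<in> parcs (path_line \<beta>)"
    and "(Suc (path_len \<alpha> + i), path_len \<alpha> + i) \<in> parcs (path_line (path_concat \<alpha> \<beta>)) \<longleftrightarrow>
      (Suc i, i) \<in> parcs (path_line \<beta>)"
  using line_digraph_arcD[OF assms] by (auto simp: path_concat_arc_iff Suc_diff_le dest: line_digraph_arcD[OF assms])

lemma line_digraph_path_concat:
  assumes \<alpha>: "line_digraph (path_len \<alpha>) (path_line \<alpha>)" and \<beta>: "line_digraph (path_len \<beta>) (path_line \<beta>)"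
  shows "line_digraph (path_len \<alpha> + path_len \<beta>) (path_line (path_concat \<alpha> \<beta>))"
proof (rule line_digraphI)
  fix i j assume "(i, j) \<in> parcs (path_line (path_concat \<alpha> \<beta>))"
  then show "i \<le> path_len \<alpha> + path_len \<beta> \<and> j \<le> path_len \<alpha> + path_len \<beta> \<and> (j = Suc i \<or> i = Suc j)"
    unfolding path_concat_arc_iff
    using line_digraph_arcD[OF \<alpha>, of i j] line_digraph_arcD[OF \<beta>, of "i - path_len \<alpha>" "j - path_len \<alpha>"]
    by auto
next
  fix i assume i: "i < path_len \<alpha> + path_len \<beta>"
  show "(Suc i, i) \<in> parcs (path_line (path_concat \<alpha> \<beta>)) \<longleftrightarrow> (i, Suc i) \<notin> parcs (path_line (path_concat \<alpha> \<beta>))"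
  proof (cases "i < path_len \<alpha>")
    case True
    then show ?thesis
      by (simp add: path_concat_line_left[OF \<alpha>] line_digraph_Suc_iff[OF \<alpha>])
  next
    case False
    then obtain k where "i = path_len \<alpha> + k"
      by (metis le_add_diff_inverse not_less)
    with i show ?thesis
      by (simp add: path_concat_line_right[OF \<alpha>] line_digraph_Suc_iff[OF \<beta>])
  qed
qed simp

lemma path_concat_in_path_maps:
  assumes \<alpha>: "\<alpha> \<in> path_maps G" and \<beta>: "\<beta> \<in> path_maps G"
    and joint: "path_fun \<alpha> (path_len \<alpha>) = path_fun \<beta> 0"
  shows "path_concat \<alpha> \<beta> \<in> path_maps G"
proof (rule path_mapsI)
  show "line_digraph (path_len (path_concat \<alpha> \<beta>)) (path_line (path_concat \<alpha> \<beta>))"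
    using line_digraph_path_concat[OF path_mapsD(1)[OF \<alpha>] path_mapsD(1)[OF \<beta>]] by simp
  show "path_fun (path_concat \<alpha> \<beta>) \<in> extensional {0..path_len (path_concat \<alpha> \<beta>)}"
    by (simp add: path_concat_def)
next
  fix i assume "i \<le> path_len (path_concat \<alpha> \<beta>)"
  then show "path_fun (path_concat \<alpha> \<beta>) i \<in> pverts G"
    using path_mapsD(3)[OF \<alpha>, of i] path_mapsD(3)[OF \<beta>, of "i - path_len \<alpha>"]
    by (auto simp: path_concat_def)
next
  fix i j assume "(i, j) \<in> parcs (path_line (path_concat \<alpha> \<beta>))"
  then consider "(i, j) \<in> parcs (path_line \<alpha>)"
    | k l where "i = path_len \<alpha> + k" "j = path_len \<alpha> + l" "(k, l) \<in> parcs (path_line \<beta>)"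
    unfolding path_concat_arc_iff by (metis le_add_diff_inverse)
  then show "weak_arc G (path_fun (path_concat \<alpha> \<beta>) i) (path_fun (path_concat \<alpha> \<beta>) j)"
  proof cases
    case 1
    then show ?thesis
      using path_mapsD(4)[OF \<alpha> 1] line_digraph_arcD[OF path_mapsD(1)[OF \<alpha>] 1] by simp
  next
    case 2
    then show ?thesis
      using path_mapsD(4)[OF \<beta> 2(3)] line_digraph_arcD[OF path_mapsD(1)[OF \<beta>] 2(3)]
      by (simp add: path_concat_fun_right[OF joint])
  qed
qed

lemma path_steps_concat:
  assumes \<alpha>: "\<alpha> \<in> path_maps G" and joint: "path_fun \<alpha> (path_len \<alpha>) = path_fun \<beta> 0"
  shows "path_steps (path_concat \<alpha> \<beta>) = path_steps \<alpha> @ path_steps \<beta>"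
proof (rule nth_equalityI)
  note line = path_mapsD(1)[OF \<alpha>]
  fix i assume "i < length (path_steps (path_concat \<alpha> \<beta>))"
  then have i: "i < path_len \<alpha> + path_len \<beta>"
    by simp
  show "path_steps (path_concat \<alpha> \<beta>) ! i = (path_steps \<alpha> @ path_steps \<beta>) ! i"
  proof (cases "i < path_len \<alpha>")
    case True
    with i show ?thesis
      by (simp add: nth_append nth_path_steps step_value_def path_concat_line_left[OF line] fun_eq_iff)
  next
    case False
    then obtain k where k: "i = path_len \<alpha> + k"
      by (metis le_add_diff_inverse not_less)
    with i have "path_fun (path_concat \<alpha> \<beta>) i = path_fun \<beta> k"
      "path_fun (path_concat \<alpha> \<beta>) (Suc i) = path_fun \<beta> (Suc k)"
      using path_concat_fun_right[OF joint, of k] path_concat_fun_right[OF joint, of "Suc k"] by simp_all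
    with i k show ?thesis
      by (simp add: nth_append nth_path_steps step_value_def path_concat_line_right[OF line] fun_eq_iff)
  qed
qed simp

subsection \<open>Reversal\<close>

lemma path_reverse_simps [simp]:
  "path_len (path_reverse \<alpha>) = path_len \<alpha>"
  "pverts (path_line (path_reverse \<alpha>)) = {0..path_len \<alpha>}"
  "i \<le> path_len \<alpha> \<Longrightarrow> path_fun (path_reverse \<alpha>) i = path_fun \<alpha> (path_len \<alpha> - i)"
  by (simp_all add: path_reverse_def)

lemma path_reverse_arc_iff:
  assumes "line_digraph (path_len \<alpha>) (path_line \<alpha>)" "i \<le> path_len \<alpha>" "j \<le> path_len \<alpha>"
  shows "(i, j) \<in> parcs (path_line (path_reverse \<alpha>)) \<longleftrightarrow> (path_len \<alpha> - i, path_len \<alpha> - j) \<in> parcs (path_line \<alpha>)"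
proof
  assume "(i, j) \<in> parcs (path_line (path_reverse \<alpha>))"
  then obtain k l where "i = path_len \<alpha> - k" "j = path_len \<alpha> - l" and kl: "(k, l) \<in> parcs (path_line \<alpha>)"
    by (auto simp: path_reverse_def)
  then show "(path_len \<alpha> - i, path_len \<alpha> - j) \<in> parcs (path_line \<alpha>)"
    using line_digraph_arcD[OF assms(1) kl] by simp
next
  assume "(path_len \<alpha> - i, path_len \<alpha> - j) \<in> parcs (path_line \<alpha>)"
  moreover have "i = path_len \<alpha> - (path_len \<alpha> - i)" "j = path_len \<alpha> - (path_len \<alpha> - j)"
    using assms by simp_all
  ultimately show "(i, j) \<in> parcs (path_line (path_reverse \<alpha>))"
    unfolding path_reverse_def by auto
qed

lemma path_reverse_arcD:
  assumes "line_digraph (path_len \<alpha>) (path_line \<alpha>)" "(i, j) \<in> parcs (path_line (path_reverse \<alpha>))"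
  shows "i \<le> path_len \<alpha>" "j \<le> path_len \<alpha>" "(path_len \<alpha> - i, path_len \<alpha> - j) \<in> parcs (path_line \<alpha>)"
proof -
  show ij: "i \<le> path_len \<alpha>" "j \<le> path_len \<alpha>"
    using assms(2) by (auto simp: path_reverse_def)
  show "(path_len \<alpha> - i, path_len \<alpha> - j) \<in> parcs (path_line \<alpha>)"
    using assms(2) by (simp add: path_reverse_arc_iff[OF assms(1) ij])
qed

lemma line_digraph_path_reverse:
  assumes \<alpha>: "line_digraph (path_len \<alpha>) (path_line \<alpha>)"
  shows "line_digraph (path_len \<alpha>) (path_line (path_reverse \<alpha>))"
proof (rule line_digraphI)
  fix i j assume "(i, j) \<in> parcs (path_line (path_reverse \<alpha>))"
  note * = path_reverse_arcD[OF \<alpha> this]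
  from line_digraph_arcD(3)[OF \<alpha> *(3)] *(1,2)
  show "i \<le> path_len \<alpha> \<and> j \<le> path_len \<alpha> \<and> (j = Suc i \<or> i = Suc j)"
    by auto
next
  fix i assume i: "i < path_len \<alpha>"
  define k where "k = path_len \<alpha> - Suc i"
  have k: "path_len \<alpha> - i = Suc k" "path_len \<alpha> - Suc i = k" "k < path_len \<alpha>"
    using i by (auto simp: k_def)
  show "(Suc i, i) \<in> parcs (path_line (path_reverse \<alpha>)) \<longleftrightarrow> (i, Suc i) \<notin> parcs (path_line (path_reverse \<alpha>))"
    using i line_digraph_Suc_iff[OF \<alpha> k(3)] by (simp add: path_reverse_arc_iff[OF \<alpha>] k(1,2))
qed simp

lemma path_reverse_in_path_maps:
  assumes \<alpha>: "\<alpha> \<in> path_maps G"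
  shows "path_reverse \<alpha> \<in> path_maps G"
proof (rule path_mapsI)
  show "line_digraph (path_len (path_reverse \<alpha>)) (path_line (path_reverse \<alpha>))"
    using line_digraph_path_reverse[OF path_mapsD(1)[OF \<alpha>]] by simp
  show "path_fun (path_reverse \<alpha>) \<in> extensional {0..path_len (path_reverse \<alpha>)}"
    by (simp add: path_reverse_def)
  show "path_fun (path_reverse \<alpha>) i \<in> pverts G" if "i \<le> path_len (path_reverse \<alpha>)" for i
    using that path_mapsD(3)[OF \<alpha>] by simp
next
  fix i j assume "(i, j) \<in> parcs (path_line (path_reverse \<alpha>))"
  note * = path_reverse_arcD[OF path_mapsD(1)[OF \<alpha>] this]
  from path_mapsD(4)[OF \<alpha> *(3)] *(1,2)
  show "weak_arc G (path_fun (path_reverse \<alpha>) i) (path_fun (path_reverse \<alpha>) j)"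
    by simp
qed

lemma path_steps_reverse:
  assumes \<alpha>: "\<alpha> \<in> path_maps G"
  shows "path_steps (path_reverse \<alpha>) = inverse_steps (path_steps \<alpha>)"
proof (rule nth_equalityI)
  fix i assume "i < length (path_steps (path_reverse \<alpha>))"
  then have i: "i < path_len \<alpha>"
    by simp
  define k where "k = path_len \<alpha> - Suc i"
  have k: "path_len \<alpha> - i = Suc k" "path_len \<alpha> - Suc i = k" "k < path_len \<alpha>"
    using i by (auto simp: k_def)
  note line = path_mapsD(1)[OF \<alpha>]
  show "path_steps (path_reverse \<alpha>) ! i = inverse_steps (path_steps \<alpha>) ! i"
    using i k(3) line_digraph_Suc_iff[OF line k(3)]
    by (auto simp: inverse_steps_def rev_nth nth_path_steps step_value_def fun_eq_iff k(1,2)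
        path_reverse_arc_iff[OF line])
qed (simp add: inverse_steps_def)

subsection \<open>Images under digraph maps\<close>

lemma path_image_simps [simp]:
  "path_len (path_image f \<alpha>) = path_len \<alpha>"
  "path_line (path_image f \<alpha>) = path_line \<alpha>"
  "i \<le> path_len \<alpha> \<Longrightarrow> path_fun (path_image f \<alpha>) i = f (path_fun \<alpha> i)"
  by (simp_all add: path_image_def)

lemma path_image_in_path_maps:
  assumes \<alpha>: "\<alpha> \<in> path_maps G" and f: "f \<in> digraph_maps G H"
  shows "path_image f \<alpha> \<in> path_maps H"
proof (rule path_mapsI)
  show "path_fun (path_image f \<alpha>) \<in> extensional {0..path_len (path_image f \<alpha>)}"
    by (simp add: path_image_def)
  fix i j assume ij: "(i, j) \<in> parcs (path_line (path_image f \<alpha>))"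
  then have ij': "(i, j) \<in> parcs (path_line \<alpha>)" by simp
  then show "weak_arc H (path_fun (path_image f \<alpha>) i) (path_fun (path_image f \<alpha>) j)"
    using path_mapsD(4)[OF \<alpha> ij'] line_digraph_arcD[OF path_mapsD(1)[OF \<alpha>] ij'] digraph_mapsD(2)[OF f]
    by auto
qed (use path_mapsD[OF \<alpha>] digraph_mapsD(1)[OF f] in simp_all)

lemma path_image_comp:
  "path_image g (path_image f \<alpha>) = path_image (\<lambda>v. g (f v)) \<alpha>"
  by (auto simp: path_image_def fun_eq_iff)

lemma path_image_cong:
  "(\<And>i. i \<le> path_len \<alpha> \<Longrightarrow> f (path_fun \<alpha> i) = g (path_fun \<alpha> i)) \<Longrightarrow> path_image f \<alpha> = path_image g \<alpha>"
  by (auto simp: path_image_def fun_eq_iff)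

lemma path_image_id:
  assumes "\<alpha> \<in> path_maps G" "\<And>v. v \<in> pverts G \<Longrightarrow> f v = v"
  shows "path_image f \<alpha> = \<alpha>"
proof -
  have "path_fun \<alpha> \<in> extensional {0..path_len \<alpha>}"
    using digraph_mapsD(3)[OF path_mapsD(2)[OF assms(1)]] line_digraph_pverts[OF path_mapsD(1)[OF assms(1)]]
    by simp
  then have "(\<lambda>i\<in>{0..path_len \<alpha>}. f (path_fun \<alpha> i)) = path_fun \<alpha>"
    using path_mapsD(3)[OF assms(1)] assms(2) by (intro extensionalityI[of _ "{0..path_len \<alpha>}"]) auto
  then show ?thesis
    by (simp add: path_image_def)
qed

lemma path_image_concat:
  assumes "path_fun \<alpha> (path_len \<alpha>) = path_fun \<beta> 0"
  shows "path_image f (path_concat \<alpha> \<beta>) = path_concat (path_image f \<alpha>) (path_image f \<beta>)"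
  by (auto simp: path_image_def path_concat_def fun_eq_iff)

lemma path_image_reverse: "path_image f (path_reverse \<alpha>) = path_reverse (path_image f \<alpha>)"
  by (auto simp: path_image_def path_reverse_def fun_eq_iff)

lemma step_value_pullback_form:
  assumes \<alpha>: "\<alpha> \<in> path_maps G" and i: "i < path_len \<alpha>"
  shows "step_value (pullback_form G f \<omega>) \<alpha> (Suc i) = step_value \<omega> (path_image f \<alpha>) (Suc i)"
proof (cases "path_fun \<alpha> i = path_fun \<alpha> (Suc i)")
  case True
  with i show ?thesis
    by (simp add: step_value_def)
next
  case False
  then have "(i, Suc i) \<in> parcs (path_line \<alpha>) \<Longrightarrow> (path_fun \<alpha> i, path_fun \<alpha> (Suc i)) \<in> parcs G"
    "(i, Suc i) \<notin> parcs (path_line \<alpha>) \<Longrightarrow> (path_fun \<alpha> (Suc i), path_fun \<alpha> i) \<in> parcs G"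
    using path_mapsD(4)[OF \<alpha>] line_digraph_Suc_iff[OF path_mapsD(1)[OF \<alpha>] i] by metis+
  with False i show ?thesis
    by (auto simp: step_value_def pullback_form_def)
qed

lemma path_integral_pullback_form:
  assumes "\<alpha> \<in> path_maps G"
  shows "path_integral (map (pullback_form G f) \<omega>s) \<alpha> = path_integral \<omega>s (path_image f \<alpha>)"
proof -
  have "(\<Prod>i<length \<omega>s. step_value (map (pullback_form G f) \<omega>s ! i) \<alpha> (ts ! i))
      = (\<Prod>i<length \<omega>s. step_value (\<omega>s ! i) (path_image f \<alpha>) (ts ! i))"
    if "length ts = length \<omega>s" "set ts \<subseteq> {1..path_len \<alpha>}" for ts
  proof (rule prod.cong)
    fix i assume i: "i \<in> {..<length \<omega>s}"
    then have "ts ! i \<in> {1..path_len \<alpha>}"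
      using that by (metis lessThan_iff nth_mem subsetD)
    then obtain k where "ts ! i = Suc k" "k < path_len \<alpha>"
      by (cases "ts ! i") auto
    with i show "step_value (map (pullback_form G f) \<omega>s ! i) \<alpha> (ts ! i)
        = step_value (\<omega>s ! i) (path_image f \<alpha>) (ts ! i)"
      by (simp add: step_value_pullback_form[OF assms])
  qed simp
  then show ?thesis
    by (simp add: path_integral_def)
qed


section \<open>The algebras of iterated integrals\<close>

lemma function_algebra_simps [simp]:
  "u \<otimes>\<^bsub>function_algebra X\<^esub> v = (\<lambda>x\<in>X. u x * v x)" "\<one>\<^bsub>function_algebra X\<^esub> = (\<lambda>x\<in>X. 1)"
  "\<zero>\<^bsub>function_algebra X\<^esub> = (\<lambda>x\<in>X. 0)" "u \<oplus>\<^bsub>function_algebra X\<^esub> v = (\<lambda>x\<in>X. u x + v x)"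
  "c \<odot>\<^bsub>function_algebra X\<^esub> u = (\<lambda>x\<in>X. c * u x)"
  by (simp_all add: function_algebra_def)

lemma integral_algebra_simps [simp]:
  "u \<otimes>\<^bsub>integral_algebra G X\<^esub> v = (\<lambda>x\<in>X. u x * v x)" "\<one>\<^bsub>integral_algebra G X\<^esub> = (\<lambda>x\<in>X. 1)"
  "\<zero>\<^bsub>integral_algebra G X\<^esub> = (\<lambda>x\<in>X. 0)" "u \<oplus>\<^bsub>integral_algebra G X\<^esub> v = (\<lambda>x\<in>X. u x + v x)"
  "c \<odot>\<^bsub>integral_algebra G X\<^esub> u = (\<lambda>x\<in>X. c * u x)"
  by (simp_all add: integral_algebra_def function_algebra_def)

lemma path_integral_Nil [simp]: "path_integral [] \<alpha> = 1"
  by (simp add: path_integral_eq_signature signature_empty_word)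

lemma integral_algebra_carrier:
  "carrier (integral_algebra G X) = generated_subalgebra (function_algebra X)
     {integral_on X \<omega>s |\<omega>s. \<omega>s \<noteq> [] \<and> set \<omega>s \<subseteq> one_forms G}"
  by (simp add: integral_algebra_def)

lemma integral_on_Nil: "integral_on X [] = (\<lambda>x\<in>X. 1)"
  by (rule ext) (simp add: integral_on_def)

lemma integral_on_in:
  assumes "set \<omega>s \<subseteq> one_forms G"
  shows "integral_on X \<omega>s \<in> carrier (integral_algebra G X)"
proof (cases "\<omega>s = []")
  case True
  then show ?thesis
    using generated_subalgebra.one[of "function_algebra X"]
    by (simp add: integral_algebra_carrier integral_on_Nil)
next
  case False
  with assms show ?thesis
    unfolding integral_algebra_carrier by (intro generated_subalgebra.incl) blast
qed

text \<open>The integral of the empty word is the unit, so the unit is covered by the case of integrals.\<close>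

lemma integral_algebra_induct [consumes 1, case_names integral add mult smult]:
  assumes "u \<in> carrier (integral_algebra G X)"
    and integral: "\<And>\<omega>s. set \<omega>s \<subseteq> one_forms G \<Longrightarrow> P (integral_on X \<omega>s)"
    and add: "\<And>u v. u \<in> carrier (integral_algebra G X) \<Longrightarrow> v \<in> carrier (integral_algebra G X) \<Longrightarrow>
      P u \<Longrightarrow> P v \<Longrightarrow> P (u \<oplus>\<^bsub>integral_algebra G X\<^esub> v)"
    and mult: "\<And>u v. u \<in> carrier (integral_algebra G X) \<Longrightarrow> v \<in> carrier (integral_algebra G X) \<Longrightarrow>
      P u \<Longrightarrow> P v \<Longrightarrow> P (u \<otimes>\<^bsub>integral_algebra G X\<^esub> v)"
    and smult: "\<And>c u. u \<in> carrier (integral_algebra G X) \<Longrightarrow> P u \<Longrightarrow> P (c \<odot>\<^bsub>integral_algebra G X\<^esub> u)"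
  shows "P u"
  using assms(1) unfolding integral_algebra_carrier
proof (induction rule: generated_subalgebra.induct)
  case one
  show ?case
    using integral[of "[]"] by (simp add: integral_on_Nil restrict_def)
next
  case (incl u)
  then show ?case
    using integral by blast
next
  case (add u v)
  then show ?case
    using assms(3)[of u v] by (simp add: integral_algebra_carrier restrict_def)
next
  case (mult u v)
  then show ?case
    using assms(4)[of u v] by (simp add: integral_algebra_carrier restrict_def)
next
  case (smult u c)
  then show ?case
    using assms(5)[of u c] by (simp add: integral_algebra_carrier restrict_def)
qed

lemma function_subalgebra_integral_algebra:
  "function_subalgebra X (integral_algebra G X :: ('k::field_char_0, 'v path_map \<Rightarrow> 'k) module)"
proof
  show "carrier (integral_algebra G X) \<subseteq> extensional X"
  proof
    fix u assume "u \<in> carrier (integral_algebra G X)"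
    then show "u \<in> extensional X"
      by (induction rule: integral_algebra_induct) (auto simp: integral_on_def extensional_def)
  qed
  show "\<one>\<^bsub>integral_algebra G X\<^esub> \<in> carrier (integral_algebra G X)"
    using integral_on_in[of "[]" G X] by (simp add: integral_on_Nil)
  fix u v :: "'v path_map \<Rightarrow> 'k" and c
  assume u: "u \<in> carrier (integral_algebra G X)"
  then show "c \<odot>\<^bsub>integral_algebra G X\<^esub> u \<in> carrier (integral_algebra G X)"
    using generated_subalgebra.smult[of u "function_algebra X"] by (simp add: integral_algebra_carrier)
  assume "v \<in> carrier (integral_algebra G X)"
  with u show "u \<oplus>\<^bsub>integral_algebra G X\<^esub> v \<in> carrier (integral_algebra G X)"
    "u \<otimes>\<^bsub>integral_algebra G X\<^esub> v \<in> carrier (integral_algebra G X)"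
    using generated_subalgebra.add[of u "function_algebra X" _ v]
      generated_subalgebra.mult[of u "function_algebra X" _ v] by (simp_all add: integral_algebra_carrier)
qed simp_all

lemma integral_algebra_steps_cong:
  assumes "u \<in> carrier (integral_algebra G X)" "\<alpha> \<in> X" "\<beta> \<in> X"
    and "path_steps \<alpha> = (path_steps \<beta> :: (_ \<Rightarrow> 'k::field_char_0) list)"
  shows "u \<alpha> = (u \<beta> :: 'k)"
  using assms(1)
  by (induction rule: integral_algebra_induct)
     (simp_all add: assms integral_on_def path_integral_eq_signature)

text \<open>
  The group laws for concatenation and reversal of loops hold on the level of signatures, hence for all
  functions in the algebra generated by the integrals.
\<close>

lemma integral_algebra_signature_cong:
  assumes "u \<in> carrier (integral_algebra G X)" "\<alpha> \<in> X" "\<beta> \<in> X"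
    and "signature (path_steps \<alpha>) = signature (path_steps \<beta> :: (_ \<Rightarrow> 'k::field_char_0) list)"
  shows "u \<alpha> = (u \<beta> :: 'k)"
  using assms(1)
  by (induction rule: integral_algebra_induct)
     (simp_all add: assms integral_on_def path_integral_eq_signature)

subsection \<open>Pullback\<close>

lemma pullback_form_in: "pullback_form G f \<omega> \<in> one_forms G"
  by (simp add: pullback_form_def one_forms_def)

lemma integral_on_pullback:
  assumes "X \<subseteq> path_maps G" "\<And>\<alpha>. \<alpha> \<in> X \<Longrightarrow> path_image f \<alpha> \<in> Y"
  shows "(\<lambda>\<alpha>\<in>X. integral_on Y \<omega>s (path_image f \<alpha>)) = integral_on X (map (pullback_form G f) \<omega>s)"
  using assms by (auto simp: integral_on_def fun_eq_iff path_integral_pullback_form subset_iff)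

lemma pullback_in_integral_algebra:
  assumes "u \<in> carrier (integral_algebra H Y)" "X \<subseteq> path_maps G" "\<And>\<alpha>. \<alpha> \<in> X \<Longrightarrow> path_image f \<alpha> \<in> Y"
  shows "(\<lambda>\<alpha>\<in>X. u (path_image f \<alpha>)) \<in> carrier (integral_algebra G X)"
proof -
  interpret X: function_subalgebra X "integral_algebra G X"
    by (rule function_subalgebra_integral_algebra)
  show ?thesis
    using assms(1)
  proof (induction rule: integral_algebra_induct)
    case (integral \<omega>s)
    then show ?case
      by (auto simp: integral_on_pullback[OF assms(2,3)] intro!: integral_on_in pullback_form_in)
  next
    case (add u v)
    then show ?case
      using X.add_in[OF add(3,4)] by (simp add: assms(3) restrict_def cong: if_cong)
  next
    case (mult u v)
    then show ?case
      using X.mult_in[OF mult(3,4)] by (simp add: assms(3) restrict_def cong: if_cong)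
  next
    case (smult c u)
    then show ?case
      using X.smult_in[OF smult(2)] by (simp add: assms(3) restrict_def cong: if_cong)
  qed
qed


section \<open>The Hopf algebra of loop integrals\<close>

lemma loops_atD:
  assumes "\<alpha> \<in> loops_at A"
  shows "\<alpha> \<in> path_maps (fst A)" "path_fun \<alpha> 0 = snd A" "path_fun \<alpha> (path_len \<alpha>) = snd A"
  using assms by (simp_all add: loops_at_def)

lemma loops_at_path_maps: "loops_at A \<subseteq> path_maps (fst A)"
  by (auto simp: loops_at_def)

lemma path_concat_in_loops:
  assumes "\<alpha> \<in> loops_at A" "\<beta> \<in> loops_at A"
  shows "path_concat \<alpha> \<beta> \<in> loops_at A"
  using loops_atD[OF assms(1)] loops_atD[OF assms(2)]
    path_concat_fun_right[of \<alpha> \<beta> "path_len \<beta>"] path_concat_in_path_maps[of \<alpha> "fst A" \<beta>]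
  by (simp add: loops_at_def)

lemma path_reverse_in_loops: "\<alpha> \<in> loops_at A \<Longrightarrow> path_reverse \<alpha> \<in> loops_at A"
  by (simp add: loops_at_def path_reverse_in_path_maps)

lemma path_image_in_loops:
  "f \<in> based_maps A B \<Longrightarrow> \<alpha> \<in> loops_at A \<Longrightarrow> path_image f \<alpha> \<in> loops_at B"
  by (auto simp: loops_at_def based_maps_def path_image_in_path_maps)

lemma path_image_in_paths_from:
  "f \<in> based_maps A B \<Longrightarrow> \<alpha> \<in> paths_from A \<Longrightarrow> path_image f \<alpha> \<in> paths_from B"
  by (auto simp: paths_from_def based_maps_def path_image_in_path_maps)

lemma trivial_loop_in_loops: "based_digraph A \<Longrightarrow> trivial_loop (snd A) \<in> loops_at A"
  by (auto simp: loops_at_def trivial_loop_def based_digraph_def line_digraph_def intro!: path_mapsI)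

lemma path_steps_trivial_loop: "path_steps (trivial_loop x) = []"
  by (simp add: path_steps_def trivial_loop_def)

lemma path_steps_concat_loops:
  assumes "\<alpha> \<in> loops_at A" "\<beta> \<in> loops_at A"
  shows "path_steps (path_concat \<alpha> \<beta>) = path_steps \<alpha> @ path_steps \<beta>"
  using assms by (intro path_steps_concat[where G = "fst A"]) (auto simp: loops_at_def)

lemma path_steps_reverse_loops:
  "\<alpha> \<in> loops_at A \<Longrightarrow> path_steps (path_reverse \<alpha>) = inverse_steps (path_steps \<alpha>)"
  by (intro path_steps_reverse[where G = "fst A"]) (auto simp: loops_at_def)

lemma path_image_concat_loops:
  "\<alpha> \<in> loops_at A \<Longrightarrow> \<beta> \<in> loops_at A \<Longrightarrow>
    path_image f (path_concat \<alpha> \<beta>) = path_concat (path_image f \<alpha>) (path_image f \<beta>)"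
  by (intro path_image_concat) (auto simp: loops_at_def)

lemma function_subalgebra_loop_algebra: "function_subalgebra (loops_at A) (loop_algebra A)"
  unfolding loop_algebra_def by (rule function_subalgebra_integral_algebra)

lemma loop_integral_concat:
  assumes "\<alpha> \<in> loops_at A" "\<beta> \<in> loops_at A"
  shows "loop_integral_at A \<omega>s (path_concat \<alpha> \<beta>)
    = (\<Sum>i\<in>{0..length \<omega>s}. loop_integral_at A (take i \<omega>s) \<alpha> * loop_integral_at A (drop i \<omega>s) \<beta>)"
  using assms
  by (simp add: integral_on_def path_concat_in_loops path_integral_eq_signature path_steps_concat_loops
      signature_append convolution_eq_sum atLeast0AtMost)

lemma loop_integral_reverse:
  assumes "\<alpha> \<in> loops_at A"
  shows "loop_integral_at A \<omega>s (path_reverse \<alpha>) = (- 1) ^ length \<omega>s * loop_integral_at A (rev \<omega>s) \<alpha>"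
  using assms
  by (simp add: integral_on_def path_reverse_in_loops path_integral_eq_signature path_steps_reverse_loops
      signature_inverse_steps signed_reversal_def)

context
  fixes A :: "'v based_digraph" and L :: "('k::field_char_0, 'v path_map \<Rightarrow> 'k) module"
  defines "L \<equiv> loop_algebra A"
begin

interpretation L: function_subalgebra "loops_at A" L
  unfolding L_def by (rule function_subalgebra_loop_algebra)

lemma loop_integral_in: "set \<omega>s \<subseteq> one_forms (fst A) \<Longrightarrow> loop_integral_at A \<omega>s \<in> carrier L"
  by (simp add: L_def loop_algebra_def integral_on_in)

text \<open>
  Concatenation of paths is dual to deconcatenation of words; this is what the comultiplication
  prescribed on integrals expresses.
\<close>

lemma deconcatenation_eval:
  assumes "set \<omega>s \<subseteq> one_forms (fst A)"
  defines "t \<equiv> (\<Oplus>\<^bsub>tensor_algebra L L\<^esub>i\<in>{0..length \<omega>s}.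
      pure_tensor L L (loop_integral_at A (take i \<omega>s)) (loop_integral_at A (drop i \<omega>s)))"
  shows "t \<in> carrier (tensor_algebra L L)"
    and "\<alpha> \<in> loops_at A \<Longrightarrow> \<beta> \<in> loops_at A \<Longrightarrow> L.ev t (\<alpha>, \<beta>) = loop_integral_at A \<omega>s (path_concat \<alpha> \<beta>)"
proof -
  have in_L: "loop_integral_at A (take i \<omega>s) \<in> carrier L" "loop_integral_at A (drop i \<omega>s) \<in> carrier L" for i
    using assms(1) set_take_subset[of i \<omega>s] set_drop_subset[of i \<omega>s] by (intro loop_integral_in; blast)+
  note pure = L.fun_pair.pure_closed[OF in_L]
  show "t \<in> carrier (tensor_algebra L L)"
    unfolding t_def by (intro L.fun_pair.T.finsum_closed) (auto intro: pure)
  assume \<alpha>\<beta>: "\<alpha> \<in> loops_at A" "\<beta> \<in> loops_at A"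
  then have "(\<alpha>, \<beta>) \<in> loops_at A \<times> loops_at A" by blast
  then have "L.ev t (\<alpha>, \<beta>) = (\<Oplus>\<^bsub>ground_algebra\<^esub>i\<in>{0..length \<omega>s}.
      L.ev (pure_tensor L L (loop_integral_at A (take i \<omega>s)) (loop_integral_at A (drop i \<omega>s))) (\<alpha>, \<beta>))"
    unfolding t_def
    by (intro linear_maps_finsum[OF L.fun_pair.vector_module_tensor vector_module_ground_algebra
          L.fun_pair.tensor_eval_linear] pure) auto
  with \<alpha>\<beta> show "L.ev t (\<alpha>, \<beta>) = loop_integral_at A \<omega>s (path_concat \<alpha> \<beta>)"
    by (simp add: finsum_ground_algebra L.fun_pair.tensor_eval_pure in_L loop_integral_concat)
qed

text \<open>
  For generators the tensor is given by deconcatenation; the functions \<open>u\<close> for which there is one are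
  closed under sums, products and scalar multiples.
\<close>

lemma loop_algebra_representative:
  assumes "u \<in> carrier L"
  shows "\<exists>t. t \<in> carrier (tensor_algebra L L) \<and>
    (\<forall>\<alpha>\<in>loops_at A. \<forall>\<beta>\<in>loops_at A. L.ev t (\<alpha>, \<beta>) = u (path_concat \<alpha> \<beta>))"
  using assms unfolding L_def loop_algebra_def
proof (induction rule: integral_algebra_induct)
  case (integral \<omega>s)
  with deconcatenation_eval[OF integral] show ?case
    unfolding L_def loop_algebra_def by blast
next
  case (add u v)
  then obtain s t where "s \<in> carrier (tensor_algebra L L)" "t \<in> carrier (tensor_algebra L L)"
    "\<forall>\<alpha>\<in>loops_at A. \<forall>\<beta>\<in>loops_at A. L.ev s (\<alpha>, \<beta>) = u (path_concat \<alpha> \<beta>)"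
    "\<forall>\<alpha>\<in>loops_at A. \<forall>\<beta>\<in>loops_at A. L.ev t (\<alpha>, \<beta>) = v (path_concat \<alpha> \<beta>)"
    unfolding L_def loop_algebra_def by blast
  then have "s \<oplus>\<^bsub>tensor_algebra L L\<^esub> t \<in> carrier (tensor_algebra L L) \<and>
    (\<forall>\<alpha>\<in>loops_at A. \<forall>\<beta>\<in>loops_at A. L.ev (s \<oplus>\<^bsub>tensor_algebra L L\<^esub> t) (\<alpha>, \<beta>)
      = (u \<oplus>\<^bsub>L\<^esub> v) (path_concat \<alpha> \<beta>))"
    by (simp add: L.fun_pair.tensor_eval_add path_concat_in_loops)
  then show ?case
    unfolding L_def loop_algebra_def by blast
next
  case (mult u v)
  then obtain s t where "s \<in> carrier (tensor_algebra L L)" "t \<in> carrier (tensor_algebra L L)"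
    "\<forall>\<alpha>\<in>loops_at A. \<forall>\<beta>\<in>loops_at A. L.ev s (\<alpha>, \<beta>) = u (path_concat \<alpha> \<beta>)"
    "\<forall>\<alpha>\<in>loops_at A. \<forall>\<beta>\<in>loops_at A. L.ev t (\<alpha>, \<beta>) = v (path_concat \<alpha> \<beta>)"
    unfolding L_def loop_algebra_def by blast
  then have "s \<otimes>\<^bsub>tensor_algebra L L\<^esub> t \<in> carrier (tensor_algebra L L) \<and>
    (\<forall>\<alpha>\<in>loops_at A. \<forall>\<beta>\<in>loops_at A. L.ev (s \<otimes>\<^bsub>tensor_algebra L L\<^esub> t) (\<alpha>, \<beta>)
      = (u \<otimes>\<^bsub>L\<^esub> v) (path_concat \<alpha> \<beta>))"
    by (simp add: L.ev_mult path_concat_in_loops)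
  then show ?case
    unfolding L_def loop_algebra_def by blast
next
  case (smult c u)
  then obtain s where "s \<in> carrier (tensor_algebra L L)"
    "\<forall>\<alpha>\<in>loops_at A. \<forall>\<beta>\<in>loops_at A. L.ev s (\<alpha>, \<beta>) = u (path_concat \<alpha> \<beta>)"
    unfolding L_def loop_algebra_def by blast
  then have "c \<odot>\<^bsub>tensor_algebra L L\<^esub> s \<in> carrier (tensor_algebra L L) \<and>
    (\<forall>\<alpha>\<in>loops_at A. \<forall>\<beta>\<in>loops_at A. L.ev (c \<odot>\<^bsub>tensor_algebra L L\<^esub> s) (\<alpha>, \<beta>)
      = (c \<odot>\<^bsub>L\<^esub> u) (path_concat \<alpha> \<beta>))"
    by (simp add: L.fun_pair.tensor_eval_smult path_concat_in_loops)
  then show ?case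
    unfolding L_def loop_algebra_def by blast
qed

lemma loop_algebra_reverse:
  assumes "u \<in> carrier L"
  shows "(\<lambda>\<alpha>\<in>loops_at A. u (path_reverse \<alpha>)) \<in> carrier L"
  using assms unfolding L_def loop_algebra_def
proof (induction rule: integral_algebra_induct)
  case (integral \<omega>s)
  have "(\<lambda>\<alpha>\<in>loops_at A. loop_integral_at A \<omega>s (path_reverse \<alpha>))
      = (- 1) ^ length \<omega>s \<odot>\<^bsub>L\<^esub> loop_integral_at A (rev \<omega>s)"
    by (simp add: L.operations loop_integral_reverse restrict_def cong: if_cong)
  then show ?case
    using L.smult_in[OF loop_integral_in[of "rev \<omega>s"]] integral
    by (simp add: L_def loop_algebra_def restrict_def)
next
  case (add u v)
  then show ?case
    using L.add_in[unfolded L_def loop_algebra_def, OF add(3,4)]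
    by (simp add: path_reverse_in_loops restrict_def cong: if_cong)
next
  case (mult u v)
  then show ?case
    using L.mult_in[unfolded L_def loop_algebra_def, OF mult(3,4)]
    by (simp add: path_reverse_in_loops restrict_def cong: if_cong)
next
  case (smult c u)
  then show ?case
    using L.smult_in[unfolded L_def loop_algebra_def, OF smult(2)]
    by (simp add: path_reverse_in_loops restrict_def cong: if_cong)
qed

end

abbreviation loop_hopf_on ::
  "'v based_digraph \<Rightarrow> ('k::field_char_0, 'v path_map \<Rightarrow> 'k) module \<Rightarrow> ('k, 'v path_map \<Rightarrow> 'k) hopf" where
  "loop_hopf_on A L \<equiv> representative_hopf (loops_at A) L path_concat (trivial_loop (snd A)) path_reverse"

text \<open>
  Stated for subalgebras since it is used both for all loop integrals and for the homotopy invariant ones.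
  Only the existence of a comultiplication and of an antipode with values in \<open>L\<close> depends on \<open>L\<close>.
\<close>

lemma function_hopf_loops:
  fixes L :: "('k::field_char_0, 'v path_map \<Rightarrow> 'k) module"
  assumes A: "based_digraph A" and L: "function_subalgebra (loops_at A) L"
    and sub: "carrier L \<subseteq> carrier (loop_algebra A)"
    and representative: "\<And>u. u \<in> carrier L \<Longrightarrow> \<exists>t. t \<in> carrier (tensor_algebra L L) \<and>
      (\<forall>\<alpha>\<in>loops_at A. \<forall>\<beta>\<in>loops_at A.
        tensor_eval (\<lambda>u. u) (\<lambda>u. u) t (\<alpha>, \<beta>) = u (path_concat \<alpha> \<beta>))"
    and reversed: "\<And>u. u \<in> carrier L \<Longrightarrow> (\<lambda>\<alpha>\<in>loops_at A. u (path_reverse \<alpha>)) \<in> carrier L"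
  shows "function_hopf (loops_at A) (loop_hopf_on A L) path_concat (trivial_loop (snd A)) path_reverse"
proof (rule function_hopf_representative_hopf[OF L])
  note loops = path_concat_in_loops path_reverse_in_loops trivial_loop_in_loops[OF A]
  note steps = path_steps_concat_loops[where A = A] path_steps_reverse_loops[where A = A]
    path_steps_trivial_loop loops
  fix u assume "u \<in> carrier L"
  with sub have u: "u \<in> carrier (integral_algebra (fst A) (loops_at A))"
    by (auto simp: loop_algebra_def)
  note cancel = integral_algebra_signature_cong[OF u]
  fix \<alpha> \<beta> \<gamma> assume \<alpha>: "\<alpha> \<in> loops_at A"
  show "u (path_concat (trivial_loop (snd A)) \<alpha>) = u \<alpha>" "u (path_concat \<alpha> (trivial_loop (snd A))) = u \<alpha>"
    using \<alpha> by (intro cancel; simp add: steps)+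
  show "u (path_concat (path_reverse \<alpha>) \<alpha>) = u (trivial_loop (snd A))"
    "u (path_concat \<alpha> (path_reverse \<alpha>)) = u (trivial_loop (snd A))"
    using \<alpha> by (intro cancel; simp add: steps signature_cancel_left signature_cancel_right)+
  assume "\<beta> \<in> loops_at A" "\<gamma> \<in> loops_at A"
  with \<alpha> show "u (path_concat (path_concat \<alpha> \<beta>) \<gamma>) = u (path_concat \<alpha> (path_concat \<beta> \<gamma>))"
    by (intro cancel; simp add: steps)
qed (fact path_concat_in_loops path_reverse_in_loops trivial_loop_in_loops[OF A] representative reversed)+

lemma function_hopf_loop_algebra:
  assumes "based_digraph A"
  shows "function_hopf (loops_at A) (loop_hopf_on A (loop_algebra A)) path_concat (trivial_loop (snd A)) path_reverse"
  by (intro function_hopf_loops assms function_subalgebra_loop_algebra order_refl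
      loop_algebra_representative loop_algebra_reverse)

lemma loop_hopf_loop_hopf_on:
  assumes A: "based_digraph A"
  shows "loop_hopf A (loop_hopf_on A (loop_algebra A :: ('k::field_char_0, 'v path_map \<Rightarrow> 'k) module))"
    (is "loop_hopf A ?Q")
proof -
  interpret Q: function_hopf "loops_at A" ?Q path_concat "trivial_loop (snd A)" path_reverse
    by (rule function_hopf_loop_algebra[OF A])
  interpret QQ: separated_module "tensor_algebra ?Q ?Q" "loops_at A \<times> loops_at A" Q.ev
    by (rule Q.fun_pair.separated_tensor)
  have "comult ?Q (loop_integral_at A \<omega>s) = (\<Oplus>\<^bsub>tensor_algebra ?Q ?Q\<^esub>i\<in>{0..length \<omega>s}.
      pure_tensor ?Q ?Q (loop_integral_at A (take i \<omega>s)) (loop_integral_at A (drop i \<omega>s)))"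
    and "antipode ?Q (loop_integral_at A \<omega>s) = (- 1) ^ length \<omega>s \<odot>\<^bsub>?Q\<^esub> loop_integral_at A (rev \<omega>s)"
    if \<omega>s: "set \<omega>s \<subseteq> one_forms (fst A)" for \<omega>s
  proof -
    have pure: "pure_tensor ?Q ?Q = pure_tensor (loop_algebra A) (loop_algebra A)"
      by (simp add: pure_tensor_def[abs_def] tensor_class_def formal_tensors_def bilinear_relations_def)
    have in_Q: "loop_integral_at A \<omega>s \<in> carrier ?Q" "loop_integral_at A (rev \<omega>s) \<in> carrier ?Q"
      using \<omega>s by (simp_all add: loop_integral_in)
    show "comult ?Q (loop_integral_at A \<omega>s) = (\<Oplus>\<^bsub>tensor_algebra ?Q ?Q\<^esub>i\<in>{0..length \<omega>s}.
      pure_tensor ?Q ?Q (loop_integral_at A (take i \<omega>s)) (loop_integral_at A (drop i \<omega>s)))"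
      using deconcatenation_eval[OF \<omega>s] in_Q Q.comult_in[OF in_Q(1)]
      by (intro QQ.eval_inject)
        (auto simp: Q.comult_in Q.comult_eval pure tensor_algebra_representative_hopf
          simp del: representative_hopf_simps)
    show "antipode ?Q (loop_integral_at A \<omega>s) = (- 1) ^ length \<omega>s \<odot>\<^bsub>?Q\<^esub> loop_integral_at A (rev \<omega>s)"
      using in_Q
      by (intro Q.function_eqI)
        (simp_all add: Q.antipode_in Q.smult_in Q.antipode_eval loop_integral_reverse
          del: representative_hopf_simps)
  qed
  then show ?thesis
    by (simp add: loop_hopf_def truncate_representative_hopf Q.counit_eq)
qed


section \<open>Operations on loops respect homotopy\<close>

lemma shrinking_mapI:
  assumes "line_digraph n I" "line_digraph m J" "m \<le> n"
    and "h \<in> extensional {0..n}" "\<And>i. i \<le> n \<Longrightarrow> h i \<le> m"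
    and "\<And>i j. (i, j) \<in> parcs I \<Longrightarrow> weak_arc J (h i) (h j)"
    and "h 0 = 0" "h n = m" "\<And>i j. i \<le> j \<Longrightarrow> j \<le> n \<Longrightarrow> h i \<le> h j"
  shows "shrinking_map n I m J h"
  using assms by (auto simp: shrinking_map_def line_digraph_pverts intro!: digraph_mapsI)

lemma shrinking_mapD:
  assumes "shrinking_map n I m J h" "line_digraph n I" "line_digraph m J"
  shows "m \<le> n" "h 0 = 0" "h n = m"
    and "i \<le> n \<Longrightarrow> h i \<le> m"
    and "(i, j) \<in> parcs I \<Longrightarrow> weak_arc J (h i) (h j)"
    and "i \<le> j \<Longrightarrow> j \<le> n \<Longrightarrow> h i \<le> h j"
  using assms digraph_mapsD[of h I J] by (auto simp: shrinking_map_def line_digraph_pverts)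

text \<open>
  The rungs of a cylinder point from the longer to the shorter path, those of an inverse cylinder
  the other way; the two relations below treat both cases at once.
\<close>

definition rung_relations :: "'v pair_pre_digraph \<Rightarrow> ('v \<Rightarrow> 'v \<Rightarrow> bool) set" where
  "rung_relations G = {weak_arc G, \<lambda>u v. weak_arc G v u}"

lemma rung_relations_refl: "R \<in> rung_relations G \<Longrightarrow> R u u"
  by (auto simp: rung_relations_def)

text \<open>
  A map out of a cylinder is determined by its restrictions to both ends, so beyond the path maps
  only the rungs impose a condition.
\<close>

lemma one_step_C_homotopic_iff:
  "one_step_C_homotopic G \<alpha> \<beta> \<longleftrightarrow>
     \<alpha> \<in> path_maps G \<and> \<beta> \<in> path_maps G \<and> path_fun \<alpha> 0 = path_fun \<beta> 0 \<and>
     path_fun \<alpha> (path_len \<alpha>) = path_fun \<beta> (path_len \<beta>) \<and>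
     (\<exists>h. shrinking_map (path_len \<alpha>) (path_line \<alpha>) (path_len \<beta>) (path_line \<beta>) h \<and>
       (\<exists>R\<in>rung_relations G. \<forall>i\<le>path_len \<alpha>. R (path_fun \<alpha> i) (path_fun \<beta> (h i))))"
    (is "_ \<longleftrightarrow> ?R")
proof
  assume L: "one_step_C_homotopic G \<alpha> \<beta>"
  then obtain h F where maps: "\<alpha> \<in> path_maps G" "\<beta> \<in> path_maps G"
    and h: "shrinking_map (path_len \<alpha>) (path_line \<alpha>) (path_len \<beta>) (path_line \<beta>) h"
    and F: "F \<in> digraph_maps (cylinder (path_line \<alpha>) (path_line \<beta>) h) G \<or>
      F \<in> digraph_maps (inverse_cylinder (path_line \<alpha>) (path_line \<beta>) h) G"
      "\<forall>i\<in>pverts (path_line \<alpha>). F (Inl i) = path_fun \<alpha> i" "\<forall>j\<in>pverts (path_line \<beta>). F (Inr j) = path_fun \<beta> j"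
    unfolding one_step_C_homotopic_def by blast
  note line = path_mapsD(1)[OF maps(1)] path_mapsD(1)[OF maps(2)]
  note pverts = line_digraph_pverts[OF line(1)] line_digraph_pverts[OF line(2)]
  have ends: "F (Inl i) = path_fun \<alpha> i" "F (Inr (h i)) = path_fun \<beta> (h i)" if "i \<le> path_len \<alpha>" for i
    using F(2,3) shrinking_mapD(4)[OF h line that] that by (auto simp: pverts)
  have "\<exists>R\<in>rung_relations G. \<forall>i\<le>path_len \<alpha>. R (path_fun \<alpha> i) (path_fun \<beta> (h i))"
    using F(1)
  proof
    assume "F \<in> digraph_maps (cylinder (path_line \<alpha>) (path_line \<beta>) h) G"
    note FD = digraph_mapsD(2)[OF this]
    have "weak_arc G (F (Inl i)) (F (Inr (h i)))" if "i \<le> path_len \<alpha>" for i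
      using that by (intro FD) (auto simp: cylinder_def pverts)
    with ends show ?thesis by (auto simp: rung_relations_def)
  next
    assume "F \<in> digraph_maps (inverse_cylinder (path_line \<alpha>) (path_line \<beta>) h) G"
    note FD = digraph_mapsD(2)[OF this]
    have "weak_arc G (F (Inr (h i))) (F (Inl i))" if "i \<le> path_len \<alpha>" for i
      using that by (intro FD) (auto simp: inverse_cylinder_def pverts)
    with ends show ?thesis by (auto simp: rung_relations_def)
  qed
  with L maps h show ?R
    unfolding one_step_C_homotopic_def by blast
next
  assume R: ?R
  then obtain h R where maps: "\<alpha> \<in> path_maps G" "\<beta> \<in> path_maps G"
    and h: "shrinking_map (path_len \<alpha>) (path_line \<alpha>) (path_len \<beta>) (path_line \<beta>) h"
    and rungs: "R \<in> rung_relations G" "\<forall>i\<le>path_len \<alpha>. R (path_fun \<alpha> i) (path_fun \<beta> (h i))"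
    by blast
  note line = path_mapsD(1)[OF maps(1)] path_mapsD(1)[OF maps(2)]
  note pverts = line_digraph_pverts[OF line(1)] line_digraph_pverts[OF line(2)]
  define F where "F = restrict (case_sum (path_fun \<alpha>) (path_fun \<beta>)) ({0..path_len \<alpha>} <+> {0..path_len \<beta>})"
  have F: "i \<le> path_len \<alpha> \<Longrightarrow> F (Inl i) = path_fun \<alpha> i" "j \<le> path_len \<beta> \<Longrightarrow> F (Inr j) = path_fun \<beta> j" for i j
    by (auto simp: F_def)
  have ext: "F \<in> extensional ({0..path_len \<alpha>} <+> {0..path_len \<beta>})"
    by (simp add: F_def)
  have verts: "F v \<in> pverts G" if "v \<in> {0..path_len \<alpha>} <+> {0..path_len \<beta>}" for v
    using that path_mapsD(3)[OF maps(1)] path_mapsD(3)[OF maps(2)] by (auto simp: F)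
  have arcs: "(i, j) \<in> parcs (path_line \<alpha>) \<Longrightarrow> weak_arc G (F (Inl i)) (F (Inl j))"
    "(k, l) \<in> parcs (path_line \<beta>) \<Longrightarrow> weak_arc G (F (Inr k)) (F (Inr l))" for i j k l
    using path_mapsD(4)[OF maps(1), of i j] path_mapsD(4)[OF maps(2), of k l]
      line_digraph_arcD[OF line(1), of i j] line_digraph_arcD[OF line(2), of k l] by (simp_all add: F)
  have rung: "\<forall>i\<le>path_len \<alpha>. R (F (Inl i)) (F (Inr (h i)))"
    using rungs(2) shrinking_mapD(4)[OF h line] by (simp add: F)
  from rungs(1) consider "R = weak_arc G" | "R = (\<lambda>u v. weak_arc G v u)"
    by (auto simp: rung_relations_def)
  then have "F \<in> digraph_maps (cylinder (path_line \<alpha>) (path_line \<beta>) h) G \<union>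
      digraph_maps (inverse_cylinder (path_line \<alpha>) (path_line \<beta>) h) G"
  proof cases
    case 1
    have "F \<in> digraph_maps (cylinder (path_line \<alpha>) (path_line \<beta>) h) G"
    proof (rule digraph_mapsI)
      fix u v assume "(u, v) \<in> parcs (cylinder (path_line \<alpha>) (path_line \<beta>) h)"
      then show "weak_arc G (F u) (F v)"
        using arcs rung[unfolded 1] by (auto simp: cylinder_def pverts)
    qed (use ext verts in \<open>simp_all add: cylinder_def pverts\<close>)
    then show ?thesis by blast
  next
    case 2
    have "F \<in> digraph_maps (inverse_cylinder (path_line \<alpha>) (path_line \<beta>) h) G"
    proof (rule digraph_mapsI)
      fix u v assume "(u, v) \<in> parcs (inverse_cylinder (path_line \<alpha>) (path_line \<beta>) h)"
      then show "weak_arc G (F u) (F v)"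
        using arcs rung[unfolded 2] by (auto simp: inverse_cylinder_def pverts)
    qed (use ext verts in \<open>simp_all add: inverse_cylinder_def pverts\<close>)
    then show ?thesis by blast
  qed
  moreover have "\<forall>i\<in>pverts (path_line \<alpha>). F (Inl i) = path_fun \<alpha> i"
    "\<forall>j\<in>pverts (path_line \<beta>). F (Inr j) = path_fun \<beta> j"
    by (simp_all add: F pverts)
  ultimately show "one_step_C_homotopic G \<alpha> \<beta>"
    using R h unfolding one_step_C_homotopic_def by blast
qed

lemma one_step_C_homotopicE:
  assumes "one_step_C_homotopic G \<alpha> \<beta>"
  obtains h R where "\<alpha> \<in> path_maps G" "\<beta> \<in> path_maps G" "path_fun \<alpha> 0 = path_fun \<beta> 0"
    "path_fun \<alpha> (path_len \<alpha>) = path_fun \<beta> (path_len \<beta>)"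
    "shrinking_map (path_len \<alpha>) (path_line \<alpha>) (path_len \<beta>) (path_line \<beta>) h"
    "R \<in> rung_relations G" "\<And>i. i \<le> path_len \<alpha> \<Longrightarrow> R (path_fun \<alpha> i) (path_fun \<beta> (h i))"
  using assms that unfolding one_step_C_homotopic_iff by blast

lemma one_step_C_homotopicI:
  assumes "\<alpha> \<in> path_maps G" "\<beta> \<in> path_maps G" "path_fun \<alpha> 0 = path_fun \<beta> 0"
    "path_fun \<alpha> (path_len \<alpha>) = path_fun \<beta> (path_len \<beta>)"
    "shrinking_map (path_len \<alpha>) (path_line \<alpha>) (path_len \<beta>) (path_line \<beta>) h"
    "R \<in> rung_relations G" "\<And>i. i \<le> path_len \<alpha> \<Longrightarrow> R (path_fun \<alpha> i) (path_fun \<beta> (h i))"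
  shows "one_step_C_homotopic G \<alpha> \<beta>"
  unfolding one_step_C_homotopic_iff
  by (intro conjI exI[of _ h] bexI[of _ R] allI impI assms)

lemma one_step_C_homotopic_image:
  assumes "one_step_C_homotopic G \<alpha> \<beta>" and f: "f \<in> digraph_maps G H"
  shows "one_step_C_homotopic H (path_image f \<alpha>) (path_image f \<beta>)"
  using assms(1)
proof (rule one_step_C_homotopicE)
  fix h R
  assume maps: "\<alpha> \<in> path_maps G" "\<beta> \<in> path_maps G"
    and ends: "path_fun \<alpha> 0 = path_fun \<beta> 0" "path_fun \<alpha> (path_len \<alpha>) = path_fun \<beta> (path_len \<beta>)"
    and h: "shrinking_map (path_len \<alpha>) (path_line \<alpha>) (path_len \<beta>) (path_line \<beta>) h"
    and R: "R \<in> rung_relations G" "\<And>i. i \<le> path_len \<alpha> \<Longrightarrow> R (path_fun \<alpha> i) (path_fun \<beta> (h i))"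
  have hle: "h i \<le> path_len \<beta>" if "i \<le> path_len \<alpha>" for i
    using shrinking_mapD(4)[OF h path_mapsD(1)[OF maps(1)] path_mapsD(1)[OF maps(2)] that] .
  obtain R' where R': "R' \<in> rung_relations H" "\<And>u v. R u v \<Longrightarrow> R' (f u) (f v)"
    using R(1) digraph_mapsD(2)[OF f] unfolding rung_relations_def by blast
  show ?thesis
    by (rule one_step_C_homotopicI[where h = h and R = R'])
      (use ends h R R' in \<open>simp_all add: path_image_in_path_maps[OF _ f] maps hle\<close>)
qed

lemma one_step_C_homotopic_concat_right:
  assumes "one_step_C_homotopic G \<alpha> \<alpha>'" and \<beta>: "\<beta> \<in> path_maps G"
    and joint: "path_fun \<alpha> (path_len \<alpha>) = path_fun \<beta> 0"
  shows "one_step_C_homotopic G (path_concat \<alpha> \<beta>) (path_concat \<alpha>' \<beta>)"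
  using assms(1)
proof (rule one_step_C_homotopicE)
  fix h R
  assume maps: "\<alpha> \<in> path_maps G" "\<alpha>' \<in> path_maps G"
    and ends: "path_fun \<alpha> 0 = path_fun \<alpha>' 0" "path_fun \<alpha> (path_len \<alpha>) = path_fun \<alpha>' (path_len \<alpha>')"
    and h: "shrinking_map (path_len \<alpha>) (path_line \<alpha>) (path_len \<alpha>') (path_line \<alpha>') h"
    and R: "R \<in> rung_relations G" "\<And>i. i \<le> path_len \<alpha> \<Longrightarrow> R (path_fun \<alpha> i) (path_fun \<alpha>' (h i))"
  let ?n = "path_len \<alpha>" and ?n' = "path_len \<alpha>'" and ?k = "path_len \<beta>"
  note lines = path_mapsD(1)[OF maps(1)] path_mapsD(1)[OF maps(2)] path_mapsD(1)[OF \<beta>]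
  note hD = shrinking_mapD[OF h lines(1,2)]
  have joint': "path_fun \<alpha>' ?n' = path_fun \<beta> 0"
    using joint ends by simp
  define h' where "h' = (\<lambda>i\<in>{0..?n + ?k}. if i \<le> ?n then h i else ?n' + (i - ?n))"
  have h'_left: "h' i = h i" if "i \<le> ?n" for i
    using that by (simp add: h'_def)
  have h'_right: "h' (?n + p) = ?n' + p" if "p \<le> ?k" for p
    using that hD(3) by (auto simp: h'_def)
  have split: "\<exists>p\<le>?k. i = ?n + p" if "i \<le> ?n + ?k" "\<not> i \<le> ?n" for i
    using that by (intro exI[of _ "i - ?n"]) auto
  show ?thesis
  proof (rule one_step_C_homotopicI[where h = h' and R = R])
    show "path_fun (path_concat \<alpha> \<beta>) 0 = path_fun (path_concat \<alpha>' \<beta>) 0"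
      using ends by simp
    show "path_fun (path_concat \<alpha> \<beta>) (path_len (path_concat \<alpha> \<beta>))
        = path_fun (path_concat \<alpha>' \<beta>) (path_len (path_concat \<alpha>' \<beta>))"
      using path_concat_fun_right[OF joint, of ?k] path_concat_fun_right[OF joint', of ?k] by simp
    \<comment> \<open>The shrinking map of the concatenation continues \<open>h\<close> by a translation over \<open>\<beta>\<close>, where the rungs
      are constant.\<close>
    show "shrinking_map (path_len (path_concat \<alpha> \<beta>)) (path_line (path_concat \<alpha> \<beta>))
        (path_len (path_concat \<alpha>' \<beta>)) (path_line (path_concat \<alpha>' \<beta>)) h'"
      unfolding path_concat_simps
    proof (rule shrinking_mapI[OF line_digraph_path_concat[OF lines(1,3)] line_digraph_path_concat[OF lines(2,3)]])
      show "h' i \<le> ?n' + ?k" if "i \<le> ?n + ?k" for i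
        using that hD(4)[of i] split[of i] by (cases "i \<le> ?n") (auto simp: h'_left h'_right)
      show "h' i \<le> h' j" if "i \<le> j" "j \<le> ?n + ?k" for i j
        using that hD(4)[of i] hD(6)[of i j] by (auto simp: h'_def)
      fix i j assume "(i, j) \<in> parcs (path_line (path_concat \<alpha> \<beta>))"
      then consider "(i, j) \<in> parcs (path_line \<alpha>)"
        | p q where "i = ?n + p" "j = ?n + q" "(p, q) \<in> parcs (path_line \<beta>)"
        unfolding path_concat_arc_iff by (metis le_add_diff_inverse)
      then show "weak_arc (path_line (path_concat \<alpha>' \<beta>)) (h' i) (h' j)"
      proof cases
        case 1
        then show ?thesis
          using hD(5)[OF 1] line_digraph_arcD[OF lines(1) 1] by (auto simp: h'_left path_concat_arc_iff)
      next
        case 2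
        then show ?thesis
          using line_digraph_arcD[OF lines(3) 2(3)] by (simp add: h'_right path_concat_arc_iff)
      qed
    qed (use hD in \<open>auto simp: h'_def\<close>)
    have left: "path_fun (path_concat \<alpha>' \<beta>) (h' i) = path_fun \<alpha>' (h i)" if "i \<le> ?n" for i
      using that hD(4)[OF that] by (simp add: h'_left)
    have right: "path_fun (path_concat \<alpha>' \<beta>) (h' i) = path_fun (path_concat \<alpha> \<beta>) i"
      if "i \<le> ?n + ?k" "\<not> i \<le> ?n" for i
      using split[OF that] by (auto simp: h'_right path_concat_fun_right[OF joint] path_concat_fun_right[OF joint'])
    show "R (path_fun (path_concat \<alpha> \<beta>) i) (path_fun (path_concat \<alpha>' \<beta>) (h' i))"
      if "i \<le> path_len (path_concat \<alpha> \<beta>)" for i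
      using that left right R(2) rung_relations_refl[OF R(1)] by (cases "i \<le> ?n") simp_all
  qed (intro path_concat_in_path_maps maps \<beta> joint joint' R(1))+
qed

lemma one_step_C_homotopic_reverse:
  assumes "one_step_C_homotopic G \<alpha> \<beta>"
  shows "one_step_C_homotopic G (path_reverse \<alpha>) (path_reverse \<beta>)"
  using assms
proof (rule one_step_C_homotopicE)
  fix h R
  assume maps: "\<alpha> \<in> path_maps G" "\<beta> \<in> path_maps G"
    and ends: "path_fun \<alpha> 0 = path_fun \<beta> 0" "path_fun \<alpha> (path_len \<alpha>) = path_fun \<beta> (path_len \<beta>)"
    and h: "shrinking_map (path_len \<alpha>) (path_line \<alpha>) (path_len \<beta>) (path_line \<beta>) h"
    and R: "R \<in> rung_relations G" "\<And>i. i \<le> path_len \<alpha> \<Longrightarrow> R (path_fun \<alpha> i) (path_fun \<beta> (h i))"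
  let ?n = "path_len \<alpha>" and ?m = "path_len \<beta>"
  note lines = path_mapsD(1)[OF maps(1)] path_mapsD(1)[OF maps(2)]
  note hD = shrinking_mapD[OF h lines]
  \<comment> \<open>The shrinking map \<open>h\<close>, conjugated by the reversals of both lines.\<close>
  define h' where "h' = (\<lambda>i\<in>{0..?n}. ?m - h (?n - i))"
  have h': "h' i = ?m - h (?n - i)" if "i \<le> ?n" for i
    using that by (simp add: h'_def)
  have fun_h': "path_fun (path_reverse \<beta>) (h' i) = path_fun \<beta> (h (?n - i))" if "i \<le> ?n" for i
    using that hD(4)[of "?n - i"] by (simp add: h')
  show ?thesis
  proof (rule one_step_C_homotopicI[where h = h' and R = R])
    show "shrinking_map (path_len (path_reverse \<alpha>)) (path_line (path_reverse \<alpha>))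
        (path_len (path_reverse \<beta>)) (path_line (path_reverse \<beta>)) h'"
      unfolding path_reverse_simps
    proof (rule shrinking_mapI[OF line_digraph_path_reverse[OF lines(1)] line_digraph_path_reverse[OF lines(2)]])
      show "h' i \<le> h' j" if "i \<le> j" "j \<le> ?n" for i j
        using that hD(6)[of "?n - j" "?n - i"] by (simp add: h' diff_le_mono2)
      fix i j assume ij: "(i, j) \<in> parcs (path_line (path_reverse \<alpha>))"
      note ij' = path_reverse_arcD[OF lines(1) ij]
      show "weak_arc (path_line (path_reverse \<beta>)) (h' i) (h' j)"
        using hD(5)[OF ij'(3)] ij'(1,2) hD(4)[of "?n - i"] hD(4)[of "?n - j"]
        by (auto simp: h' path_reverse_arc_iff[OF lines(2)])
    qed (use hD in \<open>auto simp: h'_def\<close>)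
    show "R (path_fun (path_reverse \<alpha>) i) (path_fun (path_reverse \<beta>) (h' i))"
      if "i \<le> path_len (path_reverse \<alpha>)" for i
      using that R(2)[of "?n - i"] by (simp add: fun_h')
  qed (use ends R(1) in \<open>simp_all add: path_reverse_in_path_maps maps\<close>)
qed


section \<open>The Hopf algebra of homotopy invariant loop integrals\<close>

lemma loops_at_one_step:
  assumes "one_step_C_homotopic (fst A) \<alpha> \<beta>"
  shows "\<alpha> \<in> loops_at A \<longleftrightarrow> \<beta> \<in> loops_at A"
  using assms unfolding one_step_C_homotopic_def loops_at_def by simp

text \<open>
  Every path map in a chain of one-step homotopies starting at a loop is again a loop, so invariance can
  be tested on single steps.
\<close>

lemma pi1_carrier_iff:
  "u \<in> carrier (pi1_algebra A) \<longleftrightarrow> u \<in> carrier (loop_algebra A) \<and>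
     (\<forall>\<alpha>\<in>loops_at A. \<forall>\<beta>\<in>loops_at A. one_step_C_homotopic (fst A) \<alpha> \<beta> \<longrightarrow> u \<alpha> = u \<beta>)"
proof -
  have iff: "(\<forall>\<alpha>\<in>loops_at A. \<forall>\<beta>\<in>loops_at A. C_homotopic (fst A) \<alpha> \<beta> \<longrightarrow> u \<alpha> = u \<beta>) \<longleftrightarrow>
     (\<forall>\<alpha>\<in>loops_at A. \<forall>\<beta>\<in>loops_at A. one_step_C_homotopic (fst A) \<alpha> \<beta> \<longrightarrow> u \<alpha> = u \<beta>)"
    (is "?C \<longleftrightarrow> ?O")
  proof
    assume ?C
    then show ?O
      unfolding C_homotopic_def by (intro ballI impI) (blast intro: r_into_equivclp)
  next
    assume inv: ?O
    have "\<beta> \<in> loops_at A \<and> u \<alpha> = u \<beta>"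
      if "equivclp (one_step_C_homotopic (fst A)) \<alpha> \<beta>" "\<alpha> \<in> loops_at A" for \<alpha> \<beta>
      using that(1)
    proof (induction rule: equivclp_induct)
      case (step \<beta> \<gamma>)
      then have \<beta>: "\<beta> \<in> loops_at A" "u \<alpha> = u \<beta>"
        by simp_all
      from step.hyps(2) have \<gamma>: "\<gamma> \<in> loops_at A"
        using \<beta>(1) loops_at_one_step[of A \<beta> \<gamma>] loops_at_one_step[of A \<gamma> \<beta>] by (elim disjE) simp_all
      from step.hyps(2) have "u \<beta> = u \<gamma>"
        using bspec[OF bspec[OF inv \<beta>(1)] \<gamma>] bspec[OF bspec[OF inv \<gamma>] \<beta>(1)] by (elim disjE) simp_all
      with \<beta> \<gamma> show ?case by simp
    qed (use that(2) in simp)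
    then show ?C
      unfolding C_homotopic_def by (intro ballI impI) (rule conjunct2)
  qed
  show ?thesis
    unfolding iff[symmetric] by (simp add: pi1_algebra_def)
qed

lemma pi1_carrier_subset: "carrier (pi1_algebra A) \<subseteq> carrier (loop_algebra A)"
  by (auto simp: pi1_carrier_iff)

lemma pi1_algebra_simps [simp]:
  "u \<otimes>\<^bsub>pi1_algebra A\<^esub> v = u \<otimes>\<^bsub>loop_algebra A\<^esub> v" "\<one>\<^bsub>pi1_algebra A\<^esub> = \<one>\<^bsub>loop_algebra A\<^esub>"
  "\<zero>\<^bsub>pi1_algebra A\<^esub> = \<zero>\<^bsub>loop_algebra A\<^esub>" "u \<oplus>\<^bsub>pi1_algebra A\<^esub> v = u \<oplus>\<^bsub>loop_algebra A\<^esub> v"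
  "c \<odot>\<^bsub>pi1_algebra A\<^esub> u = c \<odot>\<^bsub>loop_algebra A\<^esub> u"
  by (simp_all add: pi1_algebra_def)

lemma function_subalgebra_pi1_algebra:
  "function_subalgebra (loops_at A) (pi1_algebra A :: ('k::field_char_0, 'v path_map \<Rightarrow> 'k) module)"
proof -
  interpret L: function_subalgebra "loops_at A" "loop_algebra A :: ('k, 'v path_map \<Rightarrow> 'k) module"
    by (rule function_subalgebra_loop_algebra)
  show ?thesis
  proof
    show "carrier (pi1_algebra A :: ('k, 'v path_map \<Rightarrow> 'k) module) \<subseteq> extensional (loops_at A)"
      using L.extensional pi1_carrier_subset by blast
    show "\<one>\<^bsub>pi1_algebra A\<^esub> \<in> carrier (pi1_algebra A :: ('k, 'v path_map \<Rightarrow> 'k) module)"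
      using L.one_in by (simp add: pi1_carrier_iff)
  next
    fix u v :: "'v path_map \<Rightarrow> 'k" and c
    assume u: "u \<in> carrier (pi1_algebra A)"
    then show "c \<odot>\<^bsub>pi1_algebra A\<^esub> u \<in> carrier (pi1_algebra A)"
      by (simp add: pi1_carrier_iff L.smult_in)
    assume "v \<in> carrier (pi1_algebra A)"
    with u show "u \<oplus>\<^bsub>pi1_algebra A\<^esub> v \<in> carrier (pi1_algebra A)"
      "u \<otimes>\<^bsub>pi1_algebra A\<^esub> v \<in> carrier (pi1_algebra A)"
      by (simp_all add: pi1_carrier_iff L.add_in L.mult_in; metis)+
  qed (simp_all add: L.operations)
qed

text \<open>
  The elimination lemma \<open>tensor_sum_slices\<close>, read as a statement about functions of two variables.
\<close>

lemma slices_in_subspace: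
  assumes H: "function_subalgebra X H" and K: "function_subalgebra Y K"
    and U: "\<zero>\<^bsub>H\<^esub> \<in> U" "\<And>u v. u \<in> U \<Longrightarrow> v \<in> U \<Longrightarrow> u \<oplus>\<^bsub>H\<^esub> v \<in> U" "\<And>c u. u \<in> U \<Longrightarrow> c \<odot>\<^bsub>H\<^esub> u \<in> U" "U \<subseteq> carrier H"
    and zs: "set zs \<subseteq> carrier H \<times> carrier K"
    and slices: "\<And>y. y \<in> Y \<Longrightarrow> \<exists>u\<in>U. \<forall>x\<in>X. u x = (\<Sum>(a, b)\<leftarrow>zs. a x * b y)"
  shows "\<exists>zs'. set zs' \<subseteq> U \<times> carrier K \<and>
    (\<forall>x\<in>X. \<forall>y\<in>Y. (\<Sum>(a, b)\<leftarrow>zs'. a x * b y) = (\<Sum>(a, b)\<leftarrow>zs. a x * b y))"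
proof -
  interpret H: function_subalgebra X H by fact
  interpret K: function_subalgebra Y K by fact
  interpret separated_factors H X "\<lambda>u. u" K Y "\<lambda>u. u"
    by (intro separated_factorsI H.separated_functions K.separated_functions)
  have "\<exists>zs'. set zs' \<subseteq> U \<times> carrier K \<and> tensor_sum zs' = tensor_sum zs"
  proof (rule tensor_sum_slices[OF U zs])
    fix y assume y: "y \<in> Y"
    with slices obtain u where "u \<in> U" "\<forall>x\<in>X. u x = (\<Sum>(a, b)\<leftarrow>zs. a x * b y)"
      by blast
    with y show "\<exists>u\<in>U. \<forall>x\<in>X. tensor_eval (\<lambda>u. u) (\<lambda>u. u) (tensor_sum zs) (x, y) = u x"
      by (intro bexI[of _ u]) (simp_all add: tensor_eval_sum zs)
  qed
  then obtain zs' where zs': "set zs' \<subseteq> U \<times> carrier K" "tensor_sum zs' = tensor_sum zs"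
    by blast
  moreover have "set zs' \<subseteq> carrier H \<times> carrier K"
    using zs'(1) U(4) by blast
  ultimately show ?thesis
    using tensor_eval_sum[OF _ _ zs] tensor_eval_sum[of _ _ zs'] by metis
qed

context
  fixes A :: "'v based_digraph" and u :: "'v path_map \<Rightarrow> 'k::field_char_0"
  assumes u: "u \<in> carrier (pi1_algebra A)"
begin

interpretation L: function_subalgebra "loops_at A" "loop_algebra A :: ('k, 'v path_map \<Rightarrow> 'k) module"
  by (rule function_subalgebra_loop_algebra)

interpretation PI: function_subalgebra "loops_at A" "pi1_algebra A :: ('k, 'v path_map \<Rightarrow> 'k) module"
  by (rule function_subalgebra_pi1_algebra)

lemma pi1_in_loop_algebra: "u \<in> carrier (loop_algebra A)"
  using u pi1_carrier_subset by blast

lemma pi1_one_step_invariant: "\<alpha> \<in> loops_at A \<Longrightarrow> one_step_C_homotopic (fst A) \<alpha> \<beta> \<Longrightarrow> u \<alpha> = u \<beta>"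
  using u loops_at_one_step[of A \<alpha> \<beta>] by (simp add: pi1_carrier_iff)

lemma pi1_reverse: "(\<lambda>\<alpha>\<in>loops_at A. u (path_reverse \<alpha>)) \<in> carrier (pi1_algebra A)"
  using loop_algebra_reverse[OF pi1_in_loop_algebra] path_reverse_in_loops[of _ A]
  by (auto simp: pi1_carrier_iff intro!: pi1_one_step_invariant one_step_C_homotopic_reverse)

lemma pi1_steps_cong:
  "\<alpha> \<in> loops_at A \<Longrightarrow> \<beta> \<in> loops_at A \<Longrightarrow> path_steps \<alpha> = (path_steps \<beta> :: (_ \<Rightarrow> 'k) list) \<Longrightarrow> u \<alpha> = u \<beta>"
  using integral_algebra_steps_cong[of u "fst A" "loops_at A" \<alpha> \<beta>] pi1_in_loop_algebra
  by (simp add: loop_algebra_def)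

lemma pi1_concat_invariant_left:
  assumes "one_step_C_homotopic (fst A) \<alpha> \<alpha>'" "\<alpha> \<in> loops_at A" "\<beta> \<in> loops_at A"
  shows "u (path_concat \<alpha> \<beta>) = u (path_concat \<alpha>' \<beta>)"
  using assms
  by (intro pi1_one_step_invariant path_concat_in_loops one_step_C_homotopic_concat_right) (simp_all add: loops_at_def)

end

text \<open>
  Reversal exchanges the two factors of a concatenation and preserves homotopy invariance, which reduces
  the second factor to the first.
\<close>

lemma pi1_concat_invariant_right:
  fixes u :: "'v path_map \<Rightarrow> 'k::field_char_0"
  assumes u: "u \<in> carrier (pi1_algebra A)"
    and \<beta>: "one_step_C_homotopic (fst A) \<beta> \<beta>'" "\<beta> \<in> loops_at A" and \<alpha>: "\<alpha> \<in> loops_at A"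
  shows "u (path_concat \<alpha> \<beta>) = u (path_concat \<alpha> \<beta>')"
proof -
  define v where "v = (\<lambda>\<alpha>\<in>loops_at A. u (path_reverse \<alpha>))"
  have v: "v \<in> carrier (pi1_algebra A)"
    unfolding v_def using u by (rule pi1_reverse)
  have swap: "u (path_concat \<alpha> \<beta>) = v (path_concat (path_reverse \<beta>) (path_reverse \<alpha>))"
    if "\<beta> \<in> loops_at A" for \<beta>
  proof -
    have "u (path_concat \<alpha> \<beta>) = u (path_reverse (path_concat (path_reverse \<beta>) (path_reverse \<alpha>)))"
      using \<alpha> that
      by (intro pi1_steps_cong[OF u])
        (simp_all add: path_concat_in_loops path_reverse_in_loops path_steps_concat_loops[where A = A]
          path_steps_reverse_loops[where A = A] inverse_steps_append)
    then show ?thesis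
      using \<alpha> that by (simp add: v_def path_concat_in_loops path_reverse_in_loops)
  qed
  have \<beta>': "\<beta>' \<in> loops_at A"
    using \<beta> loops_at_one_step by blast
  show ?thesis
    unfolding swap[OF \<beta>(2)] swap[OF \<beta>']
    by (intro pi1_concat_invariant_left[OF v] one_step_C_homotopic_reverse \<beta> path_reverse_in_loops \<alpha>)
qed

text \<open>
  The comultiplication of a homotopy invariant \<open>u\<close> represents \<open>(\<alpha>, \<beta>) \<mapsto> u(\<alpha> \<beta>)\<close>, which is invariant in each
  variable separately. Eliminating first on the left and then on the right moves it from the tensor square
  of all loop integrals into that of the invariant ones.
\<close>

lemma pi1_representative:
  fixes u :: "'v path_map \<Rightarrow> 'k::field_char_0"
  assumes u: "u \<in> carrier (pi1_algebra A)"
  shows "\<exists>t. t \<in> carrier (tensor_algebra (pi1_algebra A) (pi1_algebra A)) \<and>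
    (\<forall>\<alpha>\<in>loops_at A. \<forall>\<beta>\<in>loops_at A. tensor_eval (\<lambda>u. u) (\<lambda>u. u) t (\<alpha>, \<beta>) = u (path_concat \<alpha> \<beta>))"
proof -
  let ?X = "loops_at A" and ?L = "loop_algebra A :: ('k, 'v path_map \<Rightarrow> 'k) module"
    and ?P = "pi1_algebra A :: ('k, 'v path_map \<Rightarrow> 'k) module"
  interpret L: function_subalgebra ?X ?L
    by (rule function_subalgebra_loop_algebra)
  interpret P: function_subalgebra ?X ?P
    by (rule function_subalgebra_pi1_algebra)
  note U = P.zero_in[unfolded pi1_algebra_simps] P.add_in[unfolded pi1_algebra_simps]
    P.smult_in[unfolded pi1_algebra_simps] pi1_carrier_subset
  have uL: "u \<in> carrier ?L"
    using u by (rule pi1_in_loop_algebra)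
  obtain t where t: "t \<in> carrier (tensor_algebra ?L ?L)"
    "\<And>\<alpha> \<beta>. \<alpha> \<in> ?X \<Longrightarrow> \<beta> \<in> ?X \<Longrightarrow> L.ev t (\<alpha>, \<beta>) = u (path_concat \<alpha> \<beta>)"
    using loop_algebra_representative[OF uL] by blast
  obtain zs where zs: "set zs \<subseteq> carrier ?L \<times> carrier ?L" "t = L.fun_pair.tensor_sum zs"
    using L.fun_pair.tensor_sum_cases[OF t(1)] .
  have eval_zs: "(\<Sum>(a, b)\<leftarrow>zs. a \<alpha> * b \<beta>) = u (path_concat \<alpha> \<beta>)" if "\<alpha> \<in> ?X" "\<beta> \<in> ?X" for \<alpha> \<beta>
    using t(2)[OF that] L.fun_pair.tensor_eval_sum[OF that zs(1)] by (simp add: zs(2))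
  have combination: "(\<lambda>x\<in>?X. \<Sum>(a, b)\<leftarrow>zs. a x * c b) \<in> carrier ?L"
    if "set zs \<subseteq> carrier ?L \<times> S" for zs :: "(_ \<times> 'z) list" and c S
    using that
  proof (induction zs)
    case Nil
    then show ?case
      using L.zero_in by (simp add: L.operations restrict_def)
  next
    case (Cons z zs)
    obtain a b where z: "z = (a, b)" by (cases z)
    have "(\<lambda>x\<in>?X. \<Sum>(a, b)\<leftarrow>z # zs. a x * c b) = c b \<odot>\<^bsub>?L\<^esub> a \<oplus>\<^bsub>?L\<^esub> (\<lambda>x\<in>?X. \<Sum>(a, b)\<leftarrow>zs. a x * c b)"
      by (rule ext) (simp add: L.operations z mult.commute)
    with Cons z show ?case
      by (simp only:) (intro L.add_in L.smult_in; auto simp: restrict_def)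
  qed
  have "\<exists>zs'. set zs' \<subseteq> carrier ?P \<times> carrier ?L \<and>
      (\<forall>\<alpha>\<in>?X. \<forall>\<beta>\<in>?X. (\<Sum>(a, b)\<leftarrow>zs'. a \<alpha> * b \<beta>) = (\<Sum>(a, b)\<leftarrow>zs. a \<alpha> * b \<beta>))"
  proof (rule slices_in_subspace[OF L.function_subalgebra_axioms L.function_subalgebra_axioms U zs(1)])
    fix \<beta> assume \<beta>: "\<beta> \<in> ?X"
    let ?w = "\<lambda>\<alpha>\<in>?X. \<Sum>(a, b)\<leftarrow>zs. a \<alpha> * b \<beta>"
    have "?w \<in> carrier ?P"
      using combination[OF zs(1), of "\<lambda>b. b \<beta>"] \<beta>
      by (auto simp: pi1_carrier_iff eval_zs intro: pi1_concat_invariant_left[OF u])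
    then show "\<exists>w\<in>carrier ?P. \<forall>\<alpha>\<in>?X. w \<alpha> = (\<Sum>(a, b)\<leftarrow>zs. a \<alpha> * b \<beta>)"
      by (rule bexI[rotated]) simp
  qed
  then obtain zs1 where zs1: "set zs1 \<subseteq> carrier ?P \<times> carrier ?L"
    "\<And>\<alpha> \<beta>. \<alpha> \<in> ?X \<Longrightarrow> \<beta> \<in> ?X \<Longrightarrow> (\<Sum>(a, b)\<leftarrow>zs1. a \<alpha> * b \<beta>) = u (path_concat \<alpha> \<beta>)"
    using eval_zs by auto
  \<comment> \<open>The factors change places, so that the same lemma applies to the second variable.\<close>
  define ys where "ys = map prod.swap zs1"
  have swap: "(\<Sum>(a, b)\<leftarrow>map prod.swap zs. a \<beta> * b \<alpha>) = (\<Sum>(a, b)\<leftarrow>zs. a \<alpha> * b \<beta>)"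
    for zs :: "(('v path_map \<Rightarrow> 'k) \<times> ('v path_map \<Rightarrow> 'k)) list" and \<alpha> \<beta>
    by (induction zs) (auto simp: mult.commute)
  have ys: "set ys \<subseteq> carrier ?L \<times> carrier ?P"
    using zs1(1) by (auto simp: ys_def)
  have eval_ys: "(\<Sum>(a, b)\<leftarrow>ys. a \<beta> * b \<alpha>) = u (path_concat \<alpha> \<beta>)" if "\<alpha> \<in> ?X" "\<beta> \<in> ?X" for \<alpha> \<beta>
    using zs1(2)[OF that] by (simp add: ys_def swap del: map_map list.map_comp)
  have "\<exists>ys'. set ys' \<subseteq> carrier ?P \<times> carrier ?P \<and>
      (\<forall>\<beta>\<in>?X. \<forall>\<alpha>\<in>?X. (\<Sum>(a, b)\<leftarrow>ys'. a \<beta> * b \<alpha>) = (\<Sum>(a, b)\<leftarrow>ys. a \<beta> * b \<alpha>))"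
  proof (rule slices_in_subspace[OF L.function_subalgebra_axioms P.function_subalgebra_axioms U ys])
    fix \<alpha> assume \<alpha>: "\<alpha> \<in> ?X"
    let ?w = "\<lambda>\<beta>\<in>?X. \<Sum>(a, b)\<leftarrow>ys. a \<beta> * b \<alpha>"
    have "?w \<in> carrier ?P"
      using combination[OF ys, of "\<lambda>b. b \<alpha>"] \<alpha>
      by (auto simp: pi1_carrier_iff eval_ys intro: pi1_concat_invariant_right[OF u])
    then show "\<exists>w\<in>carrier ?P. \<forall>\<beta>\<in>?X. w \<beta> = (\<Sum>(a, b)\<leftarrow>ys. a \<beta> * b \<alpha>)"
      by (rule bexI[rotated]) simp
  qed
  then obtain ys' where ys': "set ys' \<subseteq> carrier ?P \<times> carrier ?P"
    "\<And>\<alpha> \<beta>. \<alpha> \<in> ?X \<Longrightarrow> \<beta> \<in> ?X \<Longrightarrow> (\<Sum>(a, b)\<leftarrow>ys'. a \<beta> * b \<alpha>) = u (path_concat \<alpha> \<beta>)"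
    using eval_ys by auto
  define zs2 where "zs2 = map prod.swap ys'"
  have zs2: "set zs2 \<subseteq> carrier ?P \<times> carrier ?P"
    using ys'(1) by (auto simp: zs2_def)
  have "P.ev (P.fun_pair.tensor_sum zs2) (\<alpha>, \<beta>) = u (path_concat \<alpha> \<beta>)" if "\<alpha> \<in> ?X" "\<beta> \<in> ?X" for \<alpha> \<beta>
    using P.fun_pair.tensor_eval_sum[OF that zs2] ys'(2)[OF that]
    by (simp add: zs2_def swap del: map_map list.map_comp)
  with P.fun_pair.tensor_sum_closed[OF zs2] show ?thesis
    by blast
qed

lemma function_hopf_pi1_algebra:
  assumes "based_digraph A"
  shows "function_hopf (loops_at A) (loop_hopf_on A (pi1_algebra A)) path_concat (trivial_loop (snd A)) path_reverse"
  by (intro function_hopf_loops assms function_subalgebra_pi1_algebra pi1_carrier_subset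
      pi1_representative pi1_reverse)

lemma hopf_subalgebra_pi1:
  assumes A: "based_digraph A"
  shows "hopf_subalgebra (loop_hopf_on A (pi1_algebra A)) (loop_hopf_on A (loop_algebra A))"
proof -
  have "(\<lambda>a. a) \<in> hopf_homs (loop_hopf_on A (pi1_algebra A)) (loop_hopf_on A (loop_algebra A))"
    by (rule hopf_homs_by_eval[OF function_hopf_loop_algebra[OF A] function_hopf_pi1_algebra[OF A],
          where F = "\<lambda>\<alpha>. \<alpha>"]) (auto dest: subsetD[OF pi1_carrier_subset])
  then show ?thesis
    by (simp add: hopf_subalgebra_def pi1_carrier_subset)
qed


section \<open>Homotopy of based digraph maps\<close>

lemma based_mapsD:
  assumes "f \<in> based_maps A B"
  shows "f \<in> digraph_maps (fst A) (fst B)" "f (snd A) = snd B"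
  using assms by (simp_all add: based_maps_def)

lemma based_maps_comp:
  assumes A: "based_digraph A" and f: "f \<in> based_maps A B" and g: "g \<in> based_maps B C"
  shows "compose (pverts (fst A)) g f \<in> based_maps A C"
proof -
  interpret pair_digraph "fst A"
    using A by (simp add: based_digraph_def)
  note fD = digraph_mapsD[OF based_mapsD(1)[OF f]] and gD = digraph_mapsD[OF based_mapsD(1)[OF g]]
  have "compose (pverts (fst A)) g f \<in> digraph_maps (fst A) (fst C)"
  proof (rule digraph_mapsI)
    fix u v assume uv: "(u, v) \<in> parcs (fst A)"
    then have "u \<in> pverts (fst A)" "v \<in> pverts (fst A)"
      using in_arcsD1 in_arcsD2 by auto
    with fD(2)[OF uv] gD(2) show "weak_arc (fst C) (compose (pverts (fst A)) g f u) (compose (pverts (fst A)) g f v)"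
      by (auto simp: compose_def)
  qed (use fD(1) gD(1) in \<open>auto simp: compose_def\<close>)
  then show ?thesis
    using A based_mapsD(2)[OF f] based_mapsD(2)[OF g]
    by (simp add: based_maps_def compose_def based_digraph_def)
qed

lemma based_maps_id:
  assumes "based_digraph A"
  shows "restrict id (pverts (fst A)) \<in> based_maps A A"
proof -
  interpret pair_digraph "fst A"
    using assms by (simp add: based_digraph_def)
  have "restrict id (pverts (fst A)) \<in> digraph_maps (fst A) (fst A)"
    by (rule digraph_mapsI) (use in_arcsD1 in_arcsD2 in auto)
  then show ?thesis
    using assms by (simp add: based_maps_def based_digraph_def)
qed

lemma based_maps_funcset: "f \<in> based_maps A B \<Longrightarrow> f \<in> pverts (fst A) \<rightarrow>\<^sub>E pverts (fst B)"
  by (auto simp: based_maps_def digraph_maps_def)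

lemma category_dig_cat: "category dig_cat"
  unfolding dig_cat_def
  by (rule category_of_maps[where S = "\<lambda>A. pverts (fst A)"]) (auto intro: based_maps_id based_maps_comp dest: based_maps_funcset simp del: PiE_iff)

text \<open>
  A homotopy along a line with a single edge. This relation generates homotopy, and compatibility with
  composition is immediate for it.
\<close>

definition adjacent_maps :: "'v based_digraph \<Rightarrow> 'w based_digraph \<Rightarrow> ('v \<Rightarrow> 'w) \<Rightarrow> ('v \<Rightarrow> 'w) \<Rightarrow> bool" where
  "adjacent_maps A B f g \<longleftrightarrow> f \<in> based_maps A B \<and> g \<in> based_maps A B \<and>
     (\<forall>v\<in>pverts (fst A). weak_arc (fst B) (f v) (g v))"

lemma homotopic_maps_refl:
  assumes f: "f \<in> based_maps A B" and A: "based_digraph A"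
  shows "homotopic_maps A B f f"
proof -
  let ?I = "\<lparr>pverts = {0}, parcs = {}\<rparr> :: nat pair_pre_digraph"
  interpret pair_digraph "fst A"
    using A by (simp add: based_digraph_def)
  have "line_digraph 0 ?I"
    by (simp add: line_digraph_def)
  moreover define F where "F = (\<lambda>(v, t)\<in>pverts (fst A) \<times> {0::nat}. f v)"
  have "F \<in> digraph_maps (box_product (fst A) ?I) (fst B)"
  proof (rule digraph_mapsI)
    fix u v assume "(u, v) \<in> parcs (box_product (fst A) ?I)"
    then obtain a b where "u = (a, 0)" "v = (b, 0)" "(a, b) \<in> parcs (fst A)"
      by (auto simp: box_product_def)
    moreover from this(3) have "a \<in> pverts (fst A)" "b \<in> pverts (fst A)"
      using in_arcsD1 in_arcsD2 by auto
    ultimately show "weak_arc (fst B) (F u) (F v)"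
      using digraph_mapsD(2)[OF based_mapsD(1)[OF f]] by (simp add: F_def)
  qed (use digraph_mapsD(1)[OF based_mapsD(1)[OF f]] in \<open>auto simp: F_def box_product_def\<close>)
  ultimately show ?thesis
    unfolding homotopic_maps_def using f A based_mapsD(2)[OF f]
    by (intro conjI exI[of _ 0] exI[of _ ?I] bexI[of _ F]) (auto simp: F_def based_digraph_def)
qed

text \<open>
  Lines can be extended at the end by an edge in either direction, so homotopies can be continued by
  \<open>adjacent_maps\<close> read forwards or backwards.
\<close>

lemma homotopic_maps_extend:
  assumes A: "based_digraph A" and fg: "homotopic_maps A B f g"
    and adj: "adjacent_maps A B g k \<or> adjacent_maps A B k g"
  shows "homotopic_maps A B f k"
proof -
  interpret pair_digraph "fst A"
    using A by (simp add: based_digraph_def)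
  obtain n I F where f: "f \<in> based_maps A B" and I: "line_digraph n I"
    and F: "F \<in> digraph_maps (box_product (fst A) I) (fst B)"
      "\<And>v. v \<in> pverts (fst A) \<Longrightarrow> F (v, 0) = f v" "\<And>v. v \<in> pverts (fst A) \<Longrightarrow> F (v, n) = g v"
      "\<And>t. t \<in> pverts I \<Longrightarrow> F (snd A, t) = snd B"
    using fg unfolding homotopic_maps_def by blast
  have k: "k \<in> based_maps A B"
    using adj by (auto simp: adjacent_maps_def)
  \<comment> \<open>The direction of the new edge follows the direction of adjacency.\<close>
  define e where "e = (if adjacent_maps A B g k then (n, Suc n) else (Suc n, n))"
  define J where "J = \<lparr>pverts = {0..Suc n}, parcs = insert e (parcs I)\<rparr>"
  define F' where "F' = (\<lambda>(v, t)\<in>pverts (fst A) \<times> {0..Suc n}. if t = Suc n then k v else F (v, t))"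
  have e: "e = (n, Suc n) \<or> e = (Suc n, n)"
    by (simp add: e_def)
  have J: "line_digraph (Suc n) J"
  proof (rule line_digraphI)
    fix i j assume "(i, j) \<in> parcs J"
    then show "i \<le> Suc n \<and> j \<le> Suc n \<and> (j = Suc i \<or> i = Suc j)"
      using e line_digraph_arcD[OF I, of i j] by (auto simp: J_def)
  next
    fix i assume "i < Suc n"
    then show "(Suc i, i) \<in> parcs J \<longleftrightarrow> (i, Suc i) \<notin> parcs J"
      using e line_digraph_arcD(1,2)[OF I] line_digraph_Suc_iff[OF I, of i]
      by (cases "i = n") (fastforce simp: J_def)+
  qed (simp add: J_def)
  have F'_old: "F' (v, t) = F (v, t)" if "v \<in> pverts (fst A)" "t \<le> n" for v t
    using that by (simp add: F'_def)
  have F'_new: "F' (v, Suc n) = k v" if "v \<in> pverts (fst A)" for v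
    using that by (simp add: F'_def)
  have "F' \<in> digraph_maps (box_product (fst A) J) (fst B)"
  proof (rule digraph_mapsI)
    show "F' \<in> extensional (pverts (box_product (fst A) J))"
      by (simp add: F'_def box_product_def J_def)
  next
    fix z assume "z \<in> pverts (box_product (fst A) J)"
    then obtain v t where z: "z = (v, t)" "v \<in> pverts (fst A)" "t \<le> Suc n"
      by (auto simp: box_product_def J_def)
    have "F (v, t) \<in> pverts (fst B)" if "t \<le> n"
      using z that by (intro digraph_mapsD(1)[OF F(1)]) (auto simp: box_product_def line_digraph_pverts[OF I])
    then show "F' z \<in> pverts (fst B)"
      using z digraph_mapsD(1)[OF based_mapsD(1)[OF k]] by (auto simp: F'_def)
  next
    fix z w assume "(z, w) \<in> parcs (box_product (fst A) J)"
    then consider v s t where "z = (v, s)" "w = (v, t)" "v \<in> pverts (fst A)" "(s, t) \<in> parcs I"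
      | v where "z = (v, fst e)" "w = (v, snd e)" "v \<in> pverts (fst A)"
      | u v t where "z = (u, t)" "w = (v, t)" "(u, v) \<in> parcs (fst A)" "t \<le> n"
      | u v where "z = (u, Suc n)" "w = (v, Suc n)" "(u, v) \<in> parcs (fst A)"
      by (auto simp: box_product_def J_def le_Suc_eq)
    then show "weak_arc (fst B) (F' z) (F' w)"
    proof cases
      case 1
      then have "weak_arc (fst B) (F z) (F w)"
        by (intro digraph_mapsD(2)[OF F(1)]) (auto simp: box_product_def)
      with 1 show ?thesis
        using line_digraph_arcD[OF I 1(4)] by (simp add: F'_old)
    next
      case 2
      show ?thesis
      proof (cases "adjacent_maps A B g k")
        case True
        with 2 show ?thesis
          by (simp add: e_def F'_old F'_new F(3)) (simp add: adjacent_maps_def)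
      next
        case False
        with adj 2 show ?thesis
          by (simp add: e_def F'_old F'_new F(3)) (simp add: adjacent_maps_def)
      qed
    next
      case 3
      moreover from 3(3) have "u \<in> pverts (fst A)" "v \<in> pverts (fst A)"
        using in_arcsD1 in_arcsD2 by auto
      moreover have "weak_arc (fst B) (F z) (F w)"
        using 3 by (intro digraph_mapsD(2)[OF F(1)]) (auto simp: box_product_def line_digraph_pverts[OF I])
      ultimately show ?thesis
        by (simp add: F'_old)
    next
      case 4
      moreover from 4(3) have "u \<in> pverts (fst A)" "v \<in> pverts (fst A)"
        using in_arcsD1 in_arcsD2 by auto
      ultimately show ?thesis
        using digraph_mapsD(2)[OF based_mapsD(1)[OF k] 4(3)] by (simp add: F'_new)
    qed
  qed
  moreover have "F' (snd A, t) = snd B" if "t \<in> pverts J" for t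
    using that A F(4) based_mapsD(2)[OF k]
    by (auto simp: J_def F'_def based_digraph_def line_digraph_pverts[OF I])
  ultimately show ?thesis
    unfolding homotopic_maps_def using f k J
    by (intro conjI exI[of _ "Suc n"] exI[of _ J] bexI[of _ F']) (simp_all add: F'_old F'_new F(2))
qed

text \<open>
  With this description symmetry, transitivity and compatibility with composition follow from the
  corresponding facts about generated equivalence relations.
\<close>

lemma homotopic_maps_iff:
  assumes A: "based_digraph A"
  shows "homotopic_maps A B f g \<longleftrightarrow> f \<in> based_maps A B \<and> equivclp (adjacent_maps A B) f g"
proof
  assume "f \<in> based_maps A B \<and> equivclp (adjacent_maps A B) f g"
  then have f: "f \<in> based_maps A B" and "equivclp (adjacent_maps A B) f g"
    by simp_all
  from this(2) show "homotopic_maps A B f g"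
  proof (induction rule: equivclp_induct)
    case base
    show ?case using f A by (rule homotopic_maps_refl)
  next
    case (step g k)
    from A step.IH step.hyps(2) show ?case by (rule homotopic_maps_extend)
  qed
next
  assume "homotopic_maps A B f g"
  then obtain n I F where fg: "f \<in> based_maps A B" "g \<in> based_maps A B" and I: "line_digraph n I"
    and F: "F \<in> digraph_maps (box_product (fst A) I) (fst B)"
      "\<And>v. v \<in> pverts (fst A) \<Longrightarrow> F (v, 0) = f v" "\<And>v. v \<in> pverts (fst A) \<Longrightarrow> F (v, n) = g v"
      "\<And>t. t \<in> pverts I \<Longrightarrow> F (snd A, t) = snd B"
    unfolding homotopic_maps_def by blast
  interpret pair_digraph "fst A"
    using A by (simp add: based_digraph_def)
  define \<phi> where "\<phi> t = (\<lambda>v\<in>pverts (fst A). F (v, t))" for t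
  have \<phi>: "\<phi> t \<in> based_maps A B" if "t \<le> n" for t
  proof -
    have "\<phi> t \<in> digraph_maps (fst A) (fst B)"
    proof (rule digraph_mapsI)
      fix v assume "v \<in> pverts (fst A)"
      then show "\<phi> t v \<in> pverts (fst B)"
        using digraph_mapsD(1)[OF F(1), of "(v, t)"] that
        by (simp add: \<phi>_def box_product_def line_digraph_pverts[OF I])
    next
      fix u v assume uv: "(u, v) \<in> parcs (fst A)"
      then have "u \<in> pverts (fst A)" "v \<in> pverts (fst A)"
        using in_arcsD1 in_arcsD2 by auto
      moreover have "weak_arc (fst B) (F (u, t)) (F (v, t))"
        using uv that
        by (intro digraph_mapsD(2)[OF F(1)]) (auto simp: box_product_def line_digraph_pverts[OF I])
      ultimately show "weak_arc (fst B) (\<phi> t u) (\<phi> t v)"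
        by (simp add: \<phi>_def)
    qed (simp add: \<phi>_def)
    then show ?thesis
      using A F(4)[of t] that by (simp add: based_maps_def \<phi>_def based_digraph_def line_digraph_pverts[OF I])
  qed
  have "equivclp (adjacent_maps A B) (\<phi> 0) (\<phi> t)" if "t \<le> n" for t
    using that
  proof (induction t)
    case (Suc t)
    have arc: "weak_arc (fst B) (F (v, i)) (F (v, j))"
      if "v \<in> pverts (fst A)" "(i, j) \<in> parcs I" for v i j
      using that by (intro digraph_mapsD(2)[OF F(1)]) (auto simp: box_product_def)
    have "(t, Suc t) \<in> parcs I \<or> (Suc t, t) \<in> parcs I"
      using line_digraph_Suc_iff[OF I, of t] Suc.prems by auto
    then have "adjacent_maps A B (\<phi> t) (\<phi> (Suc t)) \<or> adjacent_maps A B (\<phi> (Suc t)) (\<phi> t)"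
      using \<phi>[of t] \<phi>[of "Suc t"] Suc.prems arc by (auto simp: adjacent_maps_def \<phi>_def)
    with Suc show ?case
      by (auto intro: equivclp_into_equivclp)
  qed simp
  moreover have "\<phi> 0 = f" "\<phi> n = g"
    using digraph_mapsD(3)[OF based_mapsD(1)[OF fg(1)]] digraph_mapsD(3)[OF based_mapsD(1)[OF fg(2)]] F(2,3)
    by (auto intro!: extensionalityI[of _ "pverts (fst A)"] simp: \<phi>_def)
  ultimately show "f \<in> based_maps A B \<and> equivclp (adjacent_maps A B) f g"
    using fg(1) by blast
qed

lemma equiv_homotopy_rel:
  assumes A: "based_digraph A"
  shows "equiv (based_maps A B) (homotopy_rel A B)"
proof (rule equivI)
  show "homotopy_rel A B \<subseteq> based_maps A B \<times> based_maps A B"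
    by (auto simp: homotopy_rel_def homotopic_maps_def)
  show "refl_on (based_maps A B) (homotopy_rel A B)"
    by (auto simp: refl_on_def homotopy_rel_def homotopic_maps_refl A)
  show "sym (homotopy_rel A B)"
  proof (rule symI)
    fix f g assume fg: "(f, g) \<in> homotopy_rel A B"
    then have "g \<in> based_maps A B"
      by (simp add: homotopy_rel_def homotopic_maps_def)
    with fg show "(g, f) \<in> homotopy_rel A B"
      by (simp add: homotopy_rel_def homotopic_maps_iff[OF A] equivclp_sym)
  qed
  show "trans (homotopy_rel A B)"
    by (rule transI) (auto simp: homotopy_rel_def homotopic_maps_iff[OF A] intro: equivclp_trans)
qed

lemma adjacent_maps_comp_left:
  assumes A: "based_digraph A" and fg: "adjacent_maps A B f g" and k: "k \<in> based_maps B C"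
  shows "adjacent_maps A C (compose (pverts (fst A)) k f) (compose (pverts (fst A)) k g)"
  using fg based_maps_comp[OF A _ k] digraph_mapsD(2)[OF based_mapsD(1)[OF k]]
  by (fastforce simp: adjacent_maps_def compose_def)

lemma adjacent_maps_comp_right:
  assumes A: "based_digraph A" and fg: "adjacent_maps B C f g" and k: "k \<in> based_maps A B"
  shows "adjacent_maps A C (compose (pverts (fst A)) f k) (compose (pverts (fst A)) g k)"
  using fg based_maps_comp[OF A k, of f C] based_maps_comp[OF A k, of g C] digraph_mapsD(1)[OF based_mapsD(1)[OF k]]
  by (auto simp: adjacent_maps_def compose_def)

lemma equivclp_map:
  assumes "equivclp r x y" and "\<And>x y. r x y \<Longrightarrow> s (h x) (h y)"
  shows "equivclp s (h x) (h y)"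
  using assms(1)
proof (induction rule: equivclp_induct)
  case (step y z)
  then have "s (h y) (h z) \<or> s (h z) (h y)"
    using assms(2) by blast
  with step.IH show ?case
    by (rule equivclp_into_equivclp)
qed simp

lemma homotopic_maps_comp:
  assumes A: "based_digraph A" and B: "based_digraph B"
    and ff': "homotopic_maps A B f f'" and gg': "homotopic_maps B C g g'"
  shows "homotopic_maps A C (compose (pverts (fst A)) g f) (compose (pverts (fst A)) g' f')"
proof -
  have maps: "f \<in> based_maps A B" "f' \<in> based_maps A B" "g \<in> based_maps B C" "g' \<in> based_maps B C"
    using ff' gg' by (simp_all add: homotopic_maps_def)
  have "equivclp (adjacent_maps A C) (compose (pverts (fst A)) g f) (compose (pverts (fst A)) g f')"
    by (rule equivclp_map[where r = "adjacent_maps A B"])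
       (use ff' maps in \<open>simp_all add: homotopic_maps_iff[OF A] adjacent_maps_comp_left[OF A]\<close>)
  moreover have "equivclp (adjacent_maps A C) (compose (pverts (fst A)) g f') (compose (pverts (fst A)) g' f')"
    by (rule equivclp_map[where r = "adjacent_maps B C" and h = "\<lambda>g. compose (pverts (fst A)) g f'"])
       (use gg' maps in \<open>simp_all add: homotopic_maps_iff[OF B] adjacent_maps_comp_right[OF A]\<close>)
  ultimately show ?thesis
    using based_maps_comp[OF A maps(1,3)] by (auto simp: homotopic_maps_iff[OF A] intro: equivclp_trans)
qed

lemma homotopy_class_eq_iff:
  assumes "based_digraph A" "f \<in> based_maps A B" "g \<in> based_maps A B"
  shows "homotopy_class A B f = homotopy_class A B g \<longleftrightarrow> homotopic_maps A B f g"
  unfolding homotopy_class_def using eq_equiv_class_iff[OF equiv_homotopy_rel[OF assms(1)] assms(2,3)]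
  by (simp add: homotopy_rel_def)

lemma homotopy_class_memD: "g \<in> homotopy_class A B f \<Longrightarrow> homotopic_maps A B f g"
  by (simp add: homotopy_class_def homotopy_rel_def)

lemma homotopy_class_self: "based_digraph A \<Longrightarrow> f \<in> based_maps A B \<Longrightarrow> f \<in> homotopy_class A B f"
  by (simp add: homotopy_class_def homotopy_rel_def homotopic_maps_refl)

lemma homotopy_class_in: "f \<in> based_maps A B \<Longrightarrow> homotopy_class A B f \<in> based_maps A B // homotopy_rel A B"
  unfolding homotopy_class_def by (rule quotientI)

lemma homotopy_class_cases:
  assumes "\<Phi> \<in> based_maps A B // homotopy_rel A B"
  obtains f where "f \<in> based_maps A B" "\<Phi> = homotopy_class A B f"
  using assms unfolding homotopy_class_def by (rule quotientE)

text \<open>Composition of classes is a union over all representatives; all members of this union agree.\<close>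

lemma homotopy_class_comp:
  assumes A: "based_digraph A" and B: "based_digraph B"
    and f: "f \<in> based_maps A B" and g: "g \<in> based_maps B C"
  shows "Comp hdig_cat A B C (homotopy_class B C g) (homotopy_class A B f)
    = homotopy_class A C (compose (pverts (fst A)) g f)"
proof -
  have eq: "homotopy_class A C (compose (pverts (fst A)) g' f') = homotopy_class A C (compose (pverts (fst A)) g f)"
    if "g' \<in> homotopy_class B C g" "f' \<in> homotopy_class A B f" for f' g'
  proof -
    have h: "homotopic_maps A B f f'" "homotopic_maps B C g g'"
      using that homotopy_class_memD by blast+
    then have "f' \<in> based_maps A B" "g' \<in> based_maps B C"
      by (simp_all add: homotopic_maps_def)
    then have "homotopy_class A C (compose (pverts (fst A)) g f) = homotopy_class A C (compose (pverts (fst A)) g' f')"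
      using homotopic_maps_comp[OF A B h]
      by (subst homotopy_class_eq_iff[OF A]) (auto intro: based_maps_comp[OF A] f g)
    then show ?thesis ..
  qed
  have "Comp hdig_cat A B C (homotopy_class B C g) (homotopy_class A B f)
      = (\<Union>g'\<in>homotopy_class B C g. \<Union>f'\<in>homotopy_class A B f. homotopy_class A C (compose (pverts (fst A)) g' f'))"
    by (simp add: hdig_cat_def)
  also have "\<dots> = (\<Union>g'\<in>homotopy_class B C g. \<Union>f'\<in>homotopy_class A B f. homotopy_class A C (compose (pverts (fst A)) g f))"
    by (intro SUP_cong refl eq)
  also have "\<dots> = homotopy_class A C (compose (pverts (fst A)) g f)"
    using homotopy_class_self[OF A f] homotopy_class_self[OF B g] by blast
  finally show ?thesis .
qed

lemma hdig_cat_simps: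
  "Obj hdig_cat = {A. based_digraph A}" "Hom hdig_cat A B = based_maps A B // homotopy_rel A B"
  "Id hdig_cat A = homotopy_class A A (restrict id (pverts (fst A)))"
  by (simp_all add: hdig_cat_def)

lemma category_hdig_cat: "category (hdig_cat :: ('v based_digraph, ('v \<Rightarrow> 'v) set) cat)"
  unfolding category_def hdig_cat_simps
proof (intro conjI ballI)
  fix A :: "'v based_digraph" assume "A \<in> {A. based_digraph A}"
  then show "homotopy_class A A (restrict id (pverts (fst A))) \<in> based_maps A A // homotopy_rel A A"
    by (intro homotopy_class_in based_maps_id) simp
next
  fix A B :: "'v based_digraph" and \<Phi>
  assume AB: "A \<in> {A. based_digraph A}" "B \<in> {A. based_digraph A}"
    and "\<Phi> \<in> based_maps A B // homotopy_rel A B"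
  from this(3) obtain f where f: "f \<in> based_maps A B" "\<Phi> = homotopy_class A B f"
    by (rule homotopy_class_cases)
  have "compose (pverts (fst A)) f (restrict id (pverts (fst A))) = f"
    "compose (pverts (fst A)) (restrict id (pverts (fst B))) f = f"
    using based_maps_funcset[OF f(1)]
    by (auto intro!: extensionalityI[of _ "pverts (fst A)"] simp: compose_def PiE_iff Pi_iff)
  then show "Comp hdig_cat A A B \<Phi> (homotopy_class A A (restrict id (pverts (fst A)))) = \<Phi>"
    "Comp hdig_cat A B B (homotopy_class B B (restrict id (pverts (fst B)))) \<Phi> = \<Phi>"
    using AB f by (simp_all add: homotopy_class_comp based_maps_id)
next
  fix A B C :: "'v based_digraph" and \<Phi> \<Psi>
  assume ABC: "A \<in> {A. based_digraph A}" "B \<in> {A. based_digraph A}" "C \<in> {A. based_digraph A}"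
    and "\<Phi> \<in> based_maps A B // homotopy_rel A B" "\<Psi> \<in> based_maps B C // homotopy_rel B C"
  from this(4,5) obtain f g where fg: "f \<in> based_maps A B" "\<Phi> = homotopy_class A B f"
    "g \<in> based_maps B C" "\<Psi> = homotopy_class B C g"
    by (elim homotopy_class_cases)
  then show "Comp hdig_cat A B C \<Psi> \<Phi> \<in> based_maps A C // homotopy_rel A C"
    using ABC by (simp add: homotopy_class_comp homotopy_class_in based_maps_comp)
next
  fix A B C D :: "'v based_digraph" and \<Phi> \<Psi> \<Theta>
  assume ABCD: "A \<in> {A. based_digraph A}" "B \<in> {A. based_digraph A}" "C \<in> {A. based_digraph A}"
      "D \<in> {A. based_digraph A}"
    and "\<Phi> \<in> based_maps A B // homotopy_rel A B" "\<Psi> \<in> based_maps B C // homotopy_rel B C"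
      "\<Theta> \<in> based_maps C D // homotopy_rel C D"
  from this(5-7) obtain f g h where fgh: "f \<in> based_maps A B" "\<Phi> = homotopy_class A B f"
    "g \<in> based_maps B C" "\<Psi> = homotopy_class B C g" "h \<in> based_maps C D" "\<Theta> = homotopy_class C D h"
    by (elim homotopy_class_cases)
  have "compose (pverts (fst A)) h (compose (pverts (fst A)) g f)
      = compose (pverts (fst A)) (compose (pverts (fst B)) h g) f"
    by (rule compose_assoc) (use based_maps_funcset[OF fgh(1)] in blast)
  then show "Comp hdig_cat A C D \<Theta> (Comp hdig_cat A B C \<Psi> \<Phi>)
      = Comp hdig_cat A B D (Comp hdig_cat B C D \<Theta> \<Psi>) \<Phi>"
    using ABCD fgh by (simp add: homotopy_class_comp based_maps_comp)
qed


section \<open>The functors\<close>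

definition pullback ::
  "('v path_map \<Rightarrow> 'k) set \<Rightarrow> 'w path_map set \<Rightarrow> ('w \<Rightarrow> 'v) \<Rightarrow> ('v path_map \<Rightarrow> 'k) \<Rightarrow> 'w path_map \<Rightarrow> 'k" where
  "pullback C X f = (\<lambda>u\<in>C. \<lambda>\<alpha>\<in>X. u (path_image f \<alpha>))"

lemma pullback_extensional [simp]: "pullback C X f \<in> extensional C"
  by (simp add: pullback_def)

lemma pullback_id:
  assumes "C \<subseteq> extensional X" "X \<subseteq> path_maps G"
  shows "pullback C X (restrict id (pverts G)) = restrict id C"
proof -
  have "(\<lambda>\<alpha>\<in>X. u (path_image (restrict id (pverts G)) \<alpha>)) = u" if "u \<in> C" for u
    using that assms
    by (intro extensionalityI[of _ X]) (auto simp: path_image_id[of _ G] subset_iff)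
  then show ?thesis
    by (auto simp: pullback_def fun_eq_iff)
qed

lemma pullback_comp:
  assumes X: "X \<subseteq> path_maps G" "\<And>\<alpha>. \<alpha> \<in> X \<Longrightarrow> path_image f \<alpha> \<in> Y"
    and closed: "\<And>u. u \<in> D \<Longrightarrow> pullback D Y g u \<in> C"
  shows "pullback D X (compose (pverts G) g f) = compose D (pullback C X f) (pullback D Y g)"
proof -
  have image: "path_image (compose (pverts G) g f) \<alpha> = path_image g (path_image f \<alpha>)" if "\<alpha> \<in> X" for \<alpha>
  proof -
    have "path_fun \<alpha> i \<in> pverts G" if "i \<le> path_len \<alpha>" for i
      using X(1) \<open>\<alpha> \<in> X\<close> that path_mapsD(3) by blast
    then show ?thesis
      by (auto simp: path_image_comp compose_def intro!: path_image_cong)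
  qed
  show ?thesis
  proof (rule extensionalityI[of _ D])
    fix u assume u: "u \<in> D"
    have "pullback C X f (pullback D Y g u) = (\<lambda>\<alpha>\<in>X. u (path_image g (path_image f \<alpha>)))"
      using closed[OF u] X(2) u by (auto simp: pullback_def fun_eq_iff)
    with u show "pullback D X (compose (pverts G) g f) u = compose D (pullback C X f) (pullback D Y g) u"
      by (auto simp: compose_eq pullback_def[of D X] image fun_eq_iff)
  qed (simp_all add: compose_def)
qed

lemma function_subalgebra_path_algebra: "function_subalgebra (paths_from A) (path_algebra A)"
  unfolding path_algebra_def by (rule function_subalgebra_integral_algebra)

lemma paths_from_path_maps: "paths_from A \<subseteq> path_maps (fst A)"
  by (auto simp: paths_from_def)

lemma pullback_path_algebra_in:
  assumes "f \<in> based_maps A B" "u \<in> carrier (path_algebra B)"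
  shows "pullback (carrier (path_algebra B)) (paths_from A) f u \<in> carrier (path_algebra A)"
  using pullback_in_integral_algebra[OF assms(2)[unfolded path_algebra_def] paths_from_path_maps
      path_image_in_paths_from[OF assms(1)]] assms(2)
  by (simp add: pullback_def path_algebra_def)

lemma pullback_loop_algebra_in:
  assumes "f \<in> based_maps A B" "u \<in> carrier (loop_algebra B)"
  shows "(\<lambda>\<alpha>\<in>loops_at A. u (path_image f \<alpha>)) \<in> carrier (loop_algebra A)"
  unfolding loop_algebra_def
  by (rule pullback_in_integral_algebra[OF assms(2)[unfolded loop_algebra_def] loops_at_path_maps
        path_image_in_loops[OF assms(1)]])

lemma pullback_pi1_algebra_in:
  assumes f: "f \<in> based_maps A B" and u: "u \<in> carrier (pi1_algebra B)"
  shows "(\<lambda>\<alpha>\<in>loops_at A. u (path_image f \<alpha>)) \<in> carrier (pi1_algebra A)"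
  using u pullback_loop_algebra_in[OF f, of u] path_image_in_loops[OF f]
    one_step_C_homotopic_image[OF _ based_mapsD(1)[OF f]]
  by (simp add: pi1_carrier_iff)

lemma pullback_hopf_homs:
  fixes H K :: "('k::field_char_0, 'v path_map \<Rightarrow> 'k) hopf"
  assumes H: "function_hopf (loops_at A) H path_concat (trivial_loop (snd A)) path_reverse"
    and K: "function_hopf (loops_at B) K path_concat (trivial_loop (snd B)) path_reverse"
    and f: "f \<in> based_maps A B"
    and closed: "\<And>u. u \<in> carrier K \<Longrightarrow> (\<lambda>\<alpha>\<in>loops_at A. u (path_image f \<alpha>)) \<in> carrier H"
  shows "pullback (carrier K) (loops_at A) f \<in> hopf_homs K H"
proof (rule hopf_homs_by_eval[OF H K, where F = "path_image f"])
  have "path_image f (trivial_loop (snd A)) = trivial_loop (snd B)"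
    using based_mapsD(2)[OF f] by (auto simp: path_image_def trivial_loop_def fun_eq_iff)
  then show "u (path_image f (trivial_loop (snd A))) = u (trivial_loop (snd B))" for u :: "'v path_map \<Rightarrow> 'k"
    by simp
qed (simp_all add: pullback_def closed path_image_in_loops[OF f] path_image_concat_loops[where A = A] path_image_reverse)

text \<open>
  The reason why \<open>pi1\<close> is defined on the homotopy category. For adjacent \<open>f\<close> and \<open>g\<close>, the paths \<open>f \<circ> \<alpha>\<close> and \<open>g \<circ> \<alpha>\<close>
  have the same line, and the arrows between \<open>f v\<close> and \<open>g v\<close> are the rungs of a cylinder over the identity.
  The base point is fixed, so the ends of the loops stay in place.
\<close>

lemma pullback_homotopic:
  assumes A: "based_digraph A" and fg: "homotopic_maps A B f g" and u: "u \<in> carrier (pi1_algebra B)"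
    and \<alpha>: "\<alpha> \<in> loops_at A"
  shows "u (path_image f \<alpha>) = u (path_image g \<alpha>)"
proof -
  have adjacent: "one_step_C_homotopic (fst B) (path_image f \<alpha>) (path_image g \<alpha>)"
    if adj: "adjacent_maps A B f g" for f g
  proof (rule one_step_C_homotopicI[where h = "\<lambda>i\<in>{0..path_len \<alpha>}. i" and R = "weak_arc (fst B)"])
    note \<alpha>D = loops_atD[OF \<alpha>]
    have fg: "f \<in> based_maps A B" "g \<in> based_maps A B"
      using adj by (simp_all add: adjacent_maps_def)
    note f = based_mapsD[OF fg(1)] and g = based_mapsD[OF fg(2)]
    note line = path_mapsD(1)[OF \<alpha>D(1)]
    show "path_image f \<alpha> \<in> path_maps (fst B)" "path_image g \<alpha> \<in> path_maps (fst B)"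
      by (rule path_image_in_path_maps[OF \<alpha>D(1)], fact f g)+
    show "path_fun (path_image f \<alpha>) 0 = path_fun (path_image g \<alpha>) 0"
      "path_fun (path_image f \<alpha>) (path_len (path_image f \<alpha>)) = path_fun (path_image g \<alpha>) (path_len (path_image g \<alpha>))"
      by (simp_all add: \<alpha>D f g)
    show "shrinking_map (path_len (path_image f \<alpha>)) (path_line (path_image f \<alpha>))
        (path_len (path_image g \<alpha>)) (path_line (path_image g \<alpha>)) (\<lambda>i\<in>{0..path_len \<alpha>}. i)"
      unfolding path_image_simps
      by (rule shrinking_mapI[OF line line]) (auto dest: line_digraph_arcD[OF line])
    show "weak_arc (fst B) (path_fun (path_image f \<alpha>) i) (path_fun (path_image g \<alpha>) ((\<lambda>i\<in>{0..path_len \<alpha>}. i) i))"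
      if "i \<le> path_len (path_image f \<alpha>)" for i
      using that adj path_mapsD(3)[OF \<alpha>D(1)] by (simp add: adjacent_maps_def)
    show "weak_arc (fst B) \<in> rung_relations (fst B)"
      by (simp add: rung_relations_def)
  qed
  have loops: "path_image f \<alpha> \<in> loops_at B" if "f \<in> based_maps A B" for f
    by (rule path_image_in_loops[OF that \<alpha>])
  have invariant: "u (path_image f \<alpha>) = u (path_image g \<alpha>)" if "adjacent_maps A B f g" for f g
    using u adjacent[OF that] that loops by (simp add: pi1_carrier_iff adjacent_maps_def)
  have "equivclp (adjacent_maps A B) f g"
    using fg by (simp add: homotopic_maps_iff[OF A])
  then show ?thesis
  proof (induction rule: equivclp_induct)
    case (step g k)
    from step.hyps(2) have "u (path_image g \<alpha>) = u (path_image k \<alpha>)"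
      using invariant[of g k] invariant[of k g] by (elim disjE) simp_all
    with step.IH show ?case by simp
  qed simp
qed

abbreviation "path_pullback A B f \<equiv> pullback (carrier (path_algebra B)) (paths_from A) f"
abbreviation "loop_pullback A B f \<equiv> pullback (carrier (loop_algebra B)) (loops_at A) f"
abbreviation "pi1_pullback A B f \<equiv> pullback (carrier (pi1_algebra B)) (loops_at A) f"
abbreviation "loop_functor A \<equiv> loop_hopf_on A (loop_algebra A)"
abbreviation "pi1_functor A \<equiv> loop_hopf_on A (pi1_algebra A)"

text \<open>
  Path integrals and loop integrals differ only in the set of path maps on which they are functions and in
  the structure preserved by pullback.
\<close>

lemma contravariant_functor_pullback:
  fixes D :: "('o, ('v path_map \<Rightarrow> 'k) \<Rightarrow> 'v path_map \<Rightarrow> 'k) cat"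
  assumes D: "category D" "\<And>A. Id D (F A) = restrict id (S A)"
      "\<And>A B C \<psi> \<phi>. Comp D (F A) (F B) (F C) \<psi> \<phi> = compose (S A) \<psi> \<phi>"
    and Ob: "\<And>A. based_digraph A \<Longrightarrow> F A \<in> Obj D"
    and S: "\<And>A. S A \<subseteq> extensional (X A)" and X: "\<And>A. X A \<subseteq> path_maps (fst A)"
    and image: "\<And>A B f \<alpha>. f \<in> based_maps A B \<Longrightarrow> \<alpha> \<in> X A \<Longrightarrow> path_image f \<alpha> \<in> X B"
    and closed: "\<And>A B f u. f \<in> based_maps A B \<Longrightarrow> u \<in> S B \<Longrightarrow> pullback (S B) (X A) f u \<in> S A"
    and hom: "\<And>A B f. based_digraph A \<Longrightarrow> based_digraph B \<Longrightarrow> f \<in> based_maps A B \<Longrightarrow>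
      pullback (S B) (X A) f \<in> Hom D (F B) (F A)"
  shows "contravariant_functor dig_cat D F (\<lambda>A B. pullback (S B) (X A))"
  unfolding contravariant_functor_def
proof (intro conjI ballI category_dig_cat D(1))
  fix A :: "'v based_digraph" assume "A \<in> Obj dig_cat"
  then show "F A \<in> Obj D"
    by (simp add: dig_cat_def Ob)
  show "pullback (S A) (X A) (Id dig_cat A) = Id D (F A)"
    by (simp add: dig_cat_def D(2) pullback_id[OF S X])
  fix B :: "'v based_digraph" and f
  assume "B \<in> Obj dig_cat" and f: "f \<in> Hom dig_cat A B"
  with \<open>A \<in> Obj dig_cat\<close> show "pullback (S B) (X A) f \<in> Hom D (F B) (F A)"
    by (simp add: dig_cat_def hom)
  fix C :: "'v based_digraph" and g
  assume "g \<in> Hom dig_cat B C"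
  with f have fg: "f \<in> based_maps A B" "g \<in> based_maps B C"
    by (simp_all add: dig_cat_def)
  show "pullback (S C) (X A) (Comp dig_cat A B C g f)
      = Comp D (F C) (F B) (F A) (pullback (S B) (X A) f) (pullback (S C) (X B) g)"
    unfolding D(3) using pullback_comp[OF X image[OF fg(1)] closed[OF fg(2)]] by (simp add: dig_cat_def)
qed

lemma contravariant_functor_path_algebra:
  "contravariant_functor dig_cat (algebra_cat :: (('k::field_char_0, 'v path_map \<Rightarrow> 'k) module, _) cat)
     path_algebra path_pullback"
proof (rule contravariant_functor_pullback[OF category_algebra_cat])
  fix A B :: "'v based_digraph" and f
  interpret A: function_subalgebra "paths_from A" "path_algebra A :: ('k, 'v path_map \<Rightarrow> 'k) module"
    by (rule function_subalgebra_path_algebra)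
  show "(path_algebra A :: ('k, 'v path_map \<Rightarrow> 'k) module) \<in> Obj algebra_cat"
    using A.k_algebra_functions by (simp add: algebra_cat_def)
  show "carrier (path_algebra A :: ('k, 'v path_map \<Rightarrow> 'k) module) \<subseteq> extensional (paths_from A)"
    by (rule A.extensional)
  assume f: "f \<in> based_maps A B"
  have "path_pullback A B f \<in> algebra_homs (path_algebra B) (path_algebra A :: ('k, 'v path_map \<Rightarrow> 'k) module)"
    by (rule algebra_homs_by_eval[where F = "path_image f", OF A.function_subalgebra_axioms function_subalgebra_path_algebra
          pullback_path_algebra_in[OF f] path_image_in_paths_from[OF f]]) (simp_all add: pullback_def)
  then show "path_pullback A B f \<in> Hom algebra_cat (path_algebra B) (path_algebra A :: ('k, 'v path_map \<Rightarrow> 'k) module)"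
    by (simp add: algebra_cat_def)
qed (simp_all add: algebra_cat_def paths_from_path_maps path_image_in_paths_from pullback_path_algebra_in)

lemma hopf_cat_simps:
  "Obj hopf_cat = {H. hopf_algebra H}" "Hom hopf_cat H L = hopf_homs H L \<inter> extensional (carrier H)"
  "Id hopf_cat H = restrict id (carrier H)" "Comp hopf_cat H L M \<psi> \<phi> = compose (carrier H) \<psi> \<phi>"
  by (simp_all add: hopf_cat_def)

lemma contravariant_functor_loop_algebra:
  "contravariant_functor dig_cat (hopf_cat :: (('k::field_char_0, 'v path_map \<Rightarrow> 'k) hopf, _) cat)
     loop_functor loop_pullback"
proof (rule contravariant_functor_pullback[OF category_hopf_cat])
  fix A B :: "'v based_digraph" and f u
  show "carrier (loop_algebra A :: ('k, 'v path_map \<Rightarrow> 'k) module) \<subseteq> extensional (loops_at A)"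
    by (rule function_subalgebra.extensional[OF function_subalgebra_loop_algebra])
  show "loop_pullback A B f u \<in> carrier (loop_algebra A)"
    if "f \<in> based_maps A B" "u \<in> carrier (loop_algebra B :: ('k, 'v path_map \<Rightarrow> 'k) module)"
    using pullback_loop_algebra_in[OF that] that(2) by (simp add: pullback_def)
  assume A: "based_digraph A"
  show "(loop_functor A :: ('k, 'v path_map \<Rightarrow> 'k) hopf) \<in> Obj hopf_cat"
    using function_hopf.hopf_algebra[OF function_hopf_loop_algebra[OF A]] by (simp add: hopf_cat_simps)
  assume B: "based_digraph B" and f: "f \<in> based_maps A B"
  have "pullback (carrier (loop_functor B)) (loops_at A) f
      \<in> hopf_homs (loop_functor B) (loop_functor A :: ('k, 'v path_map \<Rightarrow> 'k) hopf)"
    by (rule pullback_hopf_homs[OF function_hopf_loop_algebra[OF A] function_hopf_loop_algebra[OF B] f])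
      (simp add: pullback_loop_algebra_in[OF f])
  then show "loop_pullback A B f \<in> Hom hopf_cat (loop_functor B) (loop_functor A :: ('k, 'v path_map \<Rightarrow> 'k) hopf)"
    by (simp add: hopf_cat_simps)
qed (simp_all add: hopf_cat_simps loops_at_path_maps path_image_in_loops)

text \<open>On homotopy classes the pullback is that of an arbitrary representative.\<close>

definition class_pullback ::
  "'v based_digraph \<Rightarrow> 'v based_digraph \<Rightarrow> ('v \<Rightarrow> 'v) set \<Rightarrow> ('v path_map \<Rightarrow> 'k::field_char_0) \<Rightarrow> 'v path_map \<Rightarrow> 'k" where
  "class_pullback A B \<Phi> = pi1_pullback A B (SOME f. f \<in> \<Phi>)"

lemma class_pullback_homotopy_class:
  assumes A: "based_digraph A" and f: "f \<in> based_maps A B"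
  shows "class_pullback A B (homotopy_class A B f) = pi1_pullback A B f"
proof -
  define g where "g = (SOME g. g \<in> homotopy_class A B f)"
  have "g \<in> homotopy_class A B f"
    unfolding g_def by (rule someI[where P = "\<lambda>g. g \<in> homotopy_class A B f", OF homotopy_class_self[OF A f]])
  then have "homotopic_maps A B f g"
    by (rule homotopy_class_memD)
  then have "u (path_image g \<alpha>) = u (path_image f \<alpha>)"
    if "u \<in> carrier (pi1_algebra B)" "\<alpha> \<in> loops_at A" for u :: "'a path_map \<Rightarrow> 'b" and \<alpha>
    using pullback_homotopic[OF A _ that] by metis
  then show ?thesis
    unfolding class_pullback_def g_def[symmetric] by (auto simp: pullback_def fun_eq_iff)
qed

lemma contravariant_functor_pi1_algebra:
  "contravariant_functor hdig_cat (hopf_cat :: (('k::field_char_0, 'v path_map \<Rightarrow> 'k) hopf, _) cat)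
     pi1_functor class_pullback"
  unfolding contravariant_functor_def hdig_cat_simps hopf_cat_simps representative_hopf_simps
proof (intro conjI ballI category_hdig_cat category_hopf_cat)
  fix A :: "'v based_digraph" assume "A \<in> {A. based_digraph A}"
  then have A: "based_digraph A" by simp
  then interpret function_hopf "loops_at A" "pi1_functor A :: ('k, 'v path_map \<Rightarrow> 'k) hopf"
    path_concat "trivial_loop (snd A)" path_reverse
    by (rule function_hopf_pi1_algebra)
  show "(pi1_functor A :: ('k, 'v path_map \<Rightarrow> 'k) hopf) \<in> {H. hopf_algebra H}"
    using hopf_algebra by simp
  show "class_pullback A A (homotopy_class A A (restrict id (pverts (fst A))))
      = restrict id (carrier (pi1_algebra A :: ('k, 'v path_map \<Rightarrow> 'k) module))"
    using pullback_id[OF extensional loops_at_path_maps]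
    by (simp add: class_pullback_homotopy_class A based_maps_id)
next
  fix A B :: "'v based_digraph" and \<Phi>
  assume "A \<in> {A. based_digraph A}" "B \<in> {A. based_digraph A}" and "\<Phi> \<in> based_maps A B // homotopy_rel A B"
  then have AB: "based_digraph A" "based_digraph B"
    and \<Phi>: "\<Phi> \<in> based_maps A B // homotopy_rel A B"
    by simp_all
  obtain f where f: "f \<in> based_maps A B" "\<Phi> = homotopy_class A B f"
    using \<Phi> by (rule homotopy_class_cases)
  have "pullback (carrier (pi1_functor B)) (loops_at A) f
      \<in> hopf_homs (pi1_functor B) (pi1_functor A :: ('k, 'v path_map \<Rightarrow> 'k) hopf)"
    by (rule pullback_hopf_homs[OF function_hopf_pi1_algebra[OF AB(1)] function_hopf_pi1_algebra[OF AB(2)] f(1)])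
      (simp add: pullback_pi1_algebra_in[OF f(1)])
  then show "class_pullback A B \<Phi> \<in> hopf_homs (pi1_functor B) (pi1_functor A :: ('k, 'v path_map \<Rightarrow> 'k) hopf)
      \<inter> extensional (carrier (pi1_algebra B))"
    by (simp add: class_pullback_homotopy_class AB f)
next
  fix A B C :: "'v based_digraph" and \<Phi> \<Psi>
  assume "A \<in> {A. based_digraph A}" "B \<in> {A. based_digraph A}" "C \<in> {A. based_digraph A}"
    and classes: "\<Phi> \<in> based_maps A B // homotopy_rel A B" "\<Psi> \<in> based_maps B C // homotopy_rel B C"
  then have AB: "based_digraph A" "based_digraph B" by simp_all
  obtain f where f: "f \<in> based_maps A B" "\<Phi> = homotopy_class A B f"
    using classes(1) by (rule homotopy_class_cases)
  obtain g where g: "g \<in> based_maps B C" "\<Psi> = homotopy_class B C g"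
    using classes(2) by (rule homotopy_class_cases)
  have "pi1_pullback A C (compose (pverts (fst A)) g f)
      = compose (carrier (pi1_algebra C :: ('k, 'v path_map \<Rightarrow> 'k) module)) (pi1_pullback A B f) (pi1_pullback B C g)"
    by (rule pullback_comp[OF loops_at_path_maps path_image_in_loops[OF f(1)]])
       (simp_all add: pullback_def[of "carrier (pi1_algebra C)"] pullback_pi1_algebra_in[OF g(1)])
  then show "class_pullback A C (Comp hdig_cat A B C \<Psi> \<Phi>)
      = compose (carrier (pi1_algebra C :: ('k, 'v path_map \<Rightarrow> 'k) module)) (class_pullback A B \<Phi>) (class_pullback B C \<Psi>)"
    by (simp add: f g AB homotopy_class_comp class_pullback_homotopy_class based_maps_comp[OF AB(1) f(1) g(1)])
qed

theorem theorem1p2: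
  shows "\<exists>(P_mor :: 'v based_digraph \<Rightarrow> 'v based_digraph \<Rightarrow> ('v \<Rightarrow> 'v) \<Rightarrow>
              ('v path_map \<Rightarrow> 'k::field_char_0) \<Rightarrow> ('v path_map \<Rightarrow> 'k))
           (Q :: 'v based_digraph \<Rightarrow> ('k, 'v path_map \<Rightarrow> 'k) hopf)
           (Q_mor :: 'v based_digraph \<Rightarrow> 'v based_digraph \<Rightarrow> ('v \<Rightarrow> 'v) \<Rightarrow>
              ('v path_map \<Rightarrow> 'k) \<Rightarrow> ('v path_map \<Rightarrow> 'k))
           (pi1 :: 'v based_digraph \<Rightarrow> ('k, 'v path_map \<Rightarrow> 'k) hopf)
           (pi1_mor :: 'v based_digraph \<Rightarrow> 'v based_digraph \<Rightarrow> ('v \<Rightarrow> 'v) set \<Rightarrow>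
              ('v path_map \<Rightarrow> 'k) \<Rightarrow> ('v path_map \<Rightarrow> 'k)).
      contravariant_functor dig_cat algebra_cat path_algebra P_mor \<and>
      acts_by_pullback path_integral_from P_mor \<and>
      contravariant_functor dig_cat hopf_cat Q Q_mor \<and>
      (\<forall>A. based_digraph A \<longrightarrow> loop_hopf A (Q A)) \<and>
      acts_by_pullback loop_integral_at Q_mor \<and>
      contravariant_functor hdig_cat hopf_cat pi1 pi1_mor \<and>
      (\<forall>A. based_digraph A \<longrightarrow>
         module.truncate (pi1 A) = pi1_algebra A \<and> hopf_subalgebra (pi1 A) (Q A)) \<and>
      (\<forall>A B f. based_digraph A \<longrightarrow> based_digraph B \<longrightarrow> f \<in> based_maps A B \<longrightarrow>
         pi1_mor A B (homotopy_class A B f) = restrict (Q_mor A B f) (carrier (pi1 B)))"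
proof (intro exI conjI allI impI)
  show "contravariant_functor dig_cat algebra_cat path_algebra
      (path_pullback :: _ \<Rightarrow> _ \<Rightarrow> _ \<Rightarrow> ('v path_map \<Rightarrow> 'k) \<Rightarrow> ('v path_map \<Rightarrow> 'k))"
    by (rule contravariant_functor_path_algebra)
  show "acts_by_pullback path_integral_from (path_pullback :: _ \<Rightarrow> _ \<Rightarrow> _ \<Rightarrow> ('v path_map \<Rightarrow> 'k) \<Rightarrow> ('v path_map \<Rightarrow> 'k))"
    unfolding acts_by_pullback_def pullback_def
    by (auto simp: integral_on_pullback[OF paths_from_path_maps path_image_in_paths_from]
        path_algebra_def integral_on_in)
  show "contravariant_functor dig_cat hopf_cat loop_functor
      (loop_pullback :: _ \<Rightarrow> _ \<Rightarrow> _ \<Rightarrow> ('v path_map \<Rightarrow> 'k) \<Rightarrow> ('v path_map \<Rightarrow> 'k))"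
    by (rule contravariant_functor_loop_algebra)
  show "loop_hopf A (loop_functor A :: ('k, 'v path_map \<Rightarrow> 'k) hopf)" if "based_digraph A" for A
    using that by (rule loop_hopf_loop_hopf_on)
  show "acts_by_pullback loop_integral_at (loop_pullback :: _ \<Rightarrow> _ \<Rightarrow> _ \<Rightarrow> ('v path_map \<Rightarrow> 'k) \<Rightarrow> ('v path_map \<Rightarrow> 'k))"
    unfolding acts_by_pullback_def pullback_def
    by (auto simp: integral_on_pullback[OF loops_at_path_maps path_image_in_loops] loop_integral_in)
  show "contravariant_functor hdig_cat hopf_cat pi1_functor
      (class_pullback :: _ \<Rightarrow> _ \<Rightarrow> _ \<Rightarrow> ('v path_map \<Rightarrow> 'k) \<Rightarrow> ('v path_map \<Rightarrow> 'k))"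
    by (rule contravariant_functor_pi1_algebra)
  fix A :: "'v based_digraph" assume A: "based_digraph A"
  show "module.truncate (pi1_functor A :: ('k, 'v path_map \<Rightarrow> 'k) hopf) = pi1_algebra A"
    by (rule truncate_representative_hopf)
  show "hopf_subalgebra (pi1_functor A) (loop_functor A :: ('k, 'v path_map \<Rightarrow> 'k) hopf)"
    using A by (rule hopf_subalgebra_pi1)
  fix B :: "'v based_digraph" and f assume "f \<in> based_maps A B"
  then have "class_pullback A B (homotopy_class A B f) = (pi1_pullback A B f :: ('v path_map \<Rightarrow> 'k) \<Rightarrow> _)"
    by (rule class_pullback_homotopy_class[OF A])
  also have "\<dots> = restrict (loop_pullback A B f) (carrier (pi1_algebra B))"
    using subsetD[OF pi1_carrier_subset, of _ B] by (auto simp: pullback_def fun_eq_iff)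
  finally show "class_pullback A B (homotopy_class A B f)
      = restrict (loop_pullback A B f) (carrier (pi1_functor B :: ('k, 'v path_map \<Rightarrow> 'k) hopf))"
    by simp
qed

end
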